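(* Let $a_{ij}$ ($i=1,2,3$, $j=0,1,2,3$) be complex constants, and consider the system of linear partial differential equations in the variables $(t_1,t_2,t_3)$ generated by the operator $$E_3=(1-t_1^2)\partial_{11}+2(t_3-t_1t_2)\partial_{12}+(1-t_2^2)\partial_{22}+a_{31}t_1\partial_1+a_{32}t_2\partial_2+a_{33}t_3\partial_3+a_{30}$$ and the two operators obtained from it by successive application of the cyclic permutation $1\to2\to3\to1$ of indices, that is, $$E_1=(1-t_2^2)\partial_{22}+2(t_1-t_2t_3)\partial_{23}+(1-t_3^2)\partial_{33}+a_{11}t_1\partial_1+a_{12}t_2\partial_2+a_{13}t_3\partial_3+a_{10},$$ $$E_2=(1-t_3^2)\partial_{33}+2(t_2-t_3t_1)\partial_{31}+(1-t_1^2)\partial_{11}+a_{21}t_1\partial_1+a_{22}t_2\partial_2+a_{23}t_3\partial_3+a_{20}.$$ This system is of rank $8$ if and only if $$a_{11}=a_{22}=a_{33}=0\quad\text{and}\quad a_{12}=a_{13}=a_{21}=a_{23}=a_{31}=a_{32}.$$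
   Context: Notation: $\partial_i=\partial/\partial t_i$, $\partial_{ij}=\partial^2/\partial t_i\partial t_j$. A system of linear differential equations is identified with the left ideal generated by the operators. Its rank is the dimension of the space of local holomorphic solutions at a generic point (the holonomic rank). *)

theory Defs
  imports "HOL-Analysis.Analysis" "HOL-Computational_Algebra.Polynomial"
begin

text \<open>Polynomials in \<open>t\<^sub>1, t\<^sub>2, t\<^sub>3\<close> are represented as iterated univariate polynomials
  \<open>\<complex>[t\<^sub>1][t\<^sub>2][t\<^sub>3]\<close>. The third coordinate is the index \<open>3 :: 3\<close>, which is the same element as
  \<open>0 :: 3\<close>.\<close>

definition eval3 :: "complex poly poly poly \<Rightarrow> complex ^ 3 \<Rightarrow> complex" where
  "eval3 p t = poly (poly (poly p [:[:t $ 3:]:]) [:t $ 2:]) (t $ 1)"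

text \<open>Holomorphy in several variables: real Frechet differentiability with a complex-linear
  derivative at every point.\<close>

definition holomorphic3_on :: "(complex ^ 3 \<Rightarrow> complex) \<Rightarrow> (complex ^ 3) set \<Rightarrow> bool" where
  "holomorphic3_on u U \<longleftrightarrow>
     (\<forall>t\<in>U. \<exists>c :: complex ^ 3. (u has_derivative (\<lambda>h. \<Sum>i\<in>UNIV. c $ i * h $ i)) (at t))"

definition partial :: "3 \<Rightarrow> (complex ^ 3 \<Rightarrow> complex) \<Rightarrow> complex ^ 3 \<Rightarrow> complex" where
  "partial i u t = deriv (\<lambda>s. u (t + axis i s)) 0"

definition partial2 :: "3 \<Rightarrow> 3 \<Rightarrow> (complex ^ 3 \<Rightarrow> complex) \<Rightarrow> complex ^ 3 \<Rightarrow> complex" where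
  "partial2 i j u = partial i (partial j u)"

text \<open>Differential operators are represented by their action on functions. Since Isabelle functions
  are total, an operator also has a (meaningless) value at non-differentiable functions; below
  operators are only applied to functions near points where these are holomorphic.\<close>

type_synonym diffop = "(complex ^ 3 \<Rightarrow> complex) \<Rightarrow> (complex ^ 3 \<Rightarrow> complex)"

text \<open>The left ideal generated by \<open>G\<close> in the Weyl algebra
  \<open>\<complex>[t\<^sub>1,t\<^sub>2,t\<^sub>3]\<langle>\<partial>\<^sub>1,\<partial>\<^sub>2,\<partial>\<^sub>3\<rangle>\<close>. As this algebra is generated by the polynomials and the \<open>\<partial>\<^sub>i\<close>,
  closure under left multiplication by these suffices.\<close>

inductive_set left_ideal :: "diffop set \<Rightarrow> diffop set" for G :: "diffop set" where
  gen: "P \<in> G \<Longrightarrow> P \<in> left_ideal G"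
| zero: "(\<lambda>u t. 0) \<in> left_ideal G"
| add: "P \<in> left_ideal G \<Longrightarrow> Q \<in> left_ideal G \<Longrightarrow> (\<lambda>u t. P u t + Q u t) \<in> left_ideal G"
| mult_poly: "P \<in> left_ideal G \<Longrightarrow> (\<lambda>u t. eval3 q t * P u t) \<in> left_ideal G"
| mult_partial: "P \<in> left_ideal G \<Longrightarrow> (\<lambda>u. partial i (P u)) \<in> left_ideal G"

definition local_solutions :: "diffop set \<Rightarrow> complex ^ 3 \<Rightarrow> (complex ^ 3 \<Rightarrow> complex) set" where
  "local_solutions I p =
     {u. \<exists>U. open U \<and> p \<in> U \<and> holomorphic3_on u U \<and> (\<forall>P\<in>I. \<forall>t\<in>U. P u t = 0)}"

text \<open>The space of germs at \<open>p\<close> of local solutions has (finite) dimension \<open>r\<close>, i.e. it has a basis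
  \<open>B 0, \<dots>, B (r - 1)\<close>. Two local solutions define the same germ iff they agree near \<open>p\<close>, so linear
  relations are only required to hold in some neighbourhood of \<open>p\<close>.\<close>

definition solution_germs_dim :: "diffop set \<Rightarrow> complex ^ 3 \<Rightarrow> nat \<Rightarrow> bool" where
  "solution_germs_dim I p r \<longleftrightarrow>
     (\<exists>B :: nat \<Rightarrow> complex ^ 3 \<Rightarrow> complex.
        (\<forall>k<r. B k \<in> local_solutions I p) \<and>
        (\<forall>c :: nat \<Rightarrow> complex.
           (\<forall>\<^sub>F t in nhds p. (\<Sum>k<r. c k * B k t) = 0) \<longrightarrow> (\<forall>k<r. c k = 0)) \<and>
        (\<forall>u\<in>local_solutions I p. \<exists>c :: nat \<Rightarrow> complex.
           \<forall>\<^sub>F t in nhds p. u t = (\<Sum>k<r. c k * B k t)))"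

text \<open>A generic point is a point outside some proper algebraic hypersurface. The rank is a
  relation rather than a function, because the solution space may be infinite-dimensional.\<close>

definition has_rank :: "diffop set \<Rightarrow> nat \<Rightarrow> bool" where
  "has_rank I r \<longleftrightarrow> (\<exists>h. h \<noteq> 0 \<and> (\<forall>p. eval3 h p \<noteq> 0 \<longrightarrow> solution_germs_dim I p r))"

definition E1 :: "(nat \<Rightarrow> nat \<Rightarrow> complex) \<Rightarrow> diffop" where
  "E1 a u t =
     (1 - (t $ 2)\<^sup>2) * partial2 2 2 u t
     + 2 * (t $ 1 - t $ 2 * t $ 3) * partial2 2 3 u t
     + (1 - (t $ 3)\<^sup>2) * partial2 3 3 u t
     + a 1 1 * t $ 1 * partial 1 u t + a 1 2 * t $ 2 * partial 2 u t
     + a 1 3 * t $ 3 * partial 3 u t + a 1 0 * u t"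

definition E2 :: "(nat \<Rightarrow> nat \<Rightarrow> complex) \<Rightarrow> diffop" where
  "E2 a u t =
     (1 - (t $ 3)\<^sup>2) * partial2 3 3 u t
     + 2 * (t $ 2 - t $ 3 * t $ 1) * partial2 3 1 u t
     + (1 - (t $ 1)\<^sup>2) * partial2 1 1 u t
     + a 2 1 * t $ 1 * partial 1 u t + a 2 2 * t $ 2 * partial 2 u t
     + a 2 3 * t $ 3 * partial 3 u t + a 2 0 * u t"

definition E3 :: "(nat \<Rightarrow> nat \<Rightarrow> complex) \<Rightarrow> diffop" where
  "E3 a u t =
     (1 - (t $ 1)\<^sup>2) * partial2 1 1 u t
     + 2 * (t $ 3 - t $ 1 * t $ 2) * partial2 1 2 u t
     + (1 - (t $ 2)\<^sup>2) * partial2 2 2 u t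
     + a 3 1 * t $ 1 * partial 1 u t + a 3 2 * t $ 2 * partial 2 u t
     + a 3 3 * t $ 3 * partial 3 u t + a 3 0 * u t"

end

theory Submission
  imports Defs "HOL-Complex_Analysis.Complex_Analysis"
begin

text \<open>
  If the conditions hold, \<open>E\<^sub>1, E\<^sub>2, E\<^sub>3\<close> commute: up to additive constants they are the Laplacians of a
  sphere of (formal) dimension \<open>- a\<^sub>1\<^sub>2\<close> in each of three points, written in the scalar products \<open>t\<^sub>i\<close> of
  the points. At a generic \<open>p\<close> their symbols are three quadrics without a common zero, so that the
  functionals \<open>u \<mapsto> (\<partial>\<^sup>\<epsilon> E\<^sup>\<gamma> u)(p)\<close> with \<open>\<epsilon> \<in> {0,1}\<^sup>3\<close> and \<open>\<gamma> \<in> \<nat>\<^sup>3\<close> span all derivatives at \<open>p\<close>. Counting by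
  \<open>\<alpha> = \<epsilon> + 2\<gamma>\<close> shows that they form a basis of the functionals of each order. Prescribing \<open>0\<close> for
  \<open>\<gamma> \<noteq> 0\<close> then gives an eight-dimensional space of formal solutions. All fourth-order symbols lie in
  the ideal generated by the three quadrics, which bounds the derivatives of order \<open>n\<close> of a solution by
  those of order \<open>n - 1\<close> and \<open>n - 2\<close> and makes the formal solutions converge.

  Conversely, the eight derivatives \<open>\<partial>\<^sup>\<epsilon> u(p)\<close> always determine \<open>u\<close>, so rank eight means that they can
  be prescribed arbitrarily. The commutators \<open>[E\<^sub>1, E\<^sub>2]\<close> and \<open>[E\<^sub>2, E\<^sub>3]\<close> have order two and annihilate
  every solution; reduced modulo the \<open>E\<^sub>i\<close> to the derivatives \<open>\<partial>\<^sup>\<epsilon> u(p)\<close>, their coefficients have to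
  vanish.
\<close>

text \<open>Three quadrics in three variables without a common zero form a complete intersection:
  the quotient has Hilbert series \<open>(1 + s)^3\<close>. This is the origin of the rank
  \<open>8 = 2^3\<close>, of the top order three and of the special role of order four. The code
  replaces the general theory by explicit elimination, with \<open>gdelta\<close> as determinant in
  orders three and four. Everything algebraic happens on arrays of derivatives at one point.
  Functions enter only through reading off jets, the identity theorem and the realization of an
  array of factorial growth. Since holomorphy is defined as mere pointwise complex
  differentiability, smoothness and symmetry of the partial derivatives come first; they are drawn
  from one-variable Cauchy estimates. Commutation makes the functionals of \<open>E_i u\<close> a
  shift of those of \<open>u\<close>, which is why prescribing zeros forces
  \<open>E_i u = 0\<close>. In the converse, the relations obtained at generic points extend by
  continuity to non-generic points where a single \<open>gq\<close> vanishes; this separates the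
  constants.\<close>

no_notation fps_nth (infixl \<open>$\<close> 75)

section \<open>Holomorphic functions of three variables\<close>

lemma bounded_linear_scale_vec: "bounded_linear (\<lambda>s. s *s (h :: complex ^ 3))"
proof -
  have "linear (\<lambda>s. s *s h)"
    by (auto intro!: linearI simp: vec_eq_iff algebra_simps)
  then show ?thesis by (simp add: linear_linear)
qed

lemma axis_eq_scale: "axis i s = s *s (axis i 1 :: complex ^ 3)"
  by (simp add: axis_def vec_eq_iff)

lemma sum_axis: "(\<Sum>j\<in>UNIV. c j * (axis i s :: complex ^ 3) $ j) = c i * s"
  by (simp add: axis_def if_distrib[of "\<lambda>x. _ * x"] cong: if_cong)

lemma norm_axis_complex: "norm (axis i s :: complex ^ 3) = norm s"
  by (simp add: norm_vec_def L2_set_def axis_def if_distrib[of norm] if_distrib[of "\<lambda>x. x\<^sup>2"] cong: if_cong)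

text \<open>Restricting the derivative to the line through \<open>t\<close> in direction
  \<open>i\<close> identifies its \<open>i\<close>-th coefficient with the one-variable derivative
  in \<open>partial\<close>.\<close>

lemma holomorphic3_on_partial:
  assumes "holomorphic3_on u U" "t \<in> U"
  shows "(u has_derivative (\<lambda>h. \<Sum>i\<in>UNIV. partial i u t * h $ i)) (at t)"
proof -
  obtain c where c: "(u has_derivative (\<lambda>h. \<Sum>i\<in>UNIV. c $ i * h $ i)) (at t)"
    using assms by (auto simp: holomorphic3_on_def)
  have "partial i u t = c $ i" for i
  proof -
    have d: "((\<lambda>s. t + s *s axis i 1) has_derivative (\<lambda>s. s *s axis i 1)) (at 0)"
      using has_derivative_add[OF has_derivative_const[of t] bounded_linear_imp_has_derivative[OF bounded_linear_scale_vec]]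
      by simp
    have "(u \<circ> (\<lambda>s. t + s *s axis i 1) has_derivative (\<lambda>h. \<Sum>i\<in>UNIV. c $ i * h $ i) \<circ> (\<lambda>s. s *s axis i 1)) (at 0)"
      by (rule diff_chain_at[OF d]) (use c in simp)
    moreover have "(\<lambda>h. \<Sum>i\<in>UNIV. c $ i * h $ i) \<circ> (\<lambda>s. s *s axis i 1) = (*) (c $ i)"
      by (simp add: fun_eq_iff sum_axis flip: axis_eq_scale)
    ultimately have "((\<lambda>s. u (t + axis i s)) has_field_derivative (c $ i)) (at 0)"
      by (simp add: has_field_derivative_def o_def flip: axis_eq_scale)
    then show ?thesis
      by (simp add: partial_def DERIV_imp_deriv)
  qed
  with c show ?thesis by simp
qed

lemma has_derivative_imp_partial:
  assumes "(u has_derivative (\<lambda>h. \<Sum>i\<in>UNIV. c i * h $ i)) (at t)"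
  shows "partial i u t = c i"
proof -
  \<comment> \<open>\<open>holomorphic3_on\<close> asks for derivatives \<open>at t\<close>, not
    within the set, so it is meaningful even on a single point.\<close>
  have "holomorphic3_on u {t}"
    unfolding holomorphic3_on_def using assms by (auto intro!: exI[of _ "\<chi> i. c i"])
  from holomorphic3_on_partial[OF this]
  have "(\<lambda>h. \<Sum>i\<in>UNIV. partial i u t * h $ i) = (\<lambda>h. \<Sum>i\<in>UNIV. c i * h $ i)"
    using assms has_derivative_unique by blast
  from fun_cong[OF this, of "axis i 1"] show ?thesis
    by (simp add: sum_axis)
qed

lemma holomorphic3_onI:
  assumes "\<And>t. t \<in> U \<Longrightarrow> (u has_derivative (\<lambda>h. \<Sum>i\<in>UNIV. c i t * h $ i)) (at t)"
  shows "holomorphic3_on u U"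
  unfolding holomorphic3_on_def
proof
  fix t assume "t \<in> U"
  from assms[OF this] show "\<exists>c :: complex ^ 3. (u has_derivative (\<lambda>h. \<Sum>i\<in>UNIV. c $ i * h $ i)) (at t)"
    by (intro exI[of _ "\<chi> i. c i t"]) simp
qed

lemma holomorphic3_on_subset: "holomorphic3_on u U \<Longrightarrow> V \<subseteq> U \<Longrightarrow> holomorphic3_on u V"
  by (auto simp: holomorphic3_on_def)

lemma holomorphic3_on_imp_continuous_on: "holomorphic3_on u U \<Longrightarrow> continuous_on U u"
  unfolding holomorphic3_on_def
  by (meson continuous_at_imp_continuous_on has_derivative_continuous)

lemma
  assumes "holomorphic3_on u U" "holomorphic3_on v U"
  shows holomorphic3_on_add: "holomorphic3_on (\<lambda>t. u t + v t) U"
    and partial_add: "t \<in> U \<Longrightarrow> partial i (\<lambda>t. u t + v t) t = partial i u t + partial i v t"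
proof -
  have "((\<lambda>t. u t + v t) has_derivative (\<lambda>h. \<Sum>i\<in>UNIV. (partial i u t + partial i v t) * h $ i)) (at t)"
    if "t \<in> U" for t
    using has_derivative_add[OF assms[THEN holomorphic3_on_partial, OF that]]
    by (simp add: sum.distrib distrib_right)
  from holomorphic3_onI[OF this] has_derivative_imp_partial[OF this]
  show "holomorphic3_on (\<lambda>t. u t + v t) U"
    "t \<in> U \<Longrightarrow> partial i (\<lambda>t. u t + v t) t = partial i u t + partial i v t" by blast+
qed

lemma
  assumes "holomorphic3_on u U" "holomorphic3_on v U"
  shows holomorphic3_on_mult: "holomorphic3_on (\<lambda>t. u t * v t) U"
    and partial_mult: "t \<in> U \<Longrightarrow> partial i (\<lambda>t. u t * v t) t = u t * partial i v t + partial i u t * v t"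
proof -
  have "((\<lambda>t. u t * v t) has_derivative (\<lambda>h. \<Sum>i\<in>UNIV. (u t * partial i v t + partial i u t * v t) * h $ i)) (at t)"
    if "t \<in> U" for t
    using has_derivative_mult[OF assms[THEN holomorphic3_on_partial, OF that]]
    by (simp add: sum.distrib sum_distrib_left algebra_simps)
  from holomorphic3_onI[OF this] has_derivative_imp_partial[OF this]
  show "holomorphic3_on (\<lambda>t. u t * v t) U"
    "t \<in> U \<Longrightarrow> partial i (\<lambda>t. u t * v t) t = u t * partial i v t + partial i u t * v t" by blast+
qed

lemma
  shows holomorphic3_on_const: "holomorphic3_on (\<lambda>t. c) U"
    and partial_const: "partial i (\<lambda>t. c) t = 0"
proof -
  have "((\<lambda>t. c) has_derivative (\<lambda>h. \<Sum>i\<in>UNIV. 0 * h $ i)) (at t)" for t :: "complex ^ 3"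
    by simp
  from holomorphic3_onI[OF this] has_derivative_imp_partial[OF this]
  show "holomorphic3_on (\<lambda>t. c) U" "partial i (\<lambda>t. c) t = 0" by auto
qed

lemma
  shows holomorphic3_on_coord: "holomorphic3_on (\<lambda>t. t $ j) U"
    and partial_coord: "partial i (\<lambda>t. t $ j) t = (if i = j then 1 else 0)"
proof -
  have "((\<lambda>t. t $ j) has_derivative (\<lambda>h. \<Sum>i\<in>UNIV. (if i = j then 1 else 0) * h $ i)) (at t)" for t :: "complex ^ 3"
    using bounded_linear_imp_has_derivative[OF bounded_linear_vec_nth]
    by (simp add: if_distrib[of "\<lambda>x. x * _"] cong: if_cong)
  from holomorphic3_onI[OF this] has_derivative_imp_partial[OF this]
  show "holomorphic3_on (\<lambda>t. t $ j) U" "partial i (\<lambda>t. t $ j) t = (if i = j then 1 else 0)" by auto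
qed

lemma
  assumes "holomorphic3_on u V" "\<And>t. t \<in> U \<Longrightarrow> t + e \<in> V"
  shows holomorphic3_on_translate: "holomorphic3_on (\<lambda>t. u (t + e)) U"
    and partial_translate: "t \<in> U \<Longrightarrow> partial i (\<lambda>t. u (t + e)) t = partial i u (t + e)"
proof -
  have "((\<lambda>t. u (t + e)) has_derivative (\<lambda>h. \<Sum>i\<in>UNIV. partial i u (t + e) * h $ i)) (at t)"
    if "t \<in> U" for t
  proof -
    have "((\<lambda>t. t + e) has_derivative (\<lambda>h. h)) (at t)"
      by (auto intro!: derivative_eq_intros)
    from diff_chain_at[OF this, of u] show ?thesis
      using holomorphic3_on_partial[OF assms(1) assms(2)[OF that]] by (simp add: o_def)
  qed
  from holomorphic3_onI[OF this] has_derivative_imp_partial[OF this]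
  show "holomorphic3_on (\<lambda>t. u (t + e)) U"
    "t \<in> U \<Longrightarrow> partial i (\<lambda>t. u (t + e)) t = partial i u (t + e)" by blast+
qed

lemma holomorphic3_on_cmult: "holomorphic3_on u U \<Longrightarrow> holomorphic3_on (\<lambda>t. c * u t) U"
  by (intro holomorphic3_on_mult holomorphic3_on_const)

lemma partial_cmult: "holomorphic3_on u U \<Longrightarrow> t \<in> U \<Longrightarrow> partial i (\<lambda>t. c * u t) t = c * partial i u t"
  using partial_mult[OF holomorphic3_on_const, of u U t i c] by (simp add: partial_const)

lemma holomorphic3_on_diff:
  "holomorphic3_on u U \<Longrightarrow> holomorphic3_on v U \<Longrightarrow> holomorphic3_on (\<lambda>t. u t - v t) U"
  using holomorphic3_on_add[OF _ holomorphic3_on_cmult[of v U "-1"]] by simp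

lemma partial_diff:
  "holomorphic3_on u U \<Longrightarrow> holomorphic3_on v U \<Longrightarrow> t \<in> U \<Longrightarrow>
    partial i (\<lambda>t. u t - v t) t = partial i u t - partial i v t"
  using partial_add[OF _ holomorphic3_on_cmult[of v U "-1"]] partial_cmult[of v U _ i "-1"] by simp

section \<open>Restriction to complex lines and Cauchy estimates\<close>

lemma line_has_field_derivative:
  assumes "holomorphic3_on u U" "t + s *s h \<in> U"
  shows "((\<lambda>s. u (t + s *s h)) has_field_derivative (\<Sum>i\<in>UNIV. partial i u (t + s *s h) * h $ i)) (at s)"
proof -
  have d: "((\<lambda>s. t + s *s h) has_derivative (\<lambda>s. s *s h)) (at s)"
    using has_derivative_add[OF has_derivative_const[of t] bounded_linear_imp_has_derivative[OF bounded_linear_scale_vec]]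
    by simp
  have "(\<lambda>h'. \<Sum>i\<in>UNIV. partial i u (t + s *s h) * h' $ i) \<circ> (\<lambda>s. s *s h)
      = (*) (\<Sum>i\<in>UNIV. partial i u (t + s *s h) * h $ i)"
    by (simp add: fun_eq_iff sum_distrib_right sum_distrib_left mult_ac)
  with diff_chain_at[OF d holomorphic3_on_partial[OF assms]]
  show ?thesis
    by (simp add: has_field_derivative_def o_def)
qed

lemma line_axis_has_field_derivative:
  assumes "holomorphic3_on u U" "t + axis i s \<in> U"
  shows "((\<lambda>s. u (t + axis i s)) has_field_derivative partial i u (t + axis i s)) (at s)"
  using line_has_field_derivative[of u U t s "axis i 1"] assms
  by (simp add: sum_axis flip: axis_eq_scale)

lemma axis_add_mem_ball:
  "t \<in> ball t0 (r / 2) \<Longrightarrow> norm s < r / 2 \<Longrightarrow> t + axis i s \<in> ball (t0 :: complex ^ 3) r"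
  using norm_triangle_ineq[of "t - t0" "axis i s"] norm_axis_complex[of i s]
  by (simp add: dist_norm norm_minus_commute[of t0] algebra_simps)

lemma line_axis_holomorphic:
  assumes "holomorphic3_on u (ball t0 r)" "t \<in> ball t0 (r / 2)"
  shows "(\<lambda>s. u (t + axis i s)) holomorphic_on ball 0 (r / 2)"
  unfolding holomorphic_on_def field_differentiable_def
  by (intro ballI exI, rule has_field_derivative_at_within, rule line_axis_has_field_derivative[OF assms(1)],
      rule axis_add_mem_ball[OF assms(2)]) simp

text \<open>Cauchy's inequality on the disc of radius \<open>r / 4\<close> in direction
  \<open>i\<close>, which fits into the distance \<open>r / 2\<close> that \<open>t\<close> keeps
  from the boundary.\<close>

lemma partial_Cauchy_bound:
  assumes "holomorphic3_on u (ball t0 r)" "\<And>t. t \<in> ball t0 r \<Longrightarrow> norm (u t) \<le> B"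
    and "t \<in> ball t0 (r / 2)" "0 < r"
  shows "norm (partial i u t) \<le> 4 * B / r"
proof -
  let ?f = "\<lambda>s. u (t + axis i s)"
  have hol: "?f holomorphic_on ball 0 (r / 2)" by (rule line_axis_holomorphic[OF assms(1,3)])
  have sub: "cball 0 (r / 4) \<subseteq> (ball 0 (r / 2) :: complex set)" using assms(4) by auto
  have "norm ((deriv ^^ 1) ?f 0) \<le> fact 1 * B / (r / 4) ^ 1"
  proof (rule Cauchy_inequality)
    show "?f holomorphic_on ball 0 (r / 4)" "continuous_on (cball 0 (r / 4)) ?f"
      using holomorphic_on_subset[OF hol] sub ball_subset_cball
      by (blast, meson hol holomorphic_on_imp_continuous_on holomorphic_on_subset sub)
    show "0 < r / 4" using assms(4) by simp
    show "norm (?f x) \<le> B" if "norm (0 - x) = r / 4" for x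
      by (rule assms(2), rule axis_add_mem_ball[OF assms(3)]) (use that assms(4) in simp)
  qed
  then show ?thesis by (simp add: partial_def mult.commute)
qed

text \<open>Taylor's formula with second-order remainder. The constant is
  \<open>32 = 2! * 4^2\<close>, from Cauchy's inequality for the second derivative on discs of
  radius \<open>R / 4\<close>.\<close>

lemma difference_quotient_bound:
  assumes hol: "f holomorphic_on ball 0 R" and B: "\<And>x. x \<in> ball 0 R \<Longrightarrow> norm (f x) \<le> B"
    and "0 < R" "s \<noteq> 0" "norm s < R / 2"
  shows "norm ((f s - f 0) / s - deriv f 0) \<le> 32 * B / R\<^sup>2 * norm s"
proof -
  have d2: "norm ((deriv ^^ 2) f x) \<le> 32 * B / R\<^sup>2" if "x \<in> ball 0 (R / 2)" for x
  proof -
    have sub: "cball x (R / 4) \<subseteq> ball 0 R"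
    proof
      fix y assume "y \<in> cball x (R / 4)"
      then have "norm y \<le> norm x + R / 4"
        using norm_triangle_ineq[of x "y - x"] by (simp add: dist_norm norm_minus_commute)
      with that assms(3) show "y \<in> ball 0 R" by simp
    qed
    have "norm ((deriv ^^ 2) f x) \<le> fact 2 * B / (R / 4) ^ 2"
    proof (rule Cauchy_inequality)
      show "f holomorphic_on ball x (R / 4)" "continuous_on (cball x (R / 4)) f"
        using holomorphic_on_subset[OF hol] sub ball_subset_cball
        by (blast, meson hol holomorphic_on_imp_continuous_on holomorphic_on_subset sub)
      show "0 < R / 4" using assms(3) by simp
      show "norm (f y) \<le> B" if "norm (x - y) = R / 4" for y
        by (rule B) (use sub that in \<open>auto simp: dist_norm\<close>)
    qed
    then show ?thesis by (simp add: power_divide)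
  qed
  have s: "s \<in> ball 0 (R / 2)" "0 \<in> ball 0 (R / 2)" using assms by auto
  have "norm ((deriv ^^ 0) f s - (\<Sum>i\<le>1. (deriv ^^ i) f 0 * (s - 0) ^ i / fact i))
      \<le> 32 * B / R\<^sup>2 * norm (s - 0) ^ Suc 1 / fact 1"
  proof (rule complex_Taylor[OF convex_ball _ _ s(2,1)])
    fix i and x :: complex assume "x \<in> ball 0 (R / 2)" "i \<le> (1::nat)"
    then show "((deriv ^^ i) f has_field_derivative (deriv ^^ Suc i) f x) (at x within ball 0 (R / 2))"
      using holomorphic_higher_deriv[OF hol open_ball, of i] assms(3)
      by (auto intro!: has_field_derivative_at_within simp: holomorphic_derivI)
  qed (use d2 in \<open>simp add: numeral_2_eq_2\<close>)
  then have "norm (f s - f 0 - deriv f 0 * s) \<le> 32 * B / R\<^sup>2 * norm s * norm s"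
    by (simp add: power2_eq_square algebra_simps)
  moreover have "norm ((f s - f 0) / s - deriv f 0) = norm (f s - f 0 - deriv f 0 * s) / norm s"
    using assms(4) by (simp flip: norm_divide add: diff_divide_distrib)
  ultimately show ?thesis
    using assms(4) by (simp add: pos_divide_le_eq)
qed

section \<open>Locally uniform limits\<close>

text \<open>Passing to partial derivatives costs half the radius of a ball. The local notion keeps
  \<open>U\<close> fixed, so the passage can be iterated.\<close>

definition locally_uniform_limit ::
  "(complex ^ 3) set \<Rightarrow> (nat \<Rightarrow> complex ^ 3 \<Rightarrow> complex) \<Rightarrow> (complex ^ 3 \<Rightarrow> complex) \<Rightarrow> bool" where
  "locally_uniform_limit U f g \<longleftrightarrow>
     (\<forall>t\<in>U. \<exists>r>0. ball t r \<subseteq> U \<and> uniform_limit (ball t r) f g sequentially)"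

lemma locally_uniform_limitI_ball:
  assumes "uniform_limit (ball t0 r) f g sequentially"
  shows "locally_uniform_limit (ball t0 r) f g"
  unfolding locally_uniform_limit_def
proof
  fix t assume "t \<in> ball t0 r"
  then obtain e where e: "e > 0" "ball t e \<subseteq> ball t0 r"
    using openE[OF open_ball] by blast
  then show "\<exists>r'>0. ball t r' \<subseteq> ball t0 r \<and> uniform_limit (ball t r') f g sequentially"
    using uniform_limit_on_subset[OF assms e(2)] by blast
qed

lemma locally_uniform_limit_tendsto:
  "locally_uniform_limit U f g \<Longrightarrow> t \<in> U \<Longrightarrow> (\<lambda>n. f n t) \<longlonglongrightarrow> g t"
  unfolding locally_uniform_limit_def
  by (metis tendsto_uniform_limitI centre_in_ball)

text \<open>By \<open>partial_Cauchy_bound\<close> for \<open>f m - f n\<close> the partial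
  derivatives are uniformly Cauchy; the theorem on differentiating sequences then identifies their
  limits as the partial derivatives of \<open>g\<close>.\<close>

lemma uniform_limit_partial:
  assumes hol: "\<And>n. holomorphic3_on (f n) (ball t0 r)" and "0 < r"
    and lim: "uniform_limit (ball t0 r) f g sequentially"
  shows "holomorphic3_on g (ball t0 (r / 2))"
    and "uniform_limit (ball t0 (r / 2)) (\<lambda>n. partial i (f n)) (partial i g) sequentially"
proof -
  let ?V = "ball t0 (r / 2)"
  have V: "?V \<subseteq> ball t0 r" using assms(2) by auto
  have "\<exists>l. uniform_limit ?V (\<lambda>n. partial i (f n)) l sequentially" for i
  proof -
    have "uniformly_Cauchy_on ?V (\<lambda>n. partial i (f n))"
      unfolding uniformly_Cauchy_on_def
    proof (intro allI impI)
      fix e :: real assume "e > 0"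
      then have "e * r / 8 > 0" using assms(2) by simp
      moreover have "uniformly_Cauchy_on (ball t0 r) f"
        using lim uniformly_convergent_Cauchy uniformly_convergent_on_def by blast
      ultimately obtain M where M: "\<And>m n t. m \<ge> M \<Longrightarrow> n \<ge> M \<Longrightarrow> t \<in> ball t0 r \<Longrightarrow> dist (f m t) (f n t) < e * r / 8"
        unfolding uniformly_Cauchy_on_def by metis
      have "dist (partial i (f m) t) (partial i (f n) t) < e" if "m \<ge> M" "n \<ge> M" "t \<in> ?V" for m n t
      proof -
        have "norm (partial i (\<lambda>t. f m t - f n t) t) \<le> 4 * (e * r / 8) / r"
          by (rule partial_Cauchy_bound[OF holomorphic3_on_diff[OF hol hol] _ that(3) assms(2)])
            (use M[OF that(1,2)] in \<open>force simp: dist_norm\<close>)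
        also have "\<dots> = e / 2" using assms(2) by simp
        also have "\<dots> < e" using \<open>e > 0\<close> by simp
        finally show ?thesis
          using partial_diff[OF hol hol, of t] that(3) V by (auto simp: dist_norm)
      qed
      then show "\<exists>M. \<forall>t\<in>?V. \<forall>m\<ge>M. \<forall>n\<ge>M. dist (partial i (f m) t) (partial i (f n) t) < e"
        by blast
    qed
    then show ?thesis
      using Cauchy_uniformly_convergent uniformly_convergent_on_def by blast
  qed
  then obtain l where l: "\<And>i. uniform_limit ?V (\<lambda>n. partial i (f n)) (l i) sequentially"
    by metis
  have t0: "t0 \<in> ?V" "t0 \<in> ball t0 r" using assms(2) by auto
  have "\<exists>g'. \<forall>t\<in>?V. (\<lambda>n. f n t) \<longlonglongrightarrow> g' t \<and> (g' has_derivative (\<lambda>h. \<Sum>i\<in>UNIV. l i t * h $ i)) (at t within ?V)"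
  proof (rule has_derivative_sequence[OF convex_ball _ _ t0(1)])
    show "(f n has_derivative (\<lambda>h. \<Sum>i\<in>UNIV. partial i (f n) t * h $ i)) (at t within ?V)" if "t \<in> ?V" for n t
      by (rule has_derivative_at_withinI, rule holomorphic3_on_partial[OF hol]) (use that V in blast)
    show "(\<lambda>n. f n t0) \<longlonglongrightarrow> g t0"
      by (rule tendsto_uniform_limitI[OF lim t0(2)])
    fix e :: real assume "e > 0"
    then have ev: "\<forall>\<^sub>F n in sequentially. \<forall>t\<in>?V. dist (partial i (f n) t) (l i t) < e / 3" for i
      by (intro uniform_limitD[OF l]) simp
    have "\<forall>\<^sub>F n in sequentially. \<forall>i. \<forall>t\<in>?V. dist (partial i (f n) t) (l i t) < e / 3"
      using ev by (simp add: eventually_all_finite)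
    then show "\<forall>\<^sub>F n in sequentially. \<forall>t\<in>?V. \<forall>h. norm ((\<Sum>i\<in>UNIV. partial i (f n) t * h $ i) - (\<Sum>i\<in>UNIV. l i t * h $ i)) \<le> e * norm h"
    proof (rule eventually_mono, intro ballI allI)
      fix n t and h :: "complex ^ 3"
      assume n: "\<forall>i. \<forall>t\<in>?V. dist (partial i (f n) t) (l i t) < e / 3" and t: "t \<in> ?V"
      have "norm ((\<Sum>i\<in>UNIV. partial i (f n) t * h $ i) - (\<Sum>i\<in>UNIV. l i t * h $ i))
          = norm (\<Sum>i\<in>UNIV. (partial i (f n) t - l i t) * h $ i)"
        by (simp add: sum_subtractf left_diff_distrib)
      also have "\<dots> \<le> (\<Sum>i\<in>(UNIV :: 3 set). e / 3 * norm h)"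
      proof (rule sum_norm_le)
        fix i :: 3
        have "norm (partial i (f n) t - l i t) \<le> e / 3"
          using n t by (metis dist_norm less_imp_le)
        then show "norm ((partial i (f n) t - l i t) * h $ i) \<le> e / 3 * norm h"
          unfolding norm_mult using \<open>e > 0\<close> Finite_Cartesian_Product.norm_nth_le[of h i]
          by (intro mult_mono) auto
      qed
      also have "\<dots> = e * norm h" by simp
      finally show "norm ((\<Sum>i\<in>UNIV. partial i (f n) t * h $ i) - (\<Sum>i\<in>UNIV. l i t * h $ i)) \<le> e * norm h" .
    qed
  qed
  then obtain g' where g': "\<And>t. t \<in> ?V \<Longrightarrow> (\<lambda>n. f n t) \<longlonglongrightarrow> g' t"
    "\<And>t. t \<in> ?V \<Longrightarrow> (g' has_derivative (\<lambda>h. \<Sum>i\<in>UNIV. l i t * h $ i)) (at t within ?V)"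
    by blast
  have gg': "g t = g' t" if "t \<in> ?V" for t
    using LIMSEQ_unique[OF g'(1)[OF that] tendsto_uniform_limitI[OF lim]] that V by auto
  have der: "(g has_derivative (\<lambda>h. \<Sum>i\<in>UNIV. l i t * h $ i)) (at t)" if "t \<in> ?V" for t
  proof -
    have "(g' has_derivative (\<lambda>h. \<Sum>i\<in>UNIV. l i t * h $ i)) (at t)"
      using g'(2)[OF that] at_within_open[OF that open_ball] by simp
    then show ?thesis
      using has_derivative_transform_within_open[OF _ open_ball that, of g' _ UNIV g] gg' by auto
  qed
  show "holomorphic3_on g ?V"
    by (rule holomorphic3_onI[OF der])
  have "partial i g t = l i t" if "t \<in> ?V" for t
    by (rule has_derivative_imp_partial[OF der[OF that]])
  then show "uniform_limit ?V (\<lambda>n. partial i (f n)) (partial i g) sequentially"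
    by (intro uniform_limit_cong'[THEN iffD2, OF _ _ l[of i]]) simp_all
qed

lemma locally_uniform_limit_partial:
  assumes hol: "\<And>n. holomorphic3_on (f n) U" and lim: "locally_uniform_limit U f g"
  shows "holomorphic3_on g U" and "locally_uniform_limit U (\<lambda>n. partial i (f n)) (partial i g)"
proof -
  have *: "\<exists>r>0. ball t r \<subseteq> U \<and> holomorphic3_on g (ball t r)
      \<and> uniform_limit (ball t r) (\<lambda>n. partial i (f n)) (partial i g) sequentially" if t: "t \<in> U" for t i
  proof -
    obtain r where r: "r > 0" "ball t r \<subseteq> U" "uniform_limit (ball t r) f g sequentially"
      using bspec[OF lim[unfolded locally_uniform_limit_def] t] by auto
    have "ball t (r / 2) \<subseteq> U"
      by (rule order_trans[OF subset_ball r(2)]) (use r(1) in simp)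
    moreover have "holomorphic3_on g (ball t (r / 2))"
      "uniform_limit (ball t (r / 2)) (\<lambda>n. partial i (f n)) (partial i g) sequentially"
      by (rule uniform_limit_partial[OF holomorphic3_on_subset[OF hol r(2)] r(1,3)])+
    ultimately show ?thesis
      using r(1) by (intro exI[of _ "r / 2"]) simp
  qed
  show "holomorphic3_on g U"
    unfolding holomorphic3_on_def
  proof
    fix t assume "t \<in> U"
    with * obtain r where "r > 0" "holomorphic3_on g (ball t r)" by blast
    then show "\<exists>c :: complex ^ 3. (g has_derivative (\<lambda>h. \<Sum>i\<in>UNIV. c $ i * h $ i)) (at t)"
      by (simp add: holomorphic3_on_def)
  qed
  show "locally_uniform_limit U (\<lambda>n. partial i (f n)) (partial i g)"
    unfolding locally_uniform_limit_def using * by blast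
qed

section \<open>Difference quotients: partial derivatives are holomorphic and commute\<close>

text \<open>Presents every partial derivative as a uniform limit of functions already known to be
  holomorphic. Continuity of \<open>u\<close> supplies the local bound \<open>B\<close> that the
  Taylor estimate requires.\<close>

lemma difference_quotient_limit:
  assumes "holomorphic3_on u U" "open U" "t0 \<in> U"
  shows "\<exists>r e. 0 < r \<and> ball t0 (2 * r) \<subseteq> U \<and> (\<forall>n. e n \<noteq> 0) \<and> (\<forall>n. norm (e n) < r) \<and> e \<longlonglongrightarrow> (0::complex) \<and>
    (\<forall>i. uniform_limit (ball t0 r) (\<lambda>n t. (u (t + axis i (e n)) - u t) / e n) (partial i u) sequentially)"
proof -
  have "isCont u t0"
    using holomorphic3_on_imp_continuous_on[OF assms(1)] assms(2,3) continuous_on_eq_continuous_at by blast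
  then obtain d where d: "d > 0" "\<And>t. dist t t0 < d \<Longrightarrow> dist (u t) (u t0) < 1"
    unfolding continuous_at_eps_delta by (metis zero_less_one)
  obtain d' where d': "d' > 0" "ball t0 d' \<subseteq> U" using assms(2,3) openE by blast
  define R where "R = min d d'"
  have R: "0 < R" "ball t0 R \<subseteq> U" using d d' by (auto simp: R_def)
  define B where "B = norm (u t0) + 1"
  have B: "norm (u t) \<le> B" if "t \<in> ball t0 R" for t
  proof -
    have "dist (u t) (u t0) < 1" using d(2)[of t] that by (simp add: R_def dist_commute)
    then show ?thesis
      using norm_triangle_ineq2[of "u t" "u t0"] unfolding B_def dist_norm by linarith
  qed
  have hol: "holomorphic3_on u (ball t0 R)" by (rule holomorphic3_on_subset[OF assms(1) R(2)])
  define e where "e = (\<lambda>n. complex_of_real (R / 8 * inverse (real (Suc n))))"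
  have e_norm: "norm (e n) = R / 8 * inverse (real (Suc n))" for n
    unfolding e_def norm_of_real using R(1) by simp
  have e_nz: "e n \<noteq> 0" for n
    using e_norm[of n] R(1) by (metis norm_eq_zero divide_pos_pos inverse_positive_iff_positive less_irrefl
        mult_pos_pos of_nat_0_less_iff zero_less_Suc zero_less_numeral)
  have e_small: "norm (e n) \<le> R / 8" for n
    unfolding e_norm using R(1) by (intro mult_left_le) (auto simp: field_simps)
  have e_lim: "e \<longlonglongrightarrow> 0"
  proof -
    have "(\<lambda>n. complex_of_real (R / 8 * inverse (real (Suc n)))) \<longlonglongrightarrow> of_real (R / 8 * 0)"
      by (intro tendsto_of_real tendsto_mult_left LIMSEQ_inverse_real_of_nat)
    then show ?thesis
      unfolding e_def by simp
  qed
  have bound: "norm ((u (t + axis i (e n)) - u t) / e n - partial i u t) \<le> 32 * B / (R / 2)\<^sup>2 * norm (e n)"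
    if "t \<in> ball t0 (R / 2)" for i n t
  proof -
    have "norm ((u (t + axis i (e n)) - u (t + axis i 0)) / e n - deriv (\<lambda>s. u (t + axis i s)) 0)
        \<le> 32 * B / (R / 2)\<^sup>2 * norm (e n)"
    proof (rule difference_quotient_bound)
      show "(\<lambda>s. u (t + axis i s)) holomorphic_on ball 0 (R / 2)"
        by (rule line_axis_holomorphic[OF hol that])
      show "norm (u (t + axis i x)) \<le> B" if "x \<in> ball 0 (R / 2)" for x
        by (rule B, rule axis_add_mem_ball) (use that \<open>t \<in> ball t0 (R / 2)\<close> in simp_all)
      show "0 < R / 2" "e n \<noteq> 0" using R(1) e_nz by auto
      show "norm (e n) < R / 2 / 2" using e_small[of n] R(1) by simp
    qed
    moreover have "axis i 0 = (0 :: complex ^ 3)" by (simp add: axis_def vec_eq_iff)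
    ultimately show ?thesis by (simp add: partial_def)
  qed
  show ?thesis
  proof (intro exI[of _ "R / 2"] exI[of _ e] conjI allI)
    show "0 < R / 2" "ball t0 (2 * (R / 2)) \<subseteq> U" using R by simp_all
    show "e n \<noteq> 0" for n by (rule e_nz)
    show "norm (e n) < R / 2" for n using e_small[of n] R(1) by simp
    show "e \<longlonglongrightarrow> 0" by (rule e_lim)
    show "uniform_limit (ball t0 (R / 2)) (\<lambda>n t. (u (t + axis i (e n)) - u t) / e n) (partial i u) sequentially" for i
    proof (rule uniform_limitI)
      fix \<epsilon> :: real assume "\<epsilon> > 0"
      have "(\<lambda>n. 32 * B / (R / 2)\<^sup>2 * norm (e n)) \<longlonglongrightarrow> 32 * B / (R / 2)\<^sup>2 * norm (0 :: complex)"
        by (intro tendsto_mult_left tendsto_norm e_lim)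
      then have "\<forall>\<^sub>F n in sequentially. 32 * B / (R / 2)\<^sup>2 * norm (e n) < \<epsilon>"
        using \<open>\<epsilon> > 0\<close> by (intro order_tendstoD) auto
      then show "\<forall>\<^sub>F n in sequentially. \<forall>t\<in>ball t0 (R / 2).
          dist ((u (t + axis i (e n)) - u t) / e n) (partial i u t) < \<epsilon>"
      proof (rule eventually_mono, intro ballI)
        fix n t assume "32 * B / (R / 2)\<^sup>2 * norm (e n) < \<epsilon>" "t \<in> ball t0 (R / 2)"
        then show "dist ((u (t + axis i (e n)) - u t) / e n) (partial i u t) < \<epsilon>"
          using le_less_trans[OF bound] unfolding dist_norm by blast
      qed
    qed
  qed
qed

lemma holomorphic3_on_difference_quotient:
  assumes "holomorphic3_on u (ball t0 (2 * r))" "norm e < r"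
  shows "holomorphic3_on (\<lambda>t. (u (t + axis i e) - u t) / e) (ball t0 r)"
    and "t \<in> ball t0 r \<Longrightarrow> partial j (\<lambda>t. (u (t + axis i e) - u t) / e) t = (partial j u (t + axis i e) - partial j u t) / e"
proof -
  have m: "t + axis i e \<in> ball t0 (2 * r)" if "t \<in> ball t0 r" for t
    using axis_add_mem_ball[of t t0 "2 * r" e i] that assms(2) by simp
  have sub: "ball t0 r \<subseteq> ball t0 (2 * r)"
    using norm_ge_zero[of e] assms(2) by (intro subset_ball) linarith
  have h: "holomorphic3_on (\<lambda>t. u (t + axis i e)) (ball t0 r)" "holomorphic3_on u (ball t0 r)"
    by (rule holomorphic3_on_translate[OF assms(1)], rule m, assumption)
      (rule holomorphic3_on_subset[OF assms(1) sub])
  have eq: "(\<lambda>t. (u (t + axis i e) - u t) / e) = (\<lambda>t. inverse e * (u (t + axis i e) - u t))"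
    by (simp add: divide_inverse mult.commute)
  show "holomorphic3_on (\<lambda>t. (u (t + axis i e) - u t) / e) (ball t0 r)"
    unfolding eq by (intro holomorphic3_on_cmult holomorphic3_on_diff h)
  show "partial j (\<lambda>t. (u (t + axis i e) - u t) / e) t = (partial j u (t + axis i e) - partial j u t) / e"
    if "t \<in> ball t0 r"
  proof -
    have "partial j (\<lambda>t. u (t + axis i e)) t = partial j u (t + axis i e)"
      by (rule partial_translate[where U = "ball t0 r", OF assms(1) m]) (use that in simp_all)
    then show ?thesis
      unfolding eq partial_cmult[OF holomorphic3_on_diff[OF h] that] partial_diff[OF h that]
      by (simp add: divide_inverse mult.commute)
  qed
qed

text \<open>Difference quotients are combinations of translates of \<open>u\<close>, hence
  holomorphic, and holomorphy survives locally uniform limits.\<close>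

lemma holomorphic3_on_partialI:
  assumes "holomorphic3_on u U" "open U"
  shows "holomorphic3_on (partial i u) U"
  unfolding holomorphic3_on_def
proof
  fix t assume "t \<in> U"
  obtain r e where r: "0 < r" "ball t (2 * r) \<subseteq> U"
    and e: "\<And>n. e n \<noteq> 0" "\<And>n. norm (e n) < r" "e \<longlonglongrightarrow> 0"
    and lim: "\<And>i. uniform_limit (ball t r) (\<lambda>n t. (u (t + axis i (e n)) - u t) / e n) (partial i u) sequentially"
    using difference_quotient_limit[OF assms \<open>t \<in> U\<close>] by blast
  have "holomorphic3_on (partial i u) (ball t r)"
    by (rule locally_uniform_limit_partial(1)[OF holomorphic3_on_difference_quotient(1)
          locally_uniform_limitI_ball[OF lim]])
      (use holomorphic3_on_subset[OF assms(1) r(2)] e(2) in auto)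
  then show "\<exists>c :: complex ^ 3. (partial i u has_derivative (\<lambda>h. \<Sum>i\<in>UNIV. c $ i * h $ i)) (at t)"
    using r(1) by (simp add: holomorphic3_on_def)
qed

text \<open>The derivatives \<open>partial i\<close> of the difference quotients in direction
  \<open>j\<close> have two limits: that of the derivatives of a uniformly convergent sequence, and
  that of the difference quotients of \<open>partial i u\<close>.\<close>

lemma partial_commute:
  assumes "holomorphic3_on u U" "open U" "t \<in> U"
  shows "partial i (partial j u) t = partial j (partial i u) t"
proof -
  obtain r e where r: "0 < r" "ball t (2 * r) \<subseteq> U"
    and e: "\<And>n. e n \<noteq> 0" "\<And>n. norm (e n) < r" "e \<longlonglongrightarrow> 0"
    and lim: "\<And>i. uniform_limit (ball t r) (\<lambda>n t. (u (t + axis i (e n)) - u t) / e n) (partial i u) sequentially"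
    using difference_quotient_limit[OF assms] by blast
  have hol: "holomorphic3_on u (ball t (2 * r))" by (rule holomorphic3_on_subset[OF assms(1) r(2)])
  have t: "t \<in> ball t r" using r(1) by simp
  have "(\<lambda>n. partial i (\<lambda>t. (u (t + axis j (e n)) - u t) / e n) t) \<longlonglongrightarrow> partial i (partial j u) t"
    by (rule locally_uniform_limit_tendsto[OF locally_uniform_limit_partial(2)[OF
          holomorphic3_on_difference_quotient(1)[OF hol e(2)] locally_uniform_limitI_ball[OF lim]] t])
  then have 1: "(\<lambda>n. (partial i u (t + axis j (e n)) - partial i u t) / e n) \<longlonglongrightarrow> partial i (partial j u) t"
    by (simp add: holomorphic3_on_difference_quotient(2)[OF hol e(2) t])
  have "((\<lambda>s. partial i u (t + axis j s)) has_field_derivative partial j (partial i u) (t + axis j 0)) (at 0)"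
    by (rule line_axis_has_field_derivative[OF holomorphic3_on_partialI[OF assms(1,2)]])
      (use assms(3) in \<open>simp add: axis_eq_scale[of j 0]\<close>)
  moreover have "axis j 0 = (0 :: complex ^ 3)" by (simp add: axis_def vec_eq_iff)
  ultimately have "((\<lambda>s. (partial i u (t + axis j s) - partial i u t) / s) \<longlongrightarrow> partial j (partial i u) t) (at 0)"
    by (simp add: DERIV_def)
  then have "(\<lambda>n. (partial i u (t + axis j (e n)) - partial i u t) / e n) \<longlonglongrightarrow> partial j (partial i u) t"
    using e(1,3) by (auto simp: tendsto_at_iff_sequentially o_def)
  with 1 show ?thesis using LIMSEQ_unique by blast
qed

section \<open>Jets\<close>

lemma partial_cong:
  assumes "open U" "t \<in> U" "\<And>t. t \<in> U \<Longrightarrow> f t = g t"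
  shows "partial i f t = partial i g t"
proof -
  obtain r where r: "r > 0" "ball t r \<subseteq> U" using assms(1,2) openE by blast
  have "\<forall>\<^sub>F s in nhds 0. s \<in> ball (0 :: complex) r"
    using r(1) by (intro eventually_nhds_in_open) auto
  then have "\<forall>\<^sub>F s in nhds 0. f (t + axis i s) = g (t + axis i s)"
  proof (rule eventually_mono)
    fix s :: complex assume "s \<in> ball 0 r"
    then have "t + axis i s \<in> ball t r" by (simp add: dist_norm norm_axis_complex)
    then show "f (t + axis i s) = g (t + axis i s)" using assms(3) r(2) by blast
  qed
  then show ?thesis
    unfolding partial_def by (intro deriv_cong_ev) auto
qed

lemma funpow_partial_cong:
  assumes "open U" "t \<in> U" "\<And>t. t \<in> U \<Longrightarrow> f t = g t"
  shows "(partial i ^^ n) f t = (partial i ^^ n) g t"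
  using assms(2)
proof (induction n arbitrary: t)
  case (Suc n)
  have "partial i ((partial i ^^ n) f) t = partial i ((partial i ^^ n) g) t"
    by (rule partial_cong[OF assms(1) Suc.prems Suc.IH])
  then show ?case by simp
qed (simp add: assms(3))

lemma holomorphic3_on_funpow_partial:
  "holomorphic3_on u U \<Longrightarrow> open U \<Longrightarrow> holomorphic3_on ((partial i ^^ n) u) U"
  by (induction n) (auto intro: holomorphic3_on_partialI)

lemma funpow_partial_commute:
  assumes "holomorphic3_on u U" "open U" "t \<in> U"
  shows "(partial i ^^ n) (partial j u) t = partial j ((partial i ^^ n) u) t"
  using assms(3)
proof (induction n arbitrary: t)
  case (Suc n)
  have "partial i ((partial i ^^ n) (partial j u)) t = partial i (partial j ((partial i ^^ n) u)) t"
    by (rule partial_cong[OF assms(2) Suc.prems Suc.IH])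
  also have "\<dots> = partial j (partial i ((partial i ^^ n) u)) t"
    by (rule partial_commute[OF holomorphic3_on_funpow_partial[OF assms(1,2)] assms(2) Suc.prems])
  finally show ?case by simp
qed simp

lemma funpow_partial_add:
  assumes "holomorphic3_on u U" "holomorphic3_on v U" "open U" "t \<in> U"
  shows "(partial i ^^ n) (\<lambda>t. u t + v t) t = (partial i ^^ n) u t + (partial i ^^ n) v t"
  using assms(4)
proof (induction n arbitrary: t)
  case (Suc n)
  note hol = assms(1,2)[THEN holomorphic3_on_funpow_partial, OF assms(3), where i = i and n = n]
  have "partial i ((partial i ^^ n) (\<lambda>t. u t + v t)) t = partial i (\<lambda>t. (partial i ^^ n) u t + (partial i ^^ n) v t) t"
    by (rule partial_cong[OF assms(3) Suc.prems Suc.IH])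
  then show ?case using partial_add[OF hol Suc.prems] by simp
qed simp

lemma funpow_partial_cmult:
  assumes "holomorphic3_on u U" "open U" "t \<in> U"
  shows "(partial i ^^ n) (\<lambda>t. c * u t) t = c * (partial i ^^ n) u t"
  using assms(3)
proof (induction n arbitrary: t)
  case (Suc n)
  note hol = holomorphic3_on_funpow_partial[OF assms(1,2), where i = i and n = n]
  have "partial i ((partial i ^^ n) (\<lambda>t. c * u t)) t = partial i (\<lambda>t. c * (partial i ^^ n) u t) t"
    by (rule partial_cong[OF assms(2) Suc.prems Suc.IH])
  then show ?case using partial_cmult[OF hol Suc.prems] by simp
qed simp

lemma funpow_partial_coord_mult:
  assumes "holomorphic3_on u U" "open U" "t \<in> U"
  shows "(partial i ^^ n) (\<lambda>t. t $ j * u t) t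
    = t $ j * (partial i ^^ n) u t + (if i = j then of_nat n else 0) * (partial i ^^ (n - 1)) u t"
  using assms(3)
proof (induction n arbitrary: t)
  case (Suc n)
  let ?c = "if i = j then of_nat n else 0 :: complex"
  note hol = holomorphic3_on_funpow_partial[OF assms(1,2), where i = i]
  note holm = holomorphic3_on_mult[OF holomorphic3_on_coord hol] holomorphic3_on_cmult[OF hol]
  have "partial i ((partial i ^^ n) (\<lambda>t. t $ j * u t)) t
      = partial i (\<lambda>t. t $ j * (partial i ^^ n) u t + ?c * (partial i ^^ (n - 1)) u t) t"
    by (rule partial_cong[OF assms(2) Suc.prems Suc.IH])
  also have "\<dots> = t $ j * partial i ((partial i ^^ n) u) t + (if i = j then 1 else 0) * (partial i ^^ n) u t
      + ?c * partial i ((partial i ^^ (n - 1)) u) t"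
    unfolding partial_add[OF holm Suc.prems] partial_mult[OF holomorphic3_on_coord hol Suc.prems]
      partial_cmult[OF hol Suc.prems] partial_coord by simp
  also have "?c * partial i ((partial i ^^ (n - 1)) u) t = ?c * (partial i ^^ n) u t"
    by (cases n) auto
  finally show ?case by (simp add: algebra_simps)
qed simp

section \<open>Jets of holomorphic functions\<close>

definition mixed_partial :: "nat \<Rightarrow> nat \<Rightarrow> nat \<Rightarrow> (complex ^ 3 \<Rightarrow> complex) \<Rightarrow> complex ^ 3 \<Rightarrow> complex" where
  "mixed_partial i j k u = (partial 1 ^^ i) ((partial 2 ^^ j) ((partial 3 ^^ k) u))"

text \<open>Derivatives instead of Taylor coefficients: differentiation becomes a pure shift, and
  factorials appear only in the Taylor sums and the growth bound.\<close>

definition jet_of :: "complex ^ 3 \<Rightarrow> (complex ^ 3 \<Rightarrow> complex) \<Rightarrow> nat \<Rightarrow> nat \<Rightarrow> nat \<Rightarrow> complex" where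
  "jet_of p u i j k = mixed_partial i j k u p"

locale jet_at =
  fixes U :: "(complex ^ 3) set" and p :: "complex ^ 3"
  assumes open_U: "open U" and p_in: "p \<in> U"
begin

lemmas hol_funpow = holomorphic3_on_funpow_partial[OF _ open_U]

lemma jet_of_cong:
  assumes "\<And>t. t \<in> U \<Longrightarrow> u t = v t"
  shows "jet_of p u i j k = jet_of p v i j k"
  unfolding jet_of_def mixed_partial_def
  by (intro funpow_partial_cong[OF open_U] p_in assms)

lemma jet_of_partial:
  assumes "holomorphic3_on u U"
  shows "jet_of p (partial 1 u) i j k = jet_of p u (Suc i) j k"
    "jet_of p (partial 2 u) i j k = jet_of p u i (Suc j) k"
    "jet_of p (partial 3 u) i j k = jet_of p u i j (Suc k)"
proof -
  note c3 = funpow_partial_commute[OF assms open_U]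
  note c2 = funpow_partial_commute[OF hol_funpow[OF assms] open_U]
  have "jet_of p (partial 1 u) i j k = (partial 1 ^^ i) ((partial 2 ^^ j) (partial 1 ((partial 3 ^^ k) u))) p"
    unfolding jet_of_def mixed_partial_def
    by (intro funpow_partial_cong[OF open_U] p_in c3)
  also have "\<dots> = (partial 1 ^^ i) (partial 1 ((partial 2 ^^ j) ((partial 3 ^^ k) u))) p"
    by (intro funpow_partial_cong[OF open_U] p_in c2)
  finally show "jet_of p (partial 1 u) i j k = jet_of p u (Suc i) j k"
    by (simp add: jet_of_def mixed_partial_def funpow_swap1)
  have "jet_of p (partial 2 u) i j k = (partial 1 ^^ i) ((partial 2 ^^ j) (partial 2 ((partial 3 ^^ k) u))) p"
    unfolding jet_of_def mixed_partial_def
    by (intro funpow_partial_cong[OF open_U] p_in c3)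
  then show "jet_of p (partial 2 u) i j k = jet_of p u i (Suc j) k"
    by (simp add: jet_of_def mixed_partial_def funpow_swap1)
  show "jet_of p (partial 3 u) i j k = jet_of p u i j (Suc k)"
    by (simp add: jet_of_def mixed_partial_def funpow_swap1)
qed

lemma jet_of_add:
  assumes "holomorphic3_on u U" "holomorphic3_on v U"
  shows "jet_of p (\<lambda>t. u t + v t) i j k = jet_of p u i j k + jet_of p v i j k"
proof -
  have "jet_of p (\<lambda>t. u t + v t) i j k
      = (partial 1 ^^ i) ((partial 2 ^^ j) (\<lambda>t. (partial 3 ^^ k) u t + (partial 3 ^^ k) v t)) p"
    unfolding jet_of_def mixed_partial_def
    by (intro funpow_partial_cong[OF open_U] p_in funpow_partial_add[OF assms open_U])
  also have "\<dots> = (partial 1 ^^ i) (\<lambda>t. (partial 2 ^^ j) ((partial 3 ^^ k) u) t + (partial 2 ^^ j) ((partial 3 ^^ k) v) t) p"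
    by (intro funpow_partial_cong[OF open_U] p_in funpow_partial_add[OF hol_funpow[OF assms(1)] hol_funpow[OF assms(2)] open_U])
  also have "\<dots> = jet_of p u i j k + jet_of p v i j k"
    unfolding jet_of_def mixed_partial_def
    by (rule funpow_partial_add[OF hol_funpow[OF hol_funpow[OF assms(1)]] hol_funpow[OF hol_funpow[OF assms(2)]] open_U p_in])
  finally show ?thesis .
qed

lemma jet_of_cmult:
  assumes "holomorphic3_on u U"
  shows "jet_of p (\<lambda>t. c * u t) i j k = c * jet_of p u i j k"
proof -
  have "jet_of p (\<lambda>t. c * u t) i j k = (partial 1 ^^ i) ((partial 2 ^^ j) (\<lambda>t. c * (partial 3 ^^ k) u t)) p"
    unfolding jet_of_def mixed_partial_def
    by (intro funpow_partial_cong[OF open_U] p_in funpow_partial_cmult[OF assms open_U])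
  also have "\<dots> = (partial 1 ^^ i) (\<lambda>t. c * (partial 2 ^^ j) ((partial 3 ^^ k) u) t) p"
    by (intro funpow_partial_cong[OF open_U] p_in funpow_partial_cmult[OF hol_funpow[OF assms] open_U])
  also have "\<dots> = c * jet_of p u i j k"
    unfolding jet_of_def mixed_partial_def
    by (rule funpow_partial_cmult[OF hol_funpow[OF hol_funpow[OF assms]] open_U p_in])
  finally show ?thesis .
qed

lemma jet_of_coord_mult:
  assumes "holomorphic3_on u U"
  shows "jet_of p (\<lambda>t. t $ 1 * u t) i j k = p $ 1 * jet_of p u i j k + of_nat i * jet_of p u (i - 1) j k"
    "jet_of p (\<lambda>t. t $ 2 * u t) i j k = p $ 2 * jet_of p u i j k + of_nat j * jet_of p u i (j - 1) k"
    "jet_of p (\<lambda>t. t $ 3 * u t) i j k = p $ 3 * jet_of p u i j k + of_nat k * jet_of p u i j (k - 1)"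
proof -
  have neq: "(1::3) \<noteq> 2" "(1::3) \<noteq> 3" "(2::3) \<noteq> 3" "(2::3) \<noteq> 1" "(3::3) \<noteq> 1" "(3::3) \<noteq> 2" by simp_all
  have c3: "(partial 3 ^^ k) (\<lambda>t. t $ m * u t) t
      = t $ m * (partial 3 ^^ k) u t + (if 3 = m then of_nat k else 0) * (partial 3 ^^ (k - 1)) u t"
    if "t \<in> U" for t m
    by (rule funpow_partial_coord_mult[OF assms open_U that])
  have c2: "(partial 2 ^^ j) (\<lambda>t. t $ m * (partial 3 ^^ k) u t) t
      = t $ m * (partial 2 ^^ j) ((partial 3 ^^ k) u) t
        + (if 2 = m then of_nat j else 0) * (partial 2 ^^ (j - 1)) ((partial 3 ^^ k) u) t"
    if "t \<in> U" for t m
    by (rule funpow_partial_coord_mult[OF hol_funpow[OF assms] open_U that])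
  have c1: "(partial 1 ^^ i) (\<lambda>t. t $ m * (partial 2 ^^ j) ((partial 3 ^^ k) u) t) t
      = t $ m * (partial 1 ^^ i) ((partial 2 ^^ j) ((partial 3 ^^ k) u)) t
        + (if 1 = m then of_nat i else 0) * (partial 1 ^^ (i - 1)) ((partial 2 ^^ j) ((partial 3 ^^ k) u)) t"
    if "t \<in> U" for t m
    by (rule funpow_partial_coord_mult[OF hol_funpow[OF hol_funpow[OF assms]] open_U that])
  have step3: "jet_of p (\<lambda>t. t $ m * u t) i j k
      = (partial 1 ^^ i) ((partial 2 ^^ j) (\<lambda>t. t $ m * (partial 3 ^^ k) u t
          + (if 3 = m then of_nat k else 0) * (partial 3 ^^ (k - 1)) u t)) p" for m
    unfolding jet_of_def mixed_partial_def
    by (intro funpow_partial_cong[OF open_U] p_in c3)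
  have step2: "(partial 1 ^^ i) ((partial 2 ^^ j) (\<lambda>t. t $ m * (partial 3 ^^ k) u t)) p
      = (partial 1 ^^ i) (\<lambda>t. t $ m * (partial 2 ^^ j) ((partial 3 ^^ k) u) t
        + (if 2 = m then of_nat j else 0) * (partial 2 ^^ (j - 1)) ((partial 3 ^^ k) u) t) p" for m
    by (intro funpow_partial_cong[OF open_U] p_in c2)
  show "jet_of p (\<lambda>t. t $ 1 * u t) i j k = p $ 1 * jet_of p u i j k + of_nat i * jet_of p u (i - 1) j k"
    using step3[of 1] step2[of 1] c1[OF p_in, of 1] by (simp add: neq jet_of_def mixed_partial_def)
  show "jet_of p (\<lambda>t. t $ 2 * u t) i j k = p $ 2 * jet_of p u i j k + of_nat j * jet_of p u i (j - 1) k"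
  proof -
    have "(partial 1 ^^ i) (\<lambda>t. t $ 2 * (partial 2 ^^ j) ((partial 3 ^^ k) u) t
          + of_nat j * (partial 2 ^^ (j - 1)) ((partial 3 ^^ k) u) t) p
      = (partial 1 ^^ i) (\<lambda>t. t $ 2 * (partial 2 ^^ j) ((partial 3 ^^ k) u) t) p
        + (partial 1 ^^ i) (\<lambda>t. of_nat j * (partial 2 ^^ (j - 1)) ((partial 3 ^^ k) u) t) p"
      by (intro funpow_partial_add[where U = U] p_in open_U holomorphic3_on_mult holomorphic3_on_coord
          holomorphic3_on_const hol_funpow assms)
    also have "(partial 1 ^^ i) (\<lambda>t. of_nat j * (partial 2 ^^ (j - 1)) ((partial 3 ^^ k) u) t) p
      = of_nat j * (partial 1 ^^ i) ((partial 2 ^^ (j - 1)) ((partial 3 ^^ k) u)) p"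
      by (intro funpow_partial_cmult[where U = U] p_in open_U hol_funpow assms)
    finally show ?thesis
      using step3[of 2] step2[of 2] c1[OF p_in, of 2] by (simp add: neq jet_of_def mixed_partial_def)
  qed
  show "jet_of p (\<lambda>t. t $ 3 * u t) i j k = p $ 3 * jet_of p u i j k + of_nat k * jet_of p u i j (k - 1)"
  proof -
    have "jet_of p (\<lambda>t. t $ 3 * u t) i j k = (partial 1 ^^ i) ((partial 2 ^^ j) (\<lambda>t. t $ 3 * (partial 3 ^^ k) u t
          + of_nat k * (partial 3 ^^ (k - 1)) u t)) p"
      using step3[of 3] by simp
    also have "\<dots> = jet_of p (\<lambda>t. t $ 3 * (partial 3 ^^ k) u t) i j 0 + jet_of p (\<lambda>t. of_nat k * (partial 3 ^^ (k - 1)) u t) i j 0"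
      using jet_of_add[of "\<lambda>t. t $ 3 * (partial 3 ^^ k) u t" "\<lambda>t. of_nat k * (partial 3 ^^ (k - 1)) u t" i j 0]
      by (simp add: jet_of_def mixed_partial_def holomorphic3_on_mult holomorphic3_on_coord holomorphic3_on_const hol_funpow assms)
    finally have "jet_of p (\<lambda>t. t $ 3 * u t) i j k = jet_of p (\<lambda>t. t $ 3 * (partial 3 ^^ k) u t) i j 0
      + jet_of p (\<lambda>t. of_nat k * (partial 3 ^^ (k - 1)) u t) i j 0" .
    moreover have "jet_of p (\<lambda>t. of_nat k * (partial 3 ^^ (k - 1)) u t) i j 0 = of_nat k * jet_of p u i j (k - 1)"
      using jet_of_cmult[OF hol_funpow[OF assms, where i = 3 and n = "k - 1"], of "of_nat k" i j 0]
      by (simp add: jet_of_def mixed_partial_def)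
    moreover have "jet_of p (\<lambda>t. t $ 3 * (partial 3 ^^ k) u t) i j 0 = p $ 3 * jet_of p u i j k"
      using step2[of 3] c1[OF p_in, of 3] by (simp add: neq jet_of_def mixed_partial_def)
    ultimately show ?thesis by simp
  qed
qed

text \<open>Both claims go through one induction, because the jet of a sum is split using holomorphy
  of the shorter sum.\<close>

lemma jet_of_sum:
  assumes "finite S" "\<And>s. s \<in> S \<Longrightarrow> holomorphic3_on (f s) U"
  shows "jet_of p (\<lambda>t. \<Sum>s\<in>S. c s * f s t) i j k = (\<Sum>s\<in>S. c s * jet_of p (f s) i j k)
    \<and> holomorphic3_on (\<lambda>t. \<Sum>s\<in>S. c s * f s t) U"
  using assms
proof (induction S rule: finite_induct)
  case empty
  then show ?case
    using jet_of_cmult[OF holomorphic3_on_const, of 0 0 i j k] by (simp add: holomorphic3_on_const)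
next
  case (insert s S)
  then show ?case
    by (simp add: jet_of_add jet_of_cmult holomorphic3_on_add holomorphic3_on_mult holomorphic3_on_const)
qed

end

section \<open>Identity theorem\<close>

lemma norm_scale_vec: "norm (s *s h) = norm s * norm (h :: complex ^ 3)"
  by (simp add: norm_vec_def norm_mult L2_set_right_distrib)

text \<open>Reduction to one variable on the complex line through \<open>p\<close> and
  \<open>t\<close>: all derivatives at \<open>0\<close> of the restriction vanish, so the
  restriction is zero on a disc containing \<open>1\<close>.\<close>

lemma jet_zero_imp_zero:
  assumes hol: "holomorphic3_on u (ball p r)" and jet: "\<And>i j k. jet_of p u i j k = 0" and t: "t \<in> ball p r"
  shows "u t = 0"
proof -
  have r: "0 < r" using t by (metis ball_empty empty_iff not_less)
  then interpret jet_at "ball p r" p by unfold_locales auto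
  define h where "h = t - p"
  show ?thesis
  proof (cases "h = 0")
    case True
    then show ?thesis using jet[of 0 0 0] by (simp add: h_def jet_of_def mixed_partial_def)
  next
    case False
    define R where "R = r / norm h"
    have R: "1 < R" using t False by (simp add: R_def h_def dist_norm norm_minus_commute)
    have mem: "p + s *s h \<in> ball p r" if "s \<in> ball 0 R" for s
      using that False by (simp add: R_def dist_norm norm_scale_vec field_simps)
    have der: "(deriv ^^ n) (\<lambda>s. v (p + s *s h)) 0 = 0"
      if "holomorphic3_on v (ball p r)" "\<And>i j k. jet_of p v i j k = 0" for n v
      using that
    proof (induction n arbitrary: v)
      case 0
      then show ?case using 0(2)[of 0 0 0] by (simp add: jet_of_def mixed_partial_def)
    next
      case (Suc n)
      \<comment> \<open>Differentiating along the line replaces \<open>v\<close> by its directional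
        derivative \<open>w\<close>, whose jet vanishes as well; hence the induction is over
        arbitrary \<open>v\<close>.\<close>
      define w where "w = (\<lambda>t. \<Sum>i\<in>UNIV. h $ i * partial i v t)"
      have d: "deriv (\<lambda>s. v (p + s *s h)) s = w (p + s *s h)" if "s \<in> ball 0 R" for s
        using DERIV_imp_deriv[OF line_has_field_derivative[OF Suc.prems(1) mem[OF that]]]
        by (simp add: w_def mult.commute)
      have "\<forall>\<^sub>F s in nhds 0. s \<in> ball (0 :: complex) R"
        using R by (intro eventually_nhds_in_open) auto
      then have "\<forall>\<^sub>F s in nhds 0. deriv (\<lambda>s. v (p + s *s h)) s = w (p + s *s h)"
        by (rule eventually_mono) (rule d)
      then have "(deriv ^^ n) (deriv (\<lambda>s. v (p + s *s h))) 0 = (deriv ^^ n) (\<lambda>s. w (p + s *s h)) 0"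
        by (rule higher_deriv_cong_ev) simp
      moreover have "(deriv ^^ n) (\<lambda>s. w (p + s *s h)) 0 = 0"
      proof (rule Suc.IH)
        have "jet_of p (partial m v) i j k = 0" for m i j k
          using exhaust_3[of m] jet_of_partial[OF Suc.prems(1)] Suc.prems(2) by metis
        moreover have "jet_of p w i j k = (\<Sum>m\<in>UNIV. h $ m * jet_of p (partial m v) i j k)
            \<and> holomorphic3_on w (ball p r)" for i j k
          unfolding w_def by (rule jet_of_sum) (simp_all add: holomorphic3_on_partialI[OF Suc.prems(1)])
        ultimately show "holomorphic3_on w (ball p r)" "jet_of p w i j k = 0" for i j k
          by simp_all
      qed
      ultimately show ?case by (simp add: funpow_swap1)
    qed
    have "(\<lambda>s. u (p + s *s h)) holomorphic_on ball 0 R"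
      unfolding holomorphic_on_def field_differentiable_def
      by (intro ballI exI, rule has_field_derivative_at_within, rule line_has_field_derivative[OF hol mem])
    then have "u (p + 1 *s h) = 0"
      by (rule holomorphic_fun_eq_0_on_ball) (use R der[OF hol jet] in auto)
    then show ?thesis by (simp add: h_def)
  qed
qed

section \<open>Taylor polynomials and realization of jets\<close>

definition power_sum :: "complex ^ 3 \<Rightarrow> 3 \<Rightarrow> nat \<Rightarrow> (nat \<Rightarrow> complex ^ 3 \<Rightarrow> complex) \<Rightarrow> complex ^ 3 \<Rightarrow> complex" where
  "power_sum p m n F = (\<lambda>t. \<Sum>i<n. (t $ m - p $ m) ^ i / fact i * F i t)"

lemma
  shows holomorphic3_on_coord_power: "holomorphic3_on (\<lambda>t. (t $ m - c) ^ n / fact n) U"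
    and partial_coord_power: "partial m' (\<lambda>t. (t $ m - c) ^ n / fact n) t
      = (if m = m' \<and> n > 0 then (t $ m - c) ^ (n - 1) / fact (n - 1) else 0)"
proof -
  have "((\<lambda>t. (t $ m - c) ^ n / fact n) has_derivative
      (\<lambda>h. \<Sum>i\<in>UNIV. (if m = i \<and> n > 0 then (t $ m - c) ^ (n - 1) / fact (n - 1) else 0) * h $ i)) (at t)"
    for t :: "complex ^ 3"
  proof -
    have "((\<lambda>t. t $ m - c) has_derivative (\<lambda>h. h $ m)) (at t)"
      using has_derivative_diff[OF bounded_linear_imp_has_derivative[OF bounded_linear_vec_nth] has_derivative_const]
      by simp
    from has_derivative_power[OF this, of n]
    have "((\<lambda>t. (t $ m - c) ^ n * inverse (fact n)) has_derivative
        (\<lambda>h. of_nat n * h $ m * (t $ m - c) ^ (n - 1) * inverse (fact n))) (at t)"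
      by (rule has_derivative_mult_left)
    moreover have "of_nat n * h $ m * (t $ m - c) ^ (n - 1) * inverse (fact n)
        = (\<Sum>i\<in>UNIV. (if m = i \<and> n > 0 then (t $ m - c) ^ (n - 1) / fact (n - 1) else 0) * h $ i)" for h
    proof (cases n)
      case (Suc k)
      have "(\<Sum>i\<in>UNIV. (if m = i \<and> n > 0 then (t $ m - c) ^ (n - 1) / fact (n - 1) else 0) * h $ i)
          = (t $ m - c) ^ k / fact k * h $ m"
        using Suc by (simp add: if_distrib[of "\<lambda>x. x * _"] cong: if_cong)
      moreover have "of_nat n * inverse (fact n) = (inverse (fact k) :: complex)"
        using Suc by (simp add: fact_Suc del: of_nat_Suc)
      ultimately show ?thesis
        using Suc by (simp add: divide_inverse mult_ac)
    qed simp
    ultimately show ?thesis by (simp only: divide_inverse)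
  qed
  from holomorphic3_onI[OF this] has_derivative_imp_partial[OF this]
  show "holomorphic3_on (\<lambda>t. (t $ m - c) ^ n / fact n) U"
    "partial m' (\<lambda>t. (t $ m - c) ^ n / fact n) t
      = (if m = m' \<and> n > 0 then (t $ m - c) ^ (n - 1) / fact (n - 1) else 0)" by blast+
qed

lemma power_sum_Suc:
  "power_sum p m (Suc n) F = (\<lambda>t. power_sum p m n F t + (t $ m - p $ m) ^ n / fact n * F n t)"
  by (simp add: power_sum_def)

lemma holomorphic3_on_power_sum:
  "(\<And>i. holomorphic3_on (F i) U) \<Longrightarrow> holomorphic3_on (power_sum p m n F) U"
proof (induction n)
  case 0
  then show ?case by (simp add: power_sum_def holomorphic3_on_const)
next
  case (Suc n)
  show ?case
    unfolding power_sum_Suc by (intro holomorphic3_on_add holomorphic3_on_mult holomorphic3_on_coord_power Suc.IH Suc.prems)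
qed

lemma partial_power_sum_other:
  assumes "\<And>i. holomorphic3_on (F i) UNIV" "m \<noteq> m'"
  shows "partial m' (power_sum p m n F) = power_sum p m n (\<lambda>i. partial m' (F i))"
proof (induction n)
  case 0
  then show ?case by (simp add: power_sum_def fun_eq_iff partial_const)
next
  case (Suc n)
  have "partial m' (\<lambda>t. power_sum p m n F t + (t $ m - p $ m) ^ n / fact n * F n t) t
      = partial m' (power_sum p m n F) t + (t $ m - p $ m) ^ n / fact n * partial m' (F n) t" for t
    using partial_add[OF holomorphic3_on_power_sum holomorphic3_on_mult[OF holomorphic3_on_coord_power], of F UNIV "F n" t m' p m n m "p $ m" n]
      partial_mult[OF holomorphic3_on_coord_power, of "F n" UNIV t m' m "p $ m" n] assms
    by (simp add: partial_coord_power)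
  then show ?case
    unfolding power_sum_Suc by (simp add: fun_eq_iff Suc)
qed

text \<open>With coefficients independent of the variable \<open>m\<close>, differentiation lowers
  each divided power by one and so shifts the coefficient sequence.\<close>

lemma partial_power_sum_same:
  assumes "\<And>i. holomorphic3_on (F i) UNIV" "\<And>i t. partial m (F i) t = 0"
  shows "partial m (power_sum p m (Suc n) F) = power_sum p m n (\<lambda>i. F (Suc i))"
proof (induction n)
  case 0
  have "partial m (\<lambda>t. 1 * F 0 t) t = 0" for t
    using assms by simp
  then show ?case by (simp add: power_sum_def fun_eq_iff)
next
  case (Suc n)
  have "partial m (\<lambda>t. power_sum p m (Suc n) F t + (t $ m - p $ m) ^ Suc n / fact (Suc n) * F (Suc n) t) t
      = partial m (power_sum p m (Suc n) F) t + (t $ m - p $ m) ^ n / fact n * F (Suc n) t" for t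
    using partial_add[OF holomorphic3_on_power_sum holomorphic3_on_mult[OF holomorphic3_on_coord_power],
        of F UNIV "F (Suc n)" t m p m "Suc n" m "p $ m" "Suc n"]
      partial_mult[OF holomorphic3_on_coord_power, of "F (Suc n)" UNIV t m m "p $ m" "Suc n"] assms
    by (simp add: partial_coord_power del: power_Suc fact_Suc)
  then show ?case
    unfolding power_sum_Suc[of p m "Suc n"] power_sum_Suc[of p m n "\<lambda>i. F (Suc i)"]
    by (simp add: fun_eq_iff Suc)
qed

text \<open>Nesting lets each partial derivative act on a single level, whose coefficients do not
  depend on the variable of differentiation.\<close>

definition taylor_sum :: "complex ^ 3 \<Rightarrow> nat \<Rightarrow> nat \<Rightarrow> nat \<Rightarrow> (nat \<Rightarrow> nat \<Rightarrow> nat \<Rightarrow> complex) \<Rightarrow> complex ^ 3 \<Rightarrow> complex" where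
  "taylor_sum p n1 n2 n3 G =
     power_sum p 1 n1 (\<lambda>i. power_sum p 2 n2 (\<lambda>j. power_sum p 3 n3 (\<lambda>k t. G i j k)))"

lemma holomorphic3_on_taylor_sum: "holomorphic3_on (taylor_sum p n1 n2 n3 G) U"
  unfolding taylor_sum_def by (intro holomorphic3_on_power_sum holomorphic3_on_const)

lemma power_sum_zero: "power_sum p m n (\<lambda>i t. 0) = (\<lambda>t. 0)"
  by (simp add: power_sum_def)

lemma partial_const_fun: "partial i (\<lambda>t. c) = (\<lambda>t. 0)"
  by (simp add: fun_eq_iff partial_const)

lemma partial_taylor_sum:
  "partial 1 (taylor_sum p (Suc n1) n2 n3 G) = taylor_sum p n1 n2 n3 (\<lambda>i. G (Suc i))"
  "partial 2 (taylor_sum p n1 (Suc n2) n3 G) = taylor_sum p n1 n2 n3 (\<lambda>i j. G i (Suc j))"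
  "partial 3 (taylor_sum p n1 n2 (Suc n3) G) = taylor_sum p n1 n2 n3 (\<lambda>i j k. G i j (Suc k))"
proof -
  have h3: "holomorphic3_on (power_sum p 3 n (\<lambda>k t. g k)) UNIV" for g n
    by (intro holomorphic3_on_power_sum holomorphic3_on_const)
  have h2: "holomorphic3_on (power_sum p 2 n' (\<lambda>j. power_sum p 3 n (\<lambda>k t. g j k))) UNIV" for g n n'
    by (intro holomorphic3_on_power_sum holomorphic3_on_const)
  have p3: "partial m (power_sum p 3 n (\<lambda>k t. g k)) = (\<lambda>t. 0)" if "m \<noteq> 3" for m g n
    using partial_power_sum_other[OF holomorphic3_on_const that[symmetric], of p n g]
    by (simp add: partial_const_fun power_sum_zero)
  have p2: "partial 1 (power_sum p 2 n' (\<lambda>j. power_sum p 3 n (\<lambda>k t. g j k))) = (\<lambda>t. 0)" for g n n'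
    using partial_power_sum_other[of "\<lambda>j. power_sum p 3 n (\<lambda>k t. g j k)" 2 1 p n', OF h3]
    by (simp add: p3 power_sum_zero)
  show "partial 1 (taylor_sum p (Suc n1) n2 n3 G) = taylor_sum p n1 n2 n3 (\<lambda>i. G (Suc i))"
    unfolding taylor_sum_def by (rule partial_power_sum_same[OF h2]) (simp add: p2)
  have "partial 2 (power_sum p 2 (Suc n2) (\<lambda>j. power_sum p 3 n3 (\<lambda>k t. G i j k)))
      = power_sum p 2 n2 (\<lambda>j. power_sum p 3 n3 (\<lambda>k t. G i (Suc j) k))" for i
    by (rule partial_power_sum_same[OF h3]) (simp add: p3)
  then show "partial 2 (taylor_sum p n1 (Suc n2) n3 G) = taylor_sum p n1 n2 n3 (\<lambda>i j. G i (Suc j))"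
    unfolding taylor_sum_def by (subst partial_power_sum_other[OF h2]) simp_all
  have "partial 3 (power_sum p 3 (Suc n3) (\<lambda>k t. G i j k)) = power_sum p 3 n3 (\<lambda>k t. G i j (Suc k))" for i j
    by (rule partial_power_sum_same) (simp_all add: holomorphic3_on_const partial_const)
  then have "partial 3 (power_sum p 2 n2 (\<lambda>j. power_sum p 3 (Suc n3) (\<lambda>k t. G i j k)))
      = power_sum p 2 n2 (\<lambda>j. power_sum p 3 n3 (\<lambda>k t. G i j (Suc k)))" for i
    by (subst partial_power_sum_other[OF h3]) simp_all
  then show "partial 3 (taylor_sum p n1 n2 (Suc n3) G) = taylor_sum p n1 n2 n3 (\<lambda>i j k. G i j (Suc k))"
    unfolding taylor_sum_def by (subst partial_power_sum_other[OF h2]) simp_all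
qed

lemma funpow_partial_taylor_sum:
  "(partial 1 ^^ i) (taylor_sum p (n1 + i) n2 n3 G) = taylor_sum p n1 n2 n3 (\<lambda>x. G (x + i))"
  "(partial 2 ^^ i) (taylor_sum p n1 (n2 + i) n3 G) = taylor_sum p n1 n2 n3 (\<lambda>x y. G x (y + i))"
  "(partial 3 ^^ i) (taylor_sum p n1 n2 (n3 + i) G) = taylor_sum p n1 n2 n3 (\<lambda>x y z. G x y (z + i))"
  by (induction i arbitrary: G) (simp_all add: partial_taylor_sum funpow_swap1 del: funpow.simps add: funpow_0 funpow_Suc_right)

lemma taylor_sum_at: "taylor_sum p (Suc n1) (Suc n2) (Suc n3) G p = G 0 0 0"
proof -
  have "power_sum p m (Suc n) F p = F 0 p" for m n F
    unfolding power_sum_def by (simp add: sum.lessThan_Suc_shift del: sum.lessThan_Suc)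
  then show ?thesis by (simp add: taylor_sum_def)
qed

lemma jet_of_taylor_sum:
  assumes "i < n1" "j < n2" "k < n3"
  shows "jet_of p (taylor_sum p n1 n2 n3 G) i j k = G i j k"
proof -
  obtain m1 m2 m3 where m: "n1 = Suc m1 + i" "n2 = Suc m2 + j" "n3 = Suc m3 + k"
    using assms by (metis add.commute add_Suc_right less_imp_Suc_add)
  show ?thesis
    unfolding jet_of_def mixed_partial_def m funpow_partial_taylor_sum taylor_sum_at by simp
qed

lemma taylor_sum_eq:
  "taylor_sum p n n n G t = (\<Sum>(i, j, k)\<in>{..<n} \<times> {..<n} \<times> {..<n}.
     G i j k / (fact i * fact j * fact k) * (t $ 1 - p $ 1) ^ i * (t $ 2 - p $ 2) ^ j * (t $ 3 - p $ 3) ^ k)"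
  unfolding taylor_sum_def power_sum_def
  by (simp add: sum_distrib_left sum.cartesian_product case_prod_beta mult_ac divide_inverse)

text \<open>The trinomial coefficient is a product of two binomial coefficients, each at most
  \<open>2 ^ (i + j + k)\<close>.\<close>

lemma fact_add3_le: "fact (i + j + k) \<le> (4 ^ (i + j + k) * (fact i * fact j * fact k) :: real)"
proof -
  have f: "(fact (m + n) :: real) \<le> 2 ^ (m + n) * (fact m * fact n)" for m n
  proof -
    have "(fact (m + n) :: real) = fact m * fact n * real ((m + n) choose m)"
      using binomial_fact_lemma[of m "m + n"] by (metis (mono_tags) diff_add_inverse le_add1 of_nat_fact of_nat_mult)
    also have "\<dots> \<le> fact m * fact n * real (2 ^ (m + n))"
      using binomial_le_pow2[of "m + n" m] by (intro mult_left_mono) (simp_all only: of_nat_le_iff, simp)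
    finally show ?thesis by (simp add: mult.commute)
  qed
  have "(fact (i + j + k) :: real) \<le> 2 ^ (i + j + k) * (fact (i + j) * fact k)" by (rule f)
  also have "\<dots> \<le> 2 ^ (i + j + k) * ((2 ^ (i + j) * (fact i * fact j)) * fact k)"
    by (intro mult_left_mono mult_right_mono f) auto
  also have "\<dots> \<le> 2 ^ (i + j + k) * ((2 ^ (i + j + k) * (fact i * fact j)) * fact k)"
    by (intro mult_left_mono mult_right_mono power_increasing) auto
  also have "\<dots> = 4 ^ (i + j + k) * (fact i * fact j * fact k)"
    by (simp flip: power_mult_distrib mult.assoc)
  finally show ?thesis .
qed

lemma locally_uniform_limit_funpow_partial:
  assumes "\<And>n. holomorphic3_on (f n) U" "open U" "locally_uniform_limit U f g"
  shows "locally_uniform_limit U (\<lambda>n. (partial i ^^ m) (f n)) ((partial i ^^ m) g)"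
proof (induction m)
  case (Suc m)
  from locally_uniform_limit_partial(2)[OF holomorphic3_on_funpow_partial[OF assms(1,2)] this]
  show ?case by simp
qed (simp add: assms(3))

text \<open>The Taylor series is dominated by a geometric series near \<open>p\<close>, and locally
  uniform convergence carries over to all derivatives.\<close>

lemma jet_realize:
  assumes A: "0 \<le> A" and M: "0 \<le> M"
    and G: "\<And>i j k. norm (G i j k) \<le> A * M ^ (i + j + k) * fact (i + j + k)"
  shows "\<exists>u r. 0 < r \<and> holomorphic3_on u (ball p r) \<and> jet_of p u = G"
proof -
  \<comment> \<open>Small enough for \<open>4 * M * r \<le> 1 / 2\<close>; the factor
    \<open>4\<close> is the one from \<open>fact_add3_le\<close>.\<close>
  define r where "r = 1 / (8 * (M + 1))"
  have r: "0 < r" "4 * M * r \<le> 1 / 2" using M by (auto simp: r_def field_simps)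
  define summand :: "complex ^ 3 \<Rightarrow> nat \<times> nat \<times> nat \<Rightarrow> complex" where "summand = (\<lambda>t (i, j, k). G i j k / (fact i * fact j * fact k)
      * (t $ 1 - p $ 1) ^ i * (t $ 2 - p $ 2) ^ j * (t $ 3 - p $ 3) ^ k)"
  define b where "b = (\<lambda>(i, j, k). A * ((1 / 2) ^ i * (1 / 2) ^ j * (1 / 2) ^ k) :: real)"
  define S where "S = (\<lambda>n. taylor_sum p n n n G)"
  \<comment> \<open>Summing over cubes of exponents makes the dominating sum a product of three
    geometric sums.\<close>
  define Box where "Box = (\<lambda>n. {..<n} \<times> {..<n} \<times> {..<n::nat})"
  have S: "S n t = sum (summand t) (Box n)" for n t
    unfolding S_def taylor_sum_eq Box_def by (intro sum.cong refl) (auto simp: summand_def)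
  have tb: "norm (summand t x) \<le> b x" if "t \<in> ball p r" for t x
  proof -
    obtain i j k where x: "x = (i, j, k)" by (cases x)
    have c: "norm (t $ m - p $ m) \<le> r" for m
      using Finite_Cartesian_Product.norm_nth_le[of "t - p" m] that
      by (simp add: dist_norm norm_minus_commute)
    have "norm (G i j k) \<le> A * M ^ (i + j + k) * (4 ^ (i + j + k) * (fact i * fact j * fact k))"
      by (rule order_trans[OF G]) (intro mult_left_mono fact_add3_le mult_nonneg_nonneg zero_le_power A M)
    then have g: "norm (G i j k) / (fact i * fact j * fact k) \<le> A * (4 * M) ^ (i + j + k)"
      by (simp add: pos_divide_le_eq power_mult_distrib mult_ac)
    have "norm (summand t x) = norm (G i j k) / (fact i * fact j * fact k)
        * (norm (t $ 1 - p $ 1) ^ i * norm (t $ 2 - p $ 2) ^ j * norm (t $ 3 - p $ 3) ^ k)"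
      by (simp add: x summand_def norm_mult norm_divide norm_power mult.assoc)
    also have "\<dots> \<le> (A * (4 * M) ^ (i + j + k)) * (r ^ i * r ^ j * r ^ k)"
      using A M r(1) by (intro mult_mono g power_mono c mult_nonneg_nonneg zero_le_power) auto
    also have "\<dots> = A * (4 * M * r) ^ (i + j + k)"
      by (simp add: power_mult_distrib power_add mult_ac)
    also have "\<dots> \<le> A * (1 / 2) ^ (i + j + k)"
      using A M r by (intro mult_left_mono power_mono) auto
    finally show ?thesis by (simp add: b_def x power_add)
  qed
  have sum_b: "sum b (Box n) = (\<Sum>i<n. (1 / 2) ^ i) * ((\<Sum>j<n. (1 / 2) ^ j) * ((\<Sum>k<n. (1 / 2) ^ k) * A))" for n
    unfolding b_def Box_def
    by (simp only: sum_distrib_left sum_distrib_right sum.cartesian_product[symmetric])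
      (simp add: mult_ac)
  have geo: "(\<lambda>n. \<Sum>i<n. (1 / 2 :: real) ^ i) \<longlonglongrightarrow> (\<Sum>i. (1 / 2) ^ i)"
    by (rule summable_LIMSEQ) (simp add: summable_geometric)
  have "convergent (\<lambda>n. sum b (Box n))"
    unfolding sum_b by (rule convergentI[OF tendsto_mult[OF geo tendsto_mult[OF geo tendsto_mult[OF geo tendsto_const]]]])
  then have Cau: "Cauchy (\<lambda>n. sum b (Box n))"
    by (simp add: Cauchy_convergent_iff)
  have fin: "finite (Box n)" for n by (simp add: Box_def)
  have diff: "dist (S m t) (S n t) \<le> dist (sum b (Box m)) (sum b (Box n))" if "t \<in> ball p r" "m \<le> n" for m n t
  proof -
    have sub: "Box m \<subseteq> Box n" using that(2) by (auto simp: Box_def)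
    have "S n t - S m t = sum (summand t) (Box n - Box m)"
      unfolding S using sum_diff[OF fin sub, of "summand t"] by simp
    then have "dist (S m t) (S n t) = norm (sum (summand t) (Box n - Box m))"
      by (metis dist_norm norm_minus_commute)
    also have "\<dots> \<le> sum b (Box n - Box m)"
      by (rule sum_norm_le) (rule tb[OF that(1)])
    also have "\<dots> = sum b (Box n) - sum b (Box m)"
      by (rule sum_diff[OF fin sub])
    finally show ?thesis by (simp add: dist_norm)
  qed
  have "uniformly_Cauchy_on (ball p r) S"
    unfolding uniformly_Cauchy_on_def
  proof (intro allI impI)
    fix e :: real assume "e > 0"
    then obtain N where N: "\<And>m n. m \<ge> N \<Longrightarrow> n \<ge> N \<Longrightarrow> dist (sum b (Box m)) (sum b (Box n)) < e"
      using metric_CauchyD[OF Cau] by metis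
    have "dist (S m t) (S n t) < e" if "t \<in> ball p r" "m \<ge> N" "n \<ge> N" for m n t
      using diff[OF that(1), of m n] diff[OF that(1), of n m] N[OF that(2,3)] N[OF that(3,2)]
      by (cases "m \<le> n") (auto simp: dist_commute)
    then show "\<exists>N. \<forall>t\<in>ball p r. \<forall>m\<ge>N. \<forall>n\<ge>N. dist (S m t) (S n t) < e" by blast
  qed
  then obtain u where u: "uniform_limit (ball p r) S u sequentially"
    using Cauchy_uniformly_convergent uniformly_convergent_on_def by blast
  have hol: "holomorphic3_on (S n) (ball p r)" for n
    unfolding S_def by (rule holomorphic3_on_taylor_sum)
  note lim = locally_uniform_limitI_ball[OF u]
  have "holomorphic3_on u (ball p r)"
    by (rule locally_uniform_limit_partial(1)[OF hol lim])
  \<comment> \<open>The jets of the partial sums at a fixed index are eventually constant, and they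
    converge to the jet of the limit.\<close>
  moreover have "jet_of p u i j k = G i j k" for i j k
  proof -
    note h = holomorphic3_on_funpow_partial[OF _ open_ball]
    have "(\<lambda>n. jet_of p (S n) i j k) \<longlonglongrightarrow> jet_of p u i j k"
      unfolding jet_of_def mixed_partial_def
      by (rule locally_uniform_limit_tendsto, rule locally_uniform_limit_funpow_partial[OF _ open_ball],
          rule h, rule h, rule hol, rule locally_uniform_limit_funpow_partial[OF _ open_ball],
          rule h, rule hol, rule locally_uniform_limit_funpow_partial[OF hol open_ball lim])
        (use r(1) in simp)
    moreover have "\<forall>\<^sub>F n in sequentially. jet_of p (S n) i j k = G i j k"
      using eventually_gt_at_top[of "i + j + k"]
      by (rule eventually_mono) (auto simp: S_def jet_of_taylor_sum)
    then have "(\<lambda>n. jet_of p (S n) i j k) \<longlonglongrightarrow> G i j k"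
      by (rule tendsto_eventually)
    ultimately show ?thesis
      by (rule LIMSEQ_unique)
  qed
  ultimately show ?thesis using r(1) by (auto simp: fun_eq_iff)
qed

section \<open>The system on jets\<close>

text \<open>A jet \<open>G\<close> at \<open>p\<close> collects the derivatives \<open>G i j k = \<partial>\<^sub>1\<^sup>i \<partial>\<^sub>2\<^sup>j \<partial>\<^sub>3\<^sup>k u(p)\<close>. On jets \<open>\<partial>\<^sub>1\<close> is the
  shift in \<open>i\<close>, and by the Leibniz rule multiplication by \<open>t\<^sub>1\<close> maps \<open>G\<close> to
  \<open>p\<^sub>1 G i j k + i G (i - 1) j k\<close>; this gives the formulas for \<open>jetE1\<close>, \<open>jetE2\<close>, \<open>jetE3\<close> below. The
  truncated \<open>i - 1\<close> is harmless because of the factor \<open>i\<close>.\<close>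

type_synonym jet = "nat \<Rightarrow> nat \<Rightarrow> nat \<Rightarrow> complex"

definition gq1 :: "complex ^ 3 \<Rightarrow> complex" where "gq1 p = 1 - (p $ 1)\<^sup>2"
definition gq2 :: "complex ^ 3 \<Rightarrow> complex" where "gq2 p = 1 - (p $ 2)\<^sup>2"
definition gq3 :: "complex ^ 3 \<Rightarrow> complex" where "gq3 p = 1 - (p $ 3)\<^sup>2"
definition gk1 :: "complex ^ 3 \<Rightarrow> complex" where "gk1 p = p $ 1 - p $ 2 * p $ 3"
definition gk2 :: "complex ^ 3 \<Rightarrow> complex" where "gk2 p = p $ 2 - p $ 3 * p $ 1"
definition gk3 :: "complex ^ 3 \<Rightarrow> complex" where "gk3 p = p $ 3 - p $ 1 * p $ 2"

lemmas gdefs = gq1_def gq2_def gq3_def gk1_def gk2_def gk3_def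

definition jetE1 :: "(nat \<Rightarrow> nat \<Rightarrow> complex) \<Rightarrow> complex ^ 3 \<Rightarrow> jet \<Rightarrow> jet" where
  "jetE1 a p G i j k =
     gq2 p * G i (Suc (Suc j)) k + 2 * gk1 p * G i (Suc j) (Suc k) + gq3 p * G i j (Suc (Suc k))
     + 2 * of_nat i * G (i - 1) (Suc j) (Suc k)
     + a 1 1 * p $ 1 * G (Suc i) j k
     + (a 1 2 - 2 * of_nat j - 2 * of_nat k) * p $ 2 * G i (Suc j) k
     + (a 1 3 - 2 * of_nat j - 2 * of_nat k) * p $ 3 * G i j (Suc k)
     + (a 1 0 + a 1 1 * of_nat i + a 1 2 * of_nat j + a 1 3 * of_nat k
        - (of_nat j + of_nat k) * (of_nat j + of_nat k - 1)) * G i j k"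

definition jetE2 :: "(nat \<Rightarrow> nat \<Rightarrow> complex) \<Rightarrow> complex ^ 3 \<Rightarrow> jet \<Rightarrow> jet" where
  "jetE2 a p G i j k =
     gq3 p * G i j (Suc (Suc k)) + 2 * gk2 p * G (Suc i) j (Suc k) + gq1 p * G (Suc (Suc i)) j k
     + 2 * of_nat j * G (Suc i) (j - 1) (Suc k)
     + (a 2 1 - 2 * of_nat i - 2 * of_nat k) * p $ 1 * G (Suc i) j k
     + a 2 2 * p $ 2 * G i (Suc j) k
     + (a 2 3 - 2 * of_nat i - 2 * of_nat k) * p $ 3 * G i j (Suc k)
     + (a 2 0 + a 2 1 * of_nat i + a 2 2 * of_nat j + a 2 3 * of_nat k
        - (of_nat i + of_nat k) * (of_nat i + of_nat k - 1)) * G i j k"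

definition jetE3 :: "(nat \<Rightarrow> nat \<Rightarrow> complex) \<Rightarrow> complex ^ 3 \<Rightarrow> jet \<Rightarrow> jet" where
  "jetE3 a p G i j k =
     gq1 p * G (Suc (Suc i)) j k + 2 * gk3 p * G (Suc i) (Suc j) k + gq2 p * G i (Suc (Suc j)) k
     + 2 * of_nat k * G (Suc i) (Suc j) (k - 1)
     + (a 3 1 - 2 * of_nat i - 2 * of_nat j) * p $ 1 * G (Suc i) j k
     + (a 3 2 - 2 * of_nat i - 2 * of_nat j) * p $ 2 * G i (Suc j) k
     + a 3 3 * p $ 3 * G i j (Suc k)
     + (a 3 0 + a 3 1 * of_nat i + a 3 2 * of_nat j + a 3 3 * of_nat k
        - (of_nat i + of_nat j) * (of_nat i + of_nat j - 1)) * G i j k"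

text \<open>The case splits resolve the truncated \<open>i - 1\<close> in \<open>jetE1\<close> and
  \<open>j - 1\<close> in \<open>jetE2\<close>. What remains is a polynomial identity in
  \<open>p\<close>, the indices and finitely many entries of \<open>G\<close>; the other two pairs
  are treated alike.\<close>

lemma jetE12_commute:
  assumes "a 1 1 = 0" "a 2 2 = 0" "a 1 2 = s" "a 1 3 = s" "a 2 1 = s" "a 2 3 = s"
  shows "jetE1 a p (jetE2 a p G) = jetE2 a p (jetE1 a p G)"
proof (intro ext)
  fix i j k
  show "jetE1 a p (jetE2 a p G) i j k = jetE2 a p (jetE1 a p G) i j k"
  proof (cases i)
    case i: 0
    show ?thesis unfolding i
    proof (cases j)
      case j: 0
      show "jetE1 a p (jetE2 a p G) 0 j k = jetE2 a p (jetE1 a p G) 0 j k"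
        unfolding j
        by (simp add: jetE1_def jetE2_def assms[unfolded One_nat_def] gdefs) algebra
    next
      case j: (Suc j')
      show "jetE1 a p (jetE2 a p G) 0 j k = jetE2 a p (jetE1 a p G) 0 j k"
        unfolding j
        by (simp add: jetE1_def jetE2_def assms[unfolded One_nat_def] gdefs) algebra
    qed
  next
    case i: (Suc i')
    show ?thesis unfolding i
    proof (cases j)
      case j: 0
      show "jetE1 a p (jetE2 a p G) (Suc i') j k = jetE2 a p (jetE1 a p G) (Suc i') j k"
        unfolding j
        by (simp add: jetE1_def jetE2_def assms[unfolded One_nat_def] gdefs) algebra
    next
      case j: (Suc j')
      show "jetE1 a p (jetE2 a p G) (Suc i') j k = jetE2 a p (jetE1 a p G) (Suc i') j k"
        unfolding j
        by (simp add: jetE1_def jetE2_def assms[unfolded One_nat_def] gdefs) algebra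
    qed
  qed
qed

lemma jetE13_commute:
  assumes "a 1 1 = 0" "a 3 3 = 0" "a 1 2 = s" "a 1 3 = s" "a 3 1 = s" "a 3 2 = s"
  shows "jetE1 a p (jetE3 a p G) = jetE3 a p (jetE1 a p G)"
proof (intro ext)
  fix i j k
  show "jetE1 a p (jetE3 a p G) i j k = jetE3 a p (jetE1 a p G) i j k"
  proof (cases i)
    case i: 0
    show ?thesis unfolding i
    proof (cases k)
      case k: 0
      show "jetE1 a p (jetE3 a p G) 0 j k = jetE3 a p (jetE1 a p G) 0 j k"
        unfolding k
        by (simp add: jetE1_def jetE3_def assms[unfolded One_nat_def] gdefs) algebra
    next
      case k: (Suc k')
      show "jetE1 a p (jetE3 a p G) 0 j k = jetE3 a p (jetE1 a p G) 0 j k"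
        unfolding k
        by (simp add: jetE1_def jetE3_def assms[unfolded One_nat_def] gdefs) algebra
    qed
  next
    case i: (Suc i')
    show ?thesis unfolding i
    proof (cases k)
      case k: 0
      show "jetE1 a p (jetE3 a p G) (Suc i') j k = jetE3 a p (jetE1 a p G) (Suc i') j k"
        unfolding k
        by (simp add: jetE1_def jetE3_def assms[unfolded One_nat_def] gdefs) algebra
    next
      case k: (Suc k')
      show "jetE1 a p (jetE3 a p G) (Suc i') j k = jetE3 a p (jetE1 a p G) (Suc i') j k"
        unfolding k
        by (simp add: jetE1_def jetE3_def assms[unfolded One_nat_def] gdefs) algebra
    qed
  qed
qed

lemma jetE23_commute:
  assumes "a 2 2 = 0" "a 3 3 = 0" "a 2 1 = s" "a 2 3 = s" "a 3 1 = s" "a 3 2 = s"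
  shows "jetE2 a p (jetE3 a p G) = jetE3 a p (jetE2 a p G)"
proof (intro ext)
  fix i j k
  show "jetE2 a p (jetE3 a p G) i j k = jetE3 a p (jetE2 a p G) i j k"
  proof (cases j)
    case j: 0
    show ?thesis unfolding j
    proof (cases k)
      case k: 0
      show "jetE2 a p (jetE3 a p G) i 0 k = jetE3 a p (jetE2 a p G) i 0 k"
        unfolding k
        by (simp add: jetE2_def jetE3_def assms[unfolded One_nat_def] gdefs) algebra
    next
      case k: (Suc k')
      show "jetE2 a p (jetE3 a p G) i 0 k = jetE3 a p (jetE2 a p G) i 0 k"
        unfolding k
        by (simp add: jetE2_def jetE3_def assms[unfolded One_nat_def] gdefs) algebra
    qed
  next
    case j: (Suc j')
    show ?thesis unfolding j
    proof (cases k)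
      case k: 0
      show "jetE2 a p (jetE3 a p G) i (Suc j') k = jetE3 a p (jetE2 a p G) i (Suc j') k"
        unfolding k
        by (simp add: jetE2_def jetE3_def assms[unfolded One_nat_def] gdefs) algebra
    next
      case k: (Suc k')
      show "jetE2 a p (jetE3 a p G) i (Suc j') k = jetE3 a p (jetE2 a p G) i (Suc j') k"
        unfolding k
        by (simp add: jetE2_def jetE3_def assms[unfolded One_nat_def] gdefs) algebra
    qed
  qed
qed

section \<open>Principal symbols and the fourth-order estimate\<close>

text \<open>The adjugate of the Gram matrix with diagonal \<open>1\<close> and off-diagonal entries \<open>t\<^sub>i\<close> has entries \<open>gq\<^sub>i\<close>
  and \<open>- gk\<^sub>i\<close>. Hence \<open>gdelta\<close>, its determinant, is the square of the Gram determinant.\<close>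

definition gdelta :: "complex ^ 3 \<Rightarrow> complex" where
  "gdelta p = gq1 p * gq2 p * gq3 p - gq1 p * (gk1 p)\<^sup>2 - gq2 p * (gk2 p)\<^sup>2 - gq3 p * (gk3 p)\<^sup>2
     - 2 * gk1 p * gk2 p * gk3 p"

text \<open>Nonzero \<open>gq\<close> allow solving for the pure second derivatives; nonzero
  \<open>gdelta\<close> makes the linear systems in orders three and four uniquely solvable, which
  rules out a common zero of the symbols.\<close>

definition generic :: "complex ^ 3 \<Rightarrow> bool" where
  "generic p \<longleftrightarrow> gq1 p \<noteq> 0 \<and> gq2 p \<noteq> 0 \<and> gq3 p \<noteq> 0 \<and> gdelta p \<noteq> 0"

text \<open>The principal symbols of \<open>(E\<^sub>2 + E\<^sub>3 - E\<^sub>1) / 2\<close> and its cyclic images. They have the advantage that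
  each contains only one of the squares \<open>\<partial>\<^sub>i\<^sup>2\<close>.\<close>

definition symb1 :: "complex ^ 3 \<Rightarrow> jet \<Rightarrow> jet" where
  "symb1 p G i j k = gq1 p * G (Suc (Suc i)) j k + gk3 p * G (Suc i) (Suc j) k
     + gk2 p * G (Suc i) j (Suc k) - gk1 p * G i (Suc j) (Suc k)"

definition symb2 :: "complex ^ 3 \<Rightarrow> jet \<Rightarrow> jet" where
  "symb2 p G i j k = gq2 p * G i (Suc (Suc j)) k + gk3 p * G (Suc i) (Suc j) k
     + gk1 p * G i (Suc j) (Suc k) - gk2 p * G (Suc i) j (Suc k)"

definition symb3 :: "complex ^ 3 \<Rightarrow> jet \<Rightarrow> jet" where
  "symb3 p G i j k = gq3 p * G i j (Suc (Suc k)) + gk2 p * G (Suc i) j (Suc k)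
     + gk1 p * G i (Suc j) (Suc k) - gk3 p * G (Suc i) (Suc j) k"

definition symb_le :: "complex ^ 3 \<Rightarrow> jet \<Rightarrow> real \<Rightarrow> bool" where
  "symb_le p G e \<longleftrightarrow> (\<forall>i j k. i + j + k = 2 \<longrightarrow>
     norm (symb1 p G i j k) \<le> e \<and> norm (symb2 p G i j k) \<le> e \<and> norm (symb3 p G i j k) \<le> e)"

text \<open>Stands in for "\<open>F\<close> is a linear combination of fourth-order symbols". Its
  closure properties keep track of the constants, whose existence, uniform in \<open>G\<close> and
  \<open>e\<close>, is all that the growth estimate uses.\<close>

definition symb_bounded :: "complex ^ 3 \<Rightarrow> (jet \<Rightarrow> complex) \<Rightarrow> bool" where
  "symb_bounded p F \<longleftrightarrow> (\<exists>C\<ge>0. \<forall>G e. symb_le p G e \<longrightarrow> norm (F G) \<le> C * e)"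

lemma symb_le_nonneg: "symb_le p G e \<Longrightarrow> 0 \<le> e"
  unfolding symb_le_def by (metis add.right_neutral norm_ge_zero order_trans)

lemma symb_bounded_add:
  assumes "symb_bounded p F" "symb_bounded p F'"
  shows "symb_bounded p (\<lambda>G. F G + F' G)"
proof -
  obtain C C' where C: "C \<ge> 0" "\<And>G e. symb_le p G e \<Longrightarrow> norm (F G) \<le> C * e"
    and C': "C' \<ge> 0" "\<And>G e. symb_le p G e \<Longrightarrow> norm (F' G) \<le> C' * e"
    using assms unfolding symb_bounded_def by blast
  have "norm (F G + F' G) \<le> (C + C') * e" if "symb_le p G e" for G e
    using norm_triangle_mono[OF C(2) C'(2), OF that that] by (simp add: algebra_simps)
  with C C' show ?thesis
    unfolding symb_bounded_def by (intro exI[of _ "C + C'"]) auto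
qed

lemma symb_bounded_cmult:
  assumes "symb_bounded p F"
  shows "symb_bounded p (\<lambda>G. c * F G)"
proof -
  obtain C where C: "C \<ge> 0" "\<And>G e. symb_le p G e \<Longrightarrow> norm (F G) \<le> C * e"
    using assms unfolding symb_bounded_def by blast
  have "norm (c * F G) \<le> (norm c * C) * e" if "symb_le p G e" for G e
    using mult_left_mono[OF C(2)[OF that] norm_ge_zero[of c]] by (simp add: norm_mult mult.assoc)
  with C show ?thesis
    unfolding symb_bounded_def by (intro exI[of _ "norm c * C"]) auto
qed

lemma symb_bounded_diff:
  assumes "symb_bounded p F" "symb_bounded p F'"
  shows "symb_bounded p (\<lambda>G. F G - F' G)"
  using symb_bounded_add[OF assms(1) symb_bounded_cmult[OF assms(2), of "-1"]] by simp

lemma symb_bounded_cancel: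
  assumes "symb_bounded p F" "c \<noteq> 0" "\<And>G. c * F' G = F G"
  shows "symb_bounded p F'"
proof -
  have "F' = (\<lambda>G. inverse c * F G)"
    using assms(2) by (auto simp flip: assms(3))
  then show ?thesis
    using symb_bounded_cmult[OF assms(1), of "inverse c"] by simp
qed

lemma symb_bounded_symb:
  assumes "i + j + k = 2"
  shows "symb_bounded p (\<lambda>G. symb1 p G i j k)" "symb_bounded p (\<lambda>G. symb2 p G i j k)"
    "symb_bounded p (\<lambda>G. symb3 p G i j k)"
  using assms unfolding symb_bounded_def symb_le_def by (auto intro!: exI[of _ 1])

lemmas symb_bounded_intros =
  symb_bounded_add symb_bounded_diff symb_bounded_cmult symb_bounded_symb

lemmas symb_defs = symb1_def symb2_def symb3_def

lemma sum_eq_4_cases: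
  assumes "i + j + k = (4::nat)"
  shows "(i, j, k) \<in> {(4,0,0),(3,1,0),(3,0,1),(2,2,0),(2,1,1),(2,0,2),(1,3,0),(1,2,1),(1,1,2),(1,0,3),
    (0,4,0),(0,3,1),(0,2,2),(0,1,3),(0,0,4)}"
proof -
  have "i \<le> 4" "j \<le> 4" using assms by auto
  then have "i = 0 \<or> i = 1 \<or> i = 2 \<or> i = 3 \<or> i = 4" "j = 0 \<or> j = 1 \<or> j = 2 \<or> j = 3 \<or> j = 4" by linarith+
  moreover have "k = 4 - i - j" "i + j \<le> 4" using assms by auto
  ultimately show ?thesis by (elim disjE) simp_all
qed

text \<open>With \<open>x\<^sub>i\<close> the coefficient at \<open>\<xi>\<^sub>i \<xi>\<^sub>1 \<xi>\<^sub>2 \<xi>\<^sub>3\<close>, the combinations \<open>L\<^sub>i\<close> of symbols are twice the cofactor matrix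
  of the matrix with determinant \<open>gdelta\<close> above, applied to \<open>(q\<^sub>i x\<^sub>i)\<^sub>i\<close>; Cramer's rule yields the
  \<open>x\<^sub>i\<close>, and the other fourth-order coefficients follow.\<close>

lemma symb_bounded_degree4:
  assumes "generic p" "i + j + k = 4"
  shows "symb_bounded p (\<lambda>G. G i j k)"
proof -
  define q1 q2 q3 k1 k2 k3 d where g: "q1 = gq1 p" "q2 = gq2 p" "q3 = gq3 p"
    "k1 = gk1 p" "k2 = gk2 p" "k3 = gk3 p" "d = gdelta p"
  have nz: "q1 \<noteq> 0" "q2 \<noteq> 0" "q3 \<noteq> 0" "d \<noteq> 0"
    using assms(1) by (auto simp: generic_def g)
  have d: "d = q1 * q2 * q3 - q1 * k1\<^sup>2 - q2 * k2\<^sup>2 - q3 * k3\<^sup>2 - 2 * k1 * k2 * k3"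
    by (simp add: g gdelta_def)
  note sd = symb_defs g[symmetric]
  let ?B = "symb_bounded p"
  \<comment> \<open>\<open>F1\<close> is the symbol of \<open>E1\<close> at index
    \<open>(2,0,0)\<close>: the entries \<open>G 3 1 0\<close> and \<open>G 3 0 1\<close> cancel.
    Only products of two squares and the \<open>x\<^sub>i\<close> remain.\<close>
  define F1 where "F1 = (\<lambda>G. symb2 p G 2 0 0 + symb3 p G 2 0 0)"
  define F2 where "F2 = (\<lambda>G. symb1 p G 0 2 0 + symb3 p G 0 2 0)"
  define F3 where "F3 = (\<lambda>G. symb1 p G 0 0 2 + symb2 p G 0 0 2)"
  note Fd = F1_def F2_def F3_def
  have F: "?B F1" "?B F2" "?B F3"
    unfolding Fd by (intro symb_bounded_intros; simp)+
  \<comment> \<open>The bracket equals \<open>2 * q2 * q3 * G 0 2 2\<close> up to multiples of the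
    \<open>x\<^sub>i\<close>, so \<open>L1\<close> eliminates \<open>G 0 2 2\<close> from
    \<open>symb1\<close> at \<open>(0,1,1)\<close>.\<close>
  define L1 where "L1 = (\<lambda>G. (2 * q2 * q3) * symb1 p G 0 1 1 + k1 * (q2 * F2 G + q3 * F3 G - q1 * F1 G))"
  define L2 where "L2 = (\<lambda>G. (2 * q1 * q3) * symb2 p G 1 0 1 + k2 * (q1 * F1 G + q3 * F3 G - q2 * F2 G))"
  define L3 where "L3 = (\<lambda>G. (2 * q1 * q2) * symb3 p G 1 1 0 + k3 * (q1 * F1 G + q2 * F2 G - q3 * F3 G))"
  note Ld = L1_def L2_def L3_def
  have L: "?B L1" "?B L2" "?B L3"
    unfolding Ld by (intro symb_bounded_intros F; simp)+
  have L1: "L1 G = 2 * (q1 * (q2 * q3 - k1\<^sup>2) * G 2 1 1 + q2 * (q3 * k3 + k1 * k2) * G 1 2 1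
      + q3 * (q2 * k2 + k1 * k3) * G 1 1 2)" for G
    unfolding Ld Fd sd by (simp add: eval_nat_numeral) algebra
  have L2: "L2 G = 2 * (q1 * (q3 * k3 + k1 * k2) * G 2 1 1 + q2 * (q1 * q3 - k2\<^sup>2) * G 1 2 1
      + q3 * (q1 * k1 + k2 * k3) * G 1 1 2)" for G
    unfolding Ld Fd sd by (simp add: eval_nat_numeral) algebra
  have L3: "L3 G = 2 * (q1 * (q2 * k2 + k1 * k3) * G 2 1 1 + q2 * (q1 * k1 + k2 * k3) * G 1 2 1
      + q3 * (q1 * q2 - k3\<^sup>2) * G 1 1 2)" for G
    unfolding Ld Fd sd by (simp add: eval_nat_numeral) algebra
  have x1: "?B (\<lambda>G. G 2 1 1)"
  proof (rule symb_bounded_cancel)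
    show "?B (\<lambda>G. q1 * L1 G - k3 * L2 G - k2 * L3 G)"
      by (intro symb_bounded_intros L; simp)
    show "2 * d * q1 \<noteq> 0"
      using nz by simp
    show "2 * d * q1 * G 2 1 1 = q1 * L1 G - k3 * L2 G - k2 * L3 G" for G
      unfolding L1 L2 L3 d by algebra
  qed
  have x2: "?B (\<lambda>G. G 1 2 1)"
  proof (rule symb_bounded_cancel)
    show "?B (\<lambda>G. q2 * L2 G - k3 * L1 G - k1 * L3 G)"
      by (intro symb_bounded_intros L; simp)
    show "2 * d * q2 \<noteq> 0"
      using nz by simp
    show "2 * d * q2 * G 1 2 1 = q2 * L2 G - k3 * L1 G - k1 * L3 G" for G
      unfolding L1 L2 L3 d by algebra
  qed
  have x3: "?B (\<lambda>G. G 1 1 2)"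
  proof (rule symb_bounded_cancel)
    show "?B (\<lambda>G. q3 * L3 G - k2 * L1 G - k1 * L2 G)"
      by (intro symb_bounded_intros L; simp)
    show "2 * d * q3 \<noteq> 0"
      using nz by simp
    show "2 * d * q3 * G 1 1 2 = q3 * L3 G - k2 * L1 G - k1 * L2 G" for G
      unfolding L1 L2 L3 d by algebra
  qed
  have y1: "?B (\<lambda>G. G 0 2 2)"
  proof (rule symb_bounded_cancel)
    show "?B (\<lambda>G. q2 * F2 G + q3 * F3 G - q1 * F1 G
        - (2 * k2 * q2) * G 1 2 1 - (2 * k3 * q3) * G 1 1 2 + (2 * k1 * q1) * G 2 1 1)"
      by (intro symb_bounded_intros F x1 x2 x3; simp)
    show "2 * q2 * q3 \<noteq> 0"
      using nz by simp
    show "2 * q2 * q3 * G 0 2 2 = q2 * F2 G + q3 * F3 G - q1 * F1 G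
        - (2 * k2 * q2) * G 1 2 1 - (2 * k3 * q3) * G 1 1 2 + (2 * k1 * q1) * G 2 1 1" for G
      unfolding Fd sd by (simp add: eval_nat_numeral) algebra
  qed
  have y2: "?B (\<lambda>G. G 2 0 2)"
  proof (rule symb_bounded_cancel)
    show "?B (\<lambda>G. q1 * F1 G + q3 * F3 G - q2 * F2 G
        - (2 * k1 * q1) * G 2 1 1 - (2 * k3 * q3) * G 1 1 2 + (2 * k2 * q2) * G 1 2 1)"
      by (intro symb_bounded_intros F x1 x2 x3; simp)
    show "2 * q1 * q3 \<noteq> 0"
      using nz by simp
    show "2 * q1 * q3 * G 2 0 2 = q1 * F1 G + q3 * F3 G - q2 * F2 G
        - (2 * k1 * q1) * G 2 1 1 - (2 * k3 * q3) * G 1 1 2 + (2 * k2 * q2) * G 1 2 1" for G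
      unfolding Fd sd by (simp add: eval_nat_numeral) algebra
  qed
  have y3: "?B (\<lambda>G. G 2 2 0)"
  proof (rule symb_bounded_cancel)
    show "?B (\<lambda>G. q1 * F1 G + q2 * F2 G - q3 * F3 G
        - (2 * k1 * q1) * G 2 1 1 - (2 * k2 * q2) * G 1 2 1 + (2 * k3 * q3) * G 1 1 2)"
      by (intro symb_bounded_intros F x1 x2 x3; simp)
    show "2 * q1 * q2 \<noteq> 0"
      using nz by simp
    show "2 * q1 * q2 * G 2 2 0 = q1 * F1 G + q2 * F2 G - q3 * F3 G
        - (2 * k1 * q1) * G 2 1 1 - (2 * k2 * q2) * G 1 2 1 + (2 * k3 * q3) * G 1 1 2" for G
      unfolding Fd sd by (simp add: eval_nat_numeral) algebra
  qed
  note xy = x1 x2 x3 y1 y2 y3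
  have c310: "?B (\<lambda>G. G 3 1 0)"
  proof (rule symb_bounded_cancel)
    show "?B (\<lambda>G. symb1 p G 1 1 0 - k3 * G 2 2 0 - k2 * G 2 1 1 + k1 * G 1 2 1)"
      by (intro symb_bounded_intros xy; simp)
    show "q1 \<noteq> 0"
      using nz by simp
    show "q1 * G 3 1 0 = symb1 p G 1 1 0 - k3 * G 2 2 0 - k2 * G 2 1 1 + k1 * G 1 2 1" for G
      unfolding sd by (simp add: eval_nat_numeral)
  qed
  have c301: "?B (\<lambda>G. G 3 0 1)"
  proof (rule symb_bounded_cancel)
    show "?B (\<lambda>G. symb1 p G 1 0 1 - k3 * G 2 1 1 - k2 * G 2 0 2 + k1 * G 1 1 2)"
      by (intro symb_bounded_intros xy; simp)
    show "q1 \<noteq> 0"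
      using nz by simp
    show "q1 * G 3 0 1 = symb1 p G 1 0 1 - k3 * G 2 1 1 - k2 * G 2 0 2 + k1 * G 1 1 2" for G
      unfolding sd by (simp add: eval_nat_numeral)
  qed
  have c130: "?B (\<lambda>G. G 1 3 0)"
  proof (rule symb_bounded_cancel)
    show "?B (\<lambda>G. symb2 p G 1 1 0 - k3 * G 2 2 0 - k1 * G 1 2 1 + k2 * G 2 1 1)"
      by (intro symb_bounded_intros xy; simp)
    show "q2 \<noteq> 0"
      using nz by simp
    show "q2 * G 1 3 0 = symb2 p G 1 1 0 - k3 * G 2 2 0 - k1 * G 1 2 1 + k2 * G 2 1 1" for G
      unfolding sd by (simp add: eval_nat_numeral)
  qed
  have c031: "?B (\<lambda>G. G 0 3 1)"
  proof (rule symb_bounded_cancel)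
    show "?B (\<lambda>G. symb2 p G 0 1 1 - k3 * G 1 2 1 - k1 * G 0 2 2 + k2 * G 1 1 2)"
      by (intro symb_bounded_intros xy; simp)
    show "q2 \<noteq> 0"
      using nz by simp
    show "q2 * G 0 3 1 = symb2 p G 0 1 1 - k3 * G 1 2 1 - k1 * G 0 2 2 + k2 * G 1 1 2" for G
      unfolding sd by (simp add: eval_nat_numeral)
  qed
  have c103: "?B (\<lambda>G. G 1 0 3)"
  proof (rule symb_bounded_cancel)
    show "?B (\<lambda>G. symb3 p G 1 0 1 - k2 * G 2 0 2 - k1 * G 1 1 2 + k3 * G 2 1 1)"
      by (intro symb_bounded_intros xy; simp)
    show "q3 \<noteq> 0"
      using nz by simp
    show "q3 * G 1 0 3 = symb3 p G 1 0 1 - k2 * G 2 0 2 - k1 * G 1 1 2 + k3 * G 2 1 1" for G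
      unfolding sd by (simp add: eval_nat_numeral)
  qed
  have c013: "?B (\<lambda>G. G 0 1 3)"
  proof (rule symb_bounded_cancel)
    show "?B (\<lambda>G. symb3 p G 0 1 1 - k2 * G 1 1 2 - k1 * G 0 2 2 + k3 * G 1 2 1)"
      by (intro symb_bounded_intros xy; simp)
    show "q3 \<noteq> 0"
      using nz by simp
    show "q3 * G 0 1 3 = symb3 p G 0 1 1 - k2 * G 1 1 2 - k1 * G 0 2 2 + k3 * G 1 2 1" for G
      unfolding sd by (simp add: eval_nat_numeral)
  qed
  note xyc = xy c310 c301 c130 c031 c103 c013
  have c400: "?B (\<lambda>G. G 4 0 0)"
  proof (rule symb_bounded_cancel)
    show "?B (\<lambda>G. symb1 p G 2 0 0 - k3 * G 3 1 0 - k2 * G 3 0 1 + k1 * G 2 1 1)"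
      by (intro symb_bounded_intros xyc; simp)
    show "q1 \<noteq> 0"
      using nz by simp
    show "q1 * G 4 0 0 = symb1 p G 2 0 0 - k3 * G 3 1 0 - k2 * G 3 0 1 + k1 * G 2 1 1" for G
      unfolding sd by (simp add: eval_nat_numeral)
  qed
  have c040: "?B (\<lambda>G. G 0 4 0)"
  proof (rule symb_bounded_cancel)
    show "?B (\<lambda>G. symb2 p G 0 2 0 - k3 * G 1 3 0 - k1 * G 0 3 1 + k2 * G 1 2 1)"
      by (intro symb_bounded_intros xyc; simp)
    show "q2 \<noteq> 0"
      using nz by simp
    show "q2 * G 0 4 0 = symb2 p G 0 2 0 - k3 * G 1 3 0 - k1 * G 0 3 1 + k2 * G 1 2 1" for G
      unfolding sd by (simp add: eval_nat_numeral)
  qed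
  have c004: "?B (\<lambda>G. G 0 0 4)"
  proof (rule symb_bounded_cancel)
    show "?B (\<lambda>G. symb3 p G 0 0 2 - k2 * G 1 0 3 - k1 * G 0 1 3 + k3 * G 1 1 2)"
      by (intro symb_bounded_intros xyc; simp)
    show "q3 \<noteq> 0"
      using nz by simp
    show "q3 * G 0 0 4 = symb3 p G 0 0 2 - k2 * G 1 0 3 - k1 * G 0 1 3 + k3 * G 1 1 2" for G
      unfolding sd by (simp add: eval_nat_numeral)
  qed
  show ?thesis
    using sum_eq_4_cases[OF assms(2)] xyc c400 c040 c004 by auto
qed

section \<open>Formal solutions\<close>

text \<open>Gaussian elimination, one equation at a time: a nonzero coefficient
  \<open>A i j0\<close> removes the unknown \<open>j0\<close>, \<open>A'\<close> is the reduced
  system, and \<open>y\<close> restores \<open>j0\<close> by back substitution.\<close>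

lemma underdetermined_system:
  fixes A :: "'i \<Rightarrow> 'j \<Rightarrow> 'a::field"
  assumes "finite I" "finite J" "card I < card J"
  shows "\<exists>x. (\<exists>j\<in>J. x j \<noteq> 0) \<and> (\<forall>i\<in>I. (\<Sum>j\<in>J. A i j * x j) = 0)"
  using assms
proof (induction I arbitrary: J A rule: finite_induct)
  case empty
  then have "J \<noteq> {}" by auto
  then show ?case by (intro exI[of _ "\<lambda>_. 1"]) auto
next
  case (insert i I)
  show ?case
  proof (cases "\<forall>j\<in>J. A i j = 0")
    case True
    moreover obtain x where "\<exists>j\<in>J. x j \<noteq> 0" "\<forall>i\<in>I. (\<Sum>j\<in>J. A i j * x j) = 0"
      using insert.IH[of J A] insert.prems insert.hyps by auto
    ultimately show ?thesis by (intro exI[of _ x]) auto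
  next
    case False
    then obtain j0 where j0: "j0 \<in> J" "A i j0 \<noteq> 0" by auto
    define J' where "J' = J - {j0}"
    define A' where "A' = (\<lambda>i' j. A i' j - A i' j0 * A i j / A i j0)"
    have J': "finite J'" "card I < card J'" "j0 \<notin> J'" and J: "J = insert j0 J'"
      using insert j0 by (auto simp: J'_def)
    obtain x where x: "\<exists>j\<in>J'. x j \<noteq> 0" "\<And>i. i \<in> I \<Longrightarrow> (\<Sum>j\<in>J'. A' i j * x j) = 0"
      using insert.IH[OF J'(1,2), of A'] by blast
    define y where "y = x(j0 := - (\<Sum>j\<in>J'. A i j * x j) / A i j0)"
    have S: "(\<Sum>j\<in>J. A i' j * y j) = (\<Sum>j\<in>J'. A' i' j * x j)" for i'
    proof -
      have "(\<Sum>j\<in>J. A i' j * y j) = A i' j0 * y j0 + (\<Sum>j\<in>J'. A i' j * y j)"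
        using J' by (simp add: J)
      also have "(\<Sum>j\<in>J'. A i' j * y j) = (\<Sum>j\<in>J'. A i' j * x j)"
        using J'(3) by (intro sum.cong) (auto simp: y_def)
      also have "A i' j0 * y j0 = - (\<Sum>j\<in>J'. A i' j0 * A i j / A i j0 * x j)"
        by (simp add: y_def sum_distrib_left sum_divide_distrib mult.assoc flip: sum_negf)
      finally show ?thesis
        by (simp add: A'_def left_diff_distrib sum_subtractf)
    qed
    have "(\<Sum>j\<in>J'. A' i j * x j) = 0"
      using j0 by (simp add: A'_def)
    moreover have "\<exists>j\<in>J. y j \<noteq> 0"
      using x(1) J'(3) J by (auto simp: y_def)
    ultimately show ?thesis
      using S x(2) by (intro exI[of _ y]) auto
  qed
qed

text \<open>Adjoining \<open>- y\<close> as a column indexed by \<open>None\<close> gives more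
  unknowns than equations. Injectivity forces the \<open>None\<close> entry of a nontrivial solution
  to be nonzero, and dividing by it solves the system.\<close>

lemma square_system_solvable:
  fixes A :: "'i \<Rightarrow> 'i \<Rightarrow> 'a::field"
  assumes "finite S"
    and inj: "\<And>x j. (\<And>i. i \<in> S \<Longrightarrow> (\<Sum>j\<in>S. A i j * x j) = 0) \<Longrightarrow> j \<in> S \<Longrightarrow> x j = 0"
  shows "\<exists>x. \<forall>i\<in>S. (\<Sum>j\<in>S. A i j * x j) = y i"
proof -
  define J where "J = insert None (Some ` S)"
  define B where "B = (\<lambda>i j. case j of None \<Rightarrow> - y i | Some j \<Rightarrow> A i j)"
  have "card S < card J"
    using assms(1) by (simp add: J_def card_image)
  then obtain x where x: "\<exists>j\<in>J. x j \<noteq> 0" "\<forall>i\<in>S. (\<Sum>j\<in>J. B i j * x j) = 0"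
    using underdetermined_system[of S J B] assms(1) by (auto simp: J_def)
  have eq: "(\<Sum>j\<in>S. A i j * x (Some j)) = y i * x None" if "i \<in> S" for i
    using x(2) that assms(1) by (force simp: J_def B_def sum.reindex)
  have "x None \<noteq> 0"
  proof
    assume "x None = 0"
    with eq inj[of "\<lambda>j. x (Some j)"] x(1) show False
      by (auto simp: J_def)
  qed
  with eq show ?thesis
    by (intro exI[of _ "\<lambda>j. x (Some j) / x None"]) (simp flip: sum_divide_distrib)
qed

section \<open>Linearity and order of the operators on jets\<close>

definition jet_linear :: "(jet \<Rightarrow> jet) \<Rightarrow> bool" where
  "jet_linear L \<longleftrightarrow> (\<forall>G H. L (\<lambda>i j k. G i j k + H i j k) = (\<lambda>i j k. L G i j k + L H i j k)) \<and>
     (\<forall>c G. L (\<lambda>i j k. c * G i j k) = (\<lambda>i j k. c * L G i j k))"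

definition jet_vanish :: "nat \<Rightarrow> jet \<Rightarrow> bool" where
  "jet_vanish n G \<longleftrightarrow> (\<forall>i j k. i + j + k < n \<longrightarrow> G i j k = 0)"

lemma jet_linear_funpow: "jet_linear L \<Longrightarrow> jet_linear (L ^^ n)"
  by (induction n) (simp_all add: jet_linear_def)

lemma jet_linear_jetE: "jet_linear (jetE1 a p)" "jet_linear (jetE2 a p)" "jet_linear (jetE3 a p)"
  unfolding jet_linear_def jetE1_def jetE2_def jetE3_def fun_eq_iff
  by (intro conjI allI; algebra)+

lemma jet_linear_cmult: "jet_linear L \<Longrightarrow> L (\<lambda>i j k. c * G i j k) = (\<lambda>i j k. c * L G i j k)"
  by (simp add: jet_linear_def)

lemma jet_linear_zero: "jet_linear L \<Longrightarrow> L (\<lambda>i j k. 0) = (\<lambda>i j k. 0)"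
  using jet_linear_cmult[of L 0 "\<lambda>i j k. 0"] by simp

lemma jet_linear_diff: "jet_linear L \<Longrightarrow> L (\<lambda>i j k. G i j k - H i j k) = (\<lambda>i j k. L G i j k - L H i j k)"
proof -
  assume L: "jet_linear L"
  have "L (\<lambda>i j k. G i j k + (-1) * H i j k) = (\<lambda>i j k. L G i j k + (-1) * L H i j k)"
    using L unfolding jet_linear_def by presburger
  then show ?thesis by simp
qed

lemma jet_linear_sum:
  assumes "jet_linear L" "finite S"
  shows "L (\<lambda>i j k. \<Sum>s\<in>S. c s * H s i j k) = (\<lambda>i j k. \<Sum>s\<in>S. c s * L (H s) i j k)"
  using assms(2) by (induction S rule: finite_induct)
    (use assms(1) in \<open>simp_all add: jet_linear_zero, simp add: jet_linear_def\<close>)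

lemma jet_vanish_jetE:
  assumes "jet_vanish (Suc (Suc n)) G"
  shows "jet_vanish n (jetE1 a p G)" "jet_vanish n (jetE2 a p G)" "jet_vanish n (jetE3 a p G)"
  using assms by (auto simp: jet_vanish_def jetE1_def jetE2_def jetE3_def)

lemma jet_vanish_funpow:
  assumes "\<And>n G. jet_vanish (Suc (Suc n)) G \<Longrightarrow> jet_vanish n (L G)"
  shows "jet_vanish (2 * m + n) G \<Longrightarrow> jet_vanish n ((L ^^ m) G)"
  by (induction m arbitrary: n) (auto intro: assms simp flip: add_Suc_right)

text \<open>Every other term, also the one with a truncated index, either has coefficient
  \<open>0\<close> or involves an entry of order below \<open>n\<close>.\<close>

lemma jetE_eq_symb:
  assumes "jet_vanish n G" "i + j + k + 2 = n"
  shows "jetE1 a p G i j k = symb2 p G i j k + symb3 p G i j k"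
    "jetE2 a p G i j k = symb1 p G i j k + symb3 p G i j k"
    "jetE3 a p G i j k = symb1 p G i j k + symb2 p G i j k"
  using assms by (cases i; cases j; cases k;
      force simp: jetE1_def jetE2_def jetE3_def symb_defs jet_vanish_def algebra_simps)+

lemma symb_uniform_bound:
  assumes "generic p"
  shows "\<exists>C\<ge>0. \<forall>G e i j k. symb_le p G e \<longrightarrow> i + j + k = 4 \<longrightarrow> norm (G i j k) \<le> C * e"
proof -
  have "\<forall>i j k. \<exists>C. i + j + k = 4 \<longrightarrow> C \<ge> 0 \<and> (\<forall>G e. symb_le p G e \<longrightarrow> norm (G i j k) \<le> C * e)"
    using symb_bounded_degree4[OF assms] unfolding symb_bounded_def by blast
  then obtain C where C: "\<And>i j k. i + j + k = 4 \<Longrightarrow> C i j k \<ge> 0"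
    "\<And>i j k G e. i + j + k = 4 \<Longrightarrow> symb_le p G e \<Longrightarrow> norm (G i j k) \<le> C i j k * e"
    by metis
  define S where "S = {(i, j, k). i + j + k = (4::nat)}"
  have fin: "finite S"
    by (rule finite_subset[of _ "{..4} \<times> {..4} \<times> {..4}"]) (auto simp: S_def)
  define K where "K = (\<Sum>(i, j, k)\<in>S. C i j k)"
  have "K \<ge> 0"
    unfolding K_def by (rule sum_nonneg) (auto simp: S_def C)
  moreover have "norm (G i j k) \<le> K * e" if "symb_le p G e" "i + j + k = 4" for G e i j k
  proof -
    have "C i j k \<le> K"
      unfolding K_def using member_le_sum[OF _ _ fin, of "(i, j, k)" "\<lambda>(i, j, k). C i j k"] that C
      by (force simp: S_def)
    then show ?thesis
      using C(2)[OF that(2,1)] mult_right_mono[of "C i j k" K e] symb_le_nonneg[OF that(1)] by linarith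
  qed
  ultimately show ?thesis by blast
qed

section \<open>Uniqueness of jet solutions\<close>

text \<open>Reduces all orders from four on to the degree-four estimate, applied to a shifted
  jet.\<close>

lemma degree4_split:
  assumes "i + j + k \<ge> (4::nat)"
  obtains i' j' k' u v w where "i = u + i'" "j = v + j'" "k = w + k'" "u + v + w = 4"
proof -
  define u v w where "u = min i 4" "v = min j (4 - min i 4)" "w = 4 - min i 4 - min j (4 - min i 4)"
  have "u \<le> i" "v \<le> j" "w \<le> k" "u + v + w = 4"
    using assms by (auto simp: u_v_w_def)
  then show ?thesis
    using that[of u "i - u" v "j - v" w "k - w"] by auto
qed

lemma symb_shift:
  "symb1 p (\<lambda>x y z. G (x + i) (y + j) (z + k)) x y z = symb1 p G (x + i) (y + j) (z + k)"
  "symb2 p (\<lambda>x y z. G (x + i) (y + j) (z + k)) x y z = symb2 p G (x + i) (y + j) (z + k)"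
  "symb3 p (\<lambda>x y z. G (x + i) (y + j) (z + k)) x y z = symb3 p G (x + i) (y + j) (z + k)"
  by (simp_all add: symb_defs)

text \<open>The nine symbol equations of order three on ten unknowns are independent at a generic
  point, and \<open>G 1 1 1\<close> is the free parameter.\<close>

lemma degree3_vanish:
  assumes "generic p" and s: "\<And>i j k. i + j + k = 1 \<Longrightarrow>
      symb1 p G i j k = 0 \<and> symb2 p G i j k = 0 \<and> symb3 p G i j k = 0"
    and "G 1 1 1 = 0" "i + j + k = 3"
  shows "G i j k = 0"
proof -
  define q1 q2 q3 k1 k2 k3 d where g: "q1 = gq1 p" "q2 = gq2 p" "q3 = gq3 p"
    "k1 = gk1 p" "k2 = gk2 p" "k3 = gk3 p" "d = gdelta p"
  have nz: "q1 \<noteq> 0" "q2 \<noteq> 0" "q3 \<noteq> 0" "d \<noteq> 0"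
    using assms(1) by (auto simp: generic_def g)
  have d: "d = q1 * q2 * q3 - q1 * k1\<^sup>2 - q2 * k2\<^sup>2 - q3 * k3\<^sup>2 - 2 * k1 * k2 * k3"
    by (simp add: g gdelta_def)
  have x: "G (Suc 0) (Suc 0) (Suc 0) = 0" using assms(3) by simp
  note ev = symb_defs g[symmetric] x eval_nat_numeral
  note s1 = s[of 1 0 0, simplified ev, simplified] and s2 = s[of 0 1 0, simplified ev, simplified]
    and s3 = s[of 0 0 1, simplified ev, simplified]
  define A12 A13 A21 A23 A31 A32 where A: "A12 = G 2 1 0" "A13 = G 2 0 1" "A21 = G 1 2 0"
    "A23 = G 0 2 1" "A31 = G 1 0 2" "A32 = G 0 1 2"
  note A' = A[simplified eval_nat_numeral One_nat_def, simplified, symmetric]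
  have e: "q1 * A12 + k3 * A21 - k1 * A23 = 0" "q1 * A13 + k2 * A31 - k1 * A32 = 0"
    "q2 * A21 + k3 * A12 - k2 * A13 = 0" "q2 * A23 + k1 * A32 - k2 * A31 = 0"
    "q3 * A31 + k2 * A13 - k3 * A12 = 0" "q3 * A32 + k1 * A23 - k3 * A21 = 0"
    using s1 s2 s3 by (simp_all add: A' x algebra_simps)
  \<comment> \<open>Adding two of the equations pairs the unknowns. The three left over,
    \<open>q1 * A12\<close>, \<open>q2 * A21\<close> and \<open>q1 * A13\<close>, satisfy a
    symmetric system with determinant \<open>d\<close>.\<close>
  have f: "q3 * A32 = - (q1 * A12)" "q3 * A31 = - (q2 * A21)" "q2 * A23 = - (q1 * A13)"
    using e by algebra+
  have "q2 * (q1 * A12) + k3 * (q2 * A21) + k1 * (q1 * A13) = 0"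
    "q1 * (q2 * A21) + k3 * (q1 * A12) - k2 * (q1 * A13) = 0"
    "q3 * (q1 * A13) - k2 * (q2 * A21) + k1 * (q1 * A12) = 0"
    using e f by algebra+
  then have "d * (q1 * A12) = 0" "d * (q2 * A21) = 0" "d * (q1 * A13) = 0"
    unfolding d by algebra+
  then have z: "A12 = 0" "A21 = 0" "A13 = 0" using nz by auto
  with f nz have z': "A32 = 0" "A31 = 0" "A23 = 0" by auto
  have "q1 * G 3 0 0 = 0" "q2 * G 0 3 0 = 0" "q3 * G 0 0 3 = 0"
    using s1 s2 s3 by (simp_all add: A' x z z' eval_nat_numeral)
  then have c: "G 3 0 0 = 0" "G 0 3 0 = 0" "G 0 0 3 = 0" using nz by auto
  have "i \<le> 3" "j \<le> 3" using assms(4) by auto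
  then have "i = 0 \<or> i = 1 \<or> i = 2 \<or> i = 3" "j = 0 \<or> j = 1 \<or> j = 2 \<or> j = 3" by linarith+
  moreover have "k = 3 - i - j" "i + j \<le> 3" using assms(4) by auto
  ultimately show ?thesis
    using z z' c assms(3) unfolding A by (elim disjE) simp_all
qed

text \<open>Vanishing of \<open>jetE1\<close>, \<open>jetE2\<close>, \<open>jetE3\<close> in order
  \<open>n - 2\<close> kills the symbols on the order \<open>n\<close> part. Order two is then
  solved by the \<open>gq\<close>, order three by \<open>degree3_vanish\<close>, and higher orders
  by the estimate with \<open>e = 0\<close>.\<close>

lemma jet_vanish_step:
  assumes "generic p" and van: "jet_vanish n G"
    and E: "jet_vanish (n - 1) (jetE1 a p G)" "jet_vanish (n - 1) (jetE2 a p G)" "jet_vanish (n - 1) (jetE3 a p G)"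
    and b: "\<And>i j k. i \<le> 1 \<Longrightarrow> j \<le> 1 \<Longrightarrow> k \<le> 1 \<Longrightarrow> i + j + k = n \<Longrightarrow> G i j k = 0"
  shows "jet_vanish (Suc n) G"
proof -
  have s: "symb1 p G i j k = 0 \<and> symb2 p G i j k = 0 \<and> symb3 p G i j k = 0" if "i + j + k + 2 = n" for i j k
  proof -
    have "i + j + k < n - 1" using that by auto
    then have "symb2 p G i j k + symb3 p G i j k = 0" "symb1 p G i j k + symb3 p G i j k = 0"
      "symb1 p G i j k + symb2 p G i j k = 0"
      using E jetE_eq_symb[OF van that, where a = a and p = p] by (simp_all add: jet_vanish_def)
    then show ?thesis by algebra
  qed
  have "G i j k = 0" if ijk: "i + j + k = n" for i j k
  proof -
    consider "n \<le> 1" | "n = 2" | "n = 3" | "n \<ge> 4" by linarith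
    then show ?thesis
    proof cases
      case 1
      then show ?thesis using b ijk by auto
    next
      case 2
      have nz: "gq1 p \<noteq> 0" "gq2 p \<noteq> 0" "gq3 p \<noteq> 0" using assms(1) by (auto simp: generic_def)
      have m: "G 1 1 0 = 0" "G 1 0 1 = 0" "G 0 1 1 = 0" using b 2 by auto
      then have "G 2 0 0 = 0" "G 0 2 0 = 0" "G 0 0 2 = 0"
        using s[of 0 0 0] 2 nz by (auto simp: symb_defs eval_nat_numeral)
      moreover have "i = 0 \<or> i = 1 \<or> i = 2" "j = 0 \<or> j = 1 \<or> j = 2" "k = 2 - i - j" "i + j \<le> 2"
        using ijk 2 by auto
      ultimately show ?thesis using m by (elim disjE) simp_all
    next
      case 3
      then show ?thesis
        using degree3_vanish[OF assms(1), of G] s b ijk by auto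
    next
      case 4
      then obtain i' j' k' u v w where w: "i = u + i'" "j = v + j'" "k = w + k'" "u + v + w = 4"
        using degree4_split[of i j k] ijk by metis
      obtain C where C: "\<And>G e i j k. symb_le p G e \<Longrightarrow> i + j + k = 4 \<Longrightarrow> norm (G i j k) \<le> C * e"
        using symb_uniform_bound[OF assms(1)] by blast
      have "symb_le p (\<lambda>x y z. G (x + i') (y + j') (z + k')) 0"
        unfolding symb_le_def symb_shift using s w ijk by auto
      from C[OF this w(4)] show ?thesis using w by simp
    qed
  qed
  with van show ?thesis
    by (auto simp: jet_vanish_def less_Suc_eq)
qed

text \<open>Gives the upper bound eight, for arbitrary constants \<open>a\<close>.\<close>

lemma jet_solution_unique:
  assumes "generic p" "jetE1 a p G = (\<lambda>i j k. 0)" "jetE2 a p G = (\<lambda>i j k. 0)" "jetE3 a p G = (\<lambda>i j k. 0)"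
    and "\<And>i j k. i \<le> 1 \<Longrightarrow> j \<le> 1 \<Longrightarrow> k \<le> 1 \<Longrightarrow> G i j k = 0"
  shows "G i j k = 0"
proof -
  have "jet_vanish n G" for n
  proof (induction n)
    case 0
    show ?case by (simp add: jet_vanish_def)
  next
    case (Suc n)
    show ?case
      by (rule jet_vanish_step[OF assms(1) Suc, of a]) (use assms in \<open>auto simp: jet_vanish_def\<close>)
  qed
  then show ?thesis by (auto simp: jet_vanish_def)
qed

section \<open>Formal solutions from commuting operators\<close>

locale commuting_jets =
  fixes a :: "nat \<Rightarrow> nat \<Rightarrow> complex" and p :: "complex ^ 3"
  assumes generic: "generic p"
    and comm12: "\<And>G. jetE1 a p (jetE2 a p G) = jetE2 a p (jetE1 a p G)"
    and comm13: "\<And>G. jetE1 a p (jetE3 a p G) = jetE3 a p (jetE1 a p G)"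
    and comm23: "\<And>G. jetE2 a p (jetE3 a p G) = jetE3 a p (jetE2 a p G)"
begin

text \<open>The exponent \<open>\<alpha>\<close> encodes the functional \<open>\<partial>\<^sup>\<epsilon> E\<^sup>\<gamma>\<close> at \<open>p\<close> with \<open>\<epsilon> = \<alpha> mod 2\<close> and \<open>\<gamma> = \<alpha> div 2\<close>. Its order
  is \<open>|\<alpha>|\<close>, which makes the linear system for the jets of bounded order square.\<close>

definition data :: "jet \<Rightarrow> jet" where
  "data G i j k = (jetE1 a p ^^ (i div 2)) ((jetE2 a p ^^ (j div 2)) ((jetE3 a p ^^ (k div 2)) G))
     (i mod 2) (j mod 2) (k mod 2)"

lemma funpow_commute: "(\<And>x. f (g x) = g (f x)) \<Longrightarrow> (f ^^ n) (g x) = g ((f ^^ n) x)"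
  by (induction n) simp_all

text \<open>Commutation moves the extra operator past the others to its own power; two more in the
  index leave the remainder modulo two and raise the quotient by one.\<close>

lemma data_jetE1: "data (jetE1 a p G) i j k = data G (Suc (Suc i)) j k"
  by (simp add: data_def funpow_commute[of _ "jetE1 a p"] comm12 comm13)

lemma data_jetE2: "data (jetE2 a p G) i j k = data G i (Suc (Suc j)) k"
  by (simp add: data_def funpow_commute[of _ "jetE2 a p"] comm12 comm23)

lemma data_jetE3: "data (jetE3 a p G) i j k = data G i j (Suc (Suc k))"
  by (simp add: data_def funpow_commute[of _ "jetE3 a p"] comm13 comm23)

lemma data_small: "i \<le> 1 \<Longrightarrow> j \<le> 1 \<Longrightarrow> k \<le> 1 \<Longrightarrow> data G i j k = G i j k"
  by (simp add: data_def)

lemma data_linear: "jet_linear data"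
proof -
  have "jet_linear (\<lambda>G. (jetE1 a p ^^ i) ((jetE2 a p ^^ j) ((jetE3 a p ^^ k) G)))" for i j k
    using jet_linear_funpow[OF jet_linear_jetE(1), of i a p] jet_linear_funpow[OF jet_linear_jetE(2), of j a p]
      jet_linear_funpow[OF jet_linear_jetE(3), of k a p]
    unfolding jet_linear_def by simp
  then show ?thesis
    unfolding jet_linear_def data_def by simp
qed

text \<open>Each operator uses up two orders of vanishing, so \<open>data\<close> at an index
  depends only on derivatives up to the order of that index.\<close>

lemma data_vanish:
  assumes "jet_vanish (Suc (i + j + k)) G"
  shows "data G i j k = 0"
proof -
  define n where "n = Suc (i mod 2 + j mod 2 + k mod 2)"
  have "Suc (i + j + k) = 2 * (k div 2) + (2 * (j div 2) + (2 * (i div 2) + n))"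
    unfolding n_def by presburger
  then have "jet_vanish (2 * (k div 2) + (2 * (j div 2) + (2 * (i div 2) + n))) G"
    using assms by simp
  then have "jet_vanish (2 * (j div 2) + (2 * (i div 2) + n)) ((jetE3 a p ^^ (k div 2)) G)"
    by (rule jet_vanish_funpow[rotated]) (rule jet_vanish_jetE(3))
  then have "jet_vanish (2 * (i div 2) + n) ((jetE2 a p ^^ (j div 2)) ((jetE3 a p ^^ (k div 2)) G))"
    by (rule jet_vanish_funpow[rotated]) (rule jet_vanish_jetE(2))
  then have "jet_vanish n ((jetE1 a p ^^ (i div 2)) ((jetE2 a p ^^ (j div 2)) ((jetE3 a p ^^ (k div 2)) G)))"
    by (rule jet_vanish_funpow[rotated]) (rule jet_vanish_jetE(1))
  then show ?thesis
    by (simp add: jet_vanish_def data_def n_def)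
qed

lemma data_inj:
  "(\<And>i j k. i + j + k < n \<Longrightarrow> data G i j k = 0) \<Longrightarrow> jet_vanish n G"
proof (induction n arbitrary: G rule: less_induct)
  case (less n)
  show ?case
  proof (cases n)
    case 0
    then show ?thesis by (simp add: jet_vanish_def)
  next
    case (Suc m)
    \<comment> \<open>The data of \<open>jetE1 a p G\<close> are those of \<open>G\<close> two
      orders higher, so they vanish below order \<open>m - 1\<close>.\<close>
    have "jet_vanish (m - 1) (jetE1 a p G)" "jet_vanish (m - 1) (jetE2 a p G)" "jet_vanish (m - 1) (jetE3 a p G)"
      by (rule less.IH; use Suc less.prems in \<open>simp add: data_jetE1 data_jetE2 data_jetE3\<close>)+
    moreover have "jet_vanish m G"
      by (rule less.IH) (use Suc less.prems in auto)
    moreover have "G i j k = 0" if "i \<le> 1" "j \<le> 1" "k \<le> 1" "i + j + k = m" for i j k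
      using less.prems[of i j k] data_small[of i j k G] that Suc by simp
    ultimately show ?thesis
      using jet_vanish_step[OF generic] Suc by blast
  qed
qed

text \<open>The entries of a jet and its data below order \<open>n\<close> share the index set
  \<open>S\<close>, so \<open>data_inj\<close> makes a square system solvable. \<open>J x\<close>
  extends \<open>x\<close> by zero.\<close>

lemma data_surj_finite: "\<exists>G. \<forall>i j k. i + j + k < n \<longrightarrow> data G i j k = y i j k"
proof -
  define S where "S = {(i, j, k). i + j + k < (n::nat)}"
  have fin: "finite S"
    by (rule finite_subset[of _ "{..n} \<times> {..n} \<times> {..n}"]) (auto simp: S_def)
  define E :: "nat \<times> nat \<times> nat \<Rightarrow> jet" where "E = (\<lambda>s i j k. if s = (i, j, k) then 1 else 0)"
  define J where "J = (\<lambda>x i j k. \<Sum>s\<in>S. x s * E s i j k)"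
  have J: "data (J x) i j k = (\<Sum>s\<in>S. data (E s) i j k * x s)" for x i j k
    unfolding J_def jet_linear_sum[OF data_linear fin] by (simp add: mult.commute)
  have J_val: "J x i j k = x (i, j, k)" if "(i, j, k) \<in> S" for x i j k
    using that fin unfolding J_def E_def by (simp add: if_distrib[of "(*) _"] sum.delta cong: if_cong)
  define A where "A = (\<lambda>(i, j, k) s. data (E s) i j k)"
  have inj: "x s = 0" if x: "\<And>i. i \<in> S \<Longrightarrow> (\<Sum>s\<in>S. A i s * x s) = 0" and s: "s \<in> S" for x s
  proof -
    have "jet_vanish n (J x)"
      by (rule data_inj) (use x in \<open>auto simp: J A_def S_def\<close>)
    then show ?thesis
      using s J_val[of _ _ _ x] by (force simp: jet_vanish_def S_def)
  qed
  obtain x where "\<forall>i\<in>S. (\<Sum>s\<in>S. A i s * x s) = (case i of (i, j, k) \<Rightarrow> y i j k)"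
    using square_system_solvable[of S A "\<lambda>(i, j, k). y i j k"] fin inj by blast
  then show ?thesis
    by (intro exI[of _ "J x"]) (force simp: J A_def S_def)
qed

text \<open>By \<open>data_inj\<close> the solutions for different \<open>n\<close> agree where both
  are determined, so their diagonal \<open>G\<close> is coherent; \<open>data_vanish\<close>
  transfers the data to it.\<close>

lemma data_surj: "\<exists>G. \<forall>i j k. data G i j k = y i j k"
proof -
  obtain H where H: "\<And>n i j k. i + j + k < n \<Longrightarrow> data (H n) i j k = y i j k"
    using data_surj_finite[of _ y] by metis
  have agree: "H m i j k = H n i j k" if "i + j + k < m" "m \<le> n" for i j k m n
  proof -
    have "jet_vanish m (\<lambda>i j k. H m i j k - H n i j k)"
      by (rule data_inj) (use that in \<open>auto simp: jet_linear_diff[OF data_linear] H\<close>)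
    with that show ?thesis by (auto simp: jet_vanish_def)
  qed
  define G where "G = (\<lambda>i j k. H (Suc (i + j + k)) i j k)"
  have "data G i j k = y i j k" for i j k
  proof -
    have "jet_vanish (Suc (i + j + k)) (\<lambda>x y z. G x y z - H (Suc (i + j + k)) x y z)"
      using agree by (auto simp: jet_vanish_def G_def)
    from data_vanish[OF this] show ?thesis
      by (simp add: jet_linear_diff[OF data_linear] H)
  qed
  then show ?thesis by blast
qed

text \<open>The data of \<open>jetE1 a p G\<close> are values of \<open>z\<close> at indices with an
  entry at least two, hence zero, and zero data force a zero jet.\<close>

lemma formal_solution_exists:
  obtains G where "jetE1 a p G = (\<lambda>i j k. 0)" "jetE2 a p G = (\<lambda>i j k. 0)" "jetE3 a p G = (\<lambda>i j k. 0)"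
    "\<And>i j k. i \<le> 1 \<Longrightarrow> j \<le> 1 \<Longrightarrow> k \<le> 1 \<Longrightarrow> G i j k = y i j k"
proof -
  define z where "z = (\<lambda>i j k. if i \<le> 1 \<and> j \<le> 1 \<and> k \<le> 1 then y i j k else 0)"
  obtain G where G: "\<And>i j k. data G i j k = z i j k"
    using data_surj[of z] by blast
  have zero: "H = (\<lambda>i j k. 0)" if "\<And>i j k. data H i j k = 0" for H
  proof (intro ext)
    fix i j k
    show "H i j k = 0"
      using data_inj[of "Suc (i + j + k)" H] that by (auto simp: jet_vanish_def)
  qed
  show ?thesis
  proof (rule that[of G])
    show "jetE1 a p G = (\<lambda>i j k. 0)" "jetE2 a p G = (\<lambda>i j k. 0)" "jetE3 a p G = (\<lambda>i j k. 0)"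
      by (rule zero; simp add: data_jetE1 data_jetE2 data_jetE3 G z_def)+
    show "G i j k = y i j k" if "i \<le> 1" "j \<le> 1" "k \<le> 1" for i j k
      using G[of i j k] data_small[OF that, of G] that by (simp add: z_def)
  qed
qed

end

section \<open>Growth of formal solutions\<close>

text \<open>The common shape of what the three operators add to their principal symbols: entries of
  order \<open>n - 1\<close> carry factors linear in \<open>n\<close>, those of order
  \<open>n - 2\<close> quadratic ones.\<close>

lemma norm_lower_terms:
  fixes b0 b1 b2 b3 v x :: complex
  assumes "norm (x * g) \<le> real n * g1" "norm h1 \<le> g1" "norm h2 \<le> g1" "norm h3 \<le> g1" "norm h0 \<le> g2"
    and "norm u1 \<le> norm b1 + 2 * real n" "norm u2 \<le> norm b2 + 2 * real n" "norm u3 \<le> norm b3 + 2 * real n"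
    and "norm v \<le> real n * real n" "i \<le> n" "j \<le> n" "k \<le> n" "1 \<le> n" "0 \<le> g1" "0 \<le> g2"
  shows "norm (2 * x * g + u1 * p1 * h1 + u2 * p2 * h2 + u3 * p3 * h3
      + (b0 + b1 * of_nat i + b2 * of_nat j + b3 * of_nat k - v) * h0)
    \<le> (3 + (norm b1 + 2) * norm p1 + (norm b2 + 2) * norm p2 + (norm b3 + 2) * norm p3
       + norm b0 + norm b1 + norm b2 + norm b3) * (real n * g1 + real n * real n * g2)"
proof -
  let ?n = "real n"
  let ?X = "?n * g1" and ?Y = "?n * ?n * g2"
  have n: "1 \<le> ?n" using assms by simp
  have nn: "?n \<le> ?n * ?n" using n by simp
  have XY: "0 \<le> ?X" "0 \<le> ?Y" using assms by auto
  have u: "norm (u * q * h) \<le> (norm b + 2) * norm q * ?X"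
    if "norm u \<le> norm b + 2 * ?n" "norm h \<le> g1" for u q h b :: complex
  proof -
    have "norm b * 1 \<le> norm b * ?n" using n by (intro mult_left_mono) auto
    then have "norm u \<le> (norm b + 2) * ?n" using that(1) by (simp add: algebra_simps)
    then have "norm u * (norm q * norm h) \<le> ((norm b + 2) * ?n) * (norm q * g1)"
      using that(2) by (intro mult_mono) auto
    then show ?thesis by (simp add: norm_mult algebra_simps)
  qed
  have c: "norm (b * of_nat m) \<le> norm b * (?n * ?n)" if "m \<le> n" for b :: complex and m
    using that nn by (simp add: norm_mult mult_left_mono)
  have b0: "norm b0 \<le> norm b0 * (?n * ?n)" using n nn
    by (metis dual_order.trans mult.right_neutral mult_left_mono norm_ge_zero)
  have "norm (b0 + b1 * of_nat i + b2 * of_nat j + b3 * of_nat k - v)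
      \<le> norm b0 + norm (b1 * of_nat i) + norm (b2 * of_nat j) + norm (b3 * of_nat k) + norm v"
    by (intro norm_triangle_le norm_triangle_le_diff add_mono order_refl)
  also have "\<dots> \<le> (norm b0 + norm b1 + norm b2 + norm b3 + 1) * (?n * ?n)"
    using b0 c[of i b1] c[of j b2] c[of k b3] assms(9-12) by (simp add: algebra_simps)
  finally have "norm (b0 + b1 * of_nat i + b2 * of_nat j + b3 * of_nat k - v) * norm h0
      \<le> (norm b0 + norm b1 + norm b2 + norm b3 + 1) * (?n * ?n) * g2"
    using assms(5) by (intro mult_mono) auto
  then have w: "norm ((b0 + b1 * of_nat i + b2 * of_nat j + b3 * of_nat k - v) * h0)
      \<le> (norm b0 + norm b1 + norm b2 + norm b3 + 1) * ?Y"
    by (simp only: norm_mult mult.assoc)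
  have x: "norm (2 * x * g) \<le> 2 * ?X" using assms(1) by (simp add: norm_mult mult.assoc)
  have "norm (2 * x * g + u1 * p1 * h1 + u2 * p2 * h2 + u3 * p3 * h3
      + (b0 + b1 * of_nat i + b2 * of_nat j + b3 * of_nat k - v) * h0)
    \<le> 2 * ?X + (norm b1 + 2) * norm p1 * ?X + (norm b2 + 2) * norm p2 * ?X + (norm b3 + 2) * norm p3 * ?X
      + (norm b0 + norm b1 + norm b2 + norm b3 + 1) * ?Y"
    by (intro norm_triangle_le add_mono x u w assms)
  also have "\<dots> \<le> (3 + (norm b1 + 2) * norm p1 + (norm b2 + 2) * norm p2 + (norm b3 + 2) * norm p3
       + norm b0 + norm b1 + norm b2 + norm b3) * (?X + ?Y)"
  proof -
    have "2 * ?X + ((norm b1 + 2) * norm p1 + (norm b2 + 2) * norm p2 + (norm b3 + 2) * norm p3) * ?X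
        + (norm b0 + norm b1 + norm b2 + norm b3 + 1) * ?Y
      \<le> (2 + ((norm b1 + 2) * norm p1 + (norm b2 + 2) * norm p2 + (norm b3 + 2) * norm p3)) * (?X + ?Y)
        + (norm b0 + norm b1 + norm b2 + norm b3 + 1) * (?X + ?Y)"
    proof (intro add_mono)
      show "2 * ?X + ((norm b1 + 2) * norm p1 + (norm b2 + 2) * norm p2 + (norm b3 + 2) * norm p3) * ?X
        \<le> (2 + ((norm b1 + 2) * norm p1 + (norm b2 + 2) * norm p2 + (norm b3 + 2) * norm p3)) * (?X + ?Y)"
        unfolding distrib_right[symmetric] using XY by (intro mult_left_mono add_nonneg_nonneg) auto
      show "(norm b0 + norm b1 + norm b2 + norm b3 + 1) * ?Y
        \<le> (norm b0 + norm b1 + norm b2 + norm b3 + 1) * (?X + ?Y)"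
        using XY by (intro mult_left_mono add_nonneg_nonneg) auto
    qed
    then show ?thesis by (simp only: distrib_right)
  qed
  finally show ?thesis .
qed

definition lower_const :: "(nat \<Rightarrow> complex) \<Rightarrow> complex ^ 3 \<Rightarrow> real" where
  "lower_const b p = 3 + (norm (b 1) + 2) * norm (p $ 1) + (norm (b 2) + 2) * norm (p $ 2)
     + (norm (b 3) + 2) * norm (p $ 3) + norm (b 0) + norm (b 1) + norm (b 2) + norm (b 3)"

lemma lower_const_nonneg: "0 \<le> lower_const b p"
  by (simp add: lower_const_def)

lemma jetE_near_symb:
  assumes n: "i + j + k + 2 = n" and g: "0 \<le> g1" "0 \<le> g2"
    and G1: "\<And>i j k. i + j + k + 1 = n \<Longrightarrow> norm (G i j k) \<le> g1"
    and G2: "\<And>i j k. i + j + k + 2 = n \<Longrightarrow> norm (G i j k) \<le> g2"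
  shows "norm (jetE1 a p G i j k - (symb2 p G i j k + symb3 p G i j k))
      \<le> lower_const (a 1) p * (real n * g1 + real n * real n * g2)" (is ?A)
    and "norm (jetE2 a p G i j k - (symb1 p G i j k + symb3 p G i j k))
      \<le> lower_const (a 2) p * (real n * g1 + real n * real n * g2)" (is ?B)
    and "norm (jetE3 a p G i j k - (symb1 p G i j k + symb2 p G i j k))
      \<le> lower_const (a 3) p * (real n * g1 + real n * real n * g2)" (is ?C)
proof -
  have le: "norm (of_nat m * z) \<le> real n * g1" if "m = 0 \<or> norm z \<le> g1" "m \<le> n" for m and z :: complex
    using that g by (cases "m = 0") (auto simp: norm_mult intro!: mult_mono)
  have u: "norm (b - 2 * of_nat x - 2 * of_nat y) \<le> norm b + 2 * real n" if "x + y \<le> n" for b :: complex and x y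
  proof -
    have "b - 2 * of_nat x - 2 * of_nat y = b - of_nat (2 * (x + y))" by simp
    also have "norm \<dots> \<le> norm b + norm (of_nat (2 * (x + y)) :: complex)"
      by (rule norm_triangle_ineq4)
    also have "norm (of_nat (2 * (x + y)) :: complex) \<le> 2 * real n"
      using that unfolding norm_of_nat by simp
    finally show ?thesis by simp
  qed
  have u': "norm b \<le> norm b + 2 * real n" for b :: complex by simp
  have v: "norm ((of_nat x + of_nat y) * (of_nat x + of_nat y - 1) :: complex) \<le> real n * real n"
    if "x + y \<le> n" for x y
  proof (cases "x + y")
    case (Suc m)
    have "(of_nat x + of_nat y) * (of_nat x + of_nat y - 1) = (of_nat (x + y) * (of_nat (x + y) - 1) :: complex)"
      by simp
    also have "\<dots> = of_nat ((x + y) * m)"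
      unfolding Suc by (simp add: algebra_simps)
    also have "norm \<dots> \<le> real n * real n"
    proof -
      have "(x + y) * m \<le> n * n" using that Suc by (intro mult_le_mono) auto
      then show ?thesis unfolding norm_of_nat of_nat_mult[symmetric] by (simp only: of_nat_le_iff)
    qed
    finally show ?thesis .
  qed (use that in simp)
  have h: "norm (G (Suc i) j k) \<le> g1" "norm (G i (Suc j) k) \<le> g1" "norm (G i j (Suc k)) \<le> g1"
    by (rule G1, use n in simp)+
  have h0: "norm (G i j k) \<le> g2"
    by (rule G2) (use n in simp)
  have x: "norm (of_nat i * G (i - 1) (Suc j) (Suc k)) \<le> real n * g1"
    "norm (of_nat j * G (Suc i) (j - 1) (Suc k)) \<le> real n * g1"
    "norm (of_nat k * G (Suc i) (Suc j) (k - 1)) \<le> real n * g1"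
    by (rule le; use n G1[of "i - 1" "Suc j" "Suc k"] G1[of "Suc i" "j - 1" "Suc k"] G1[of "Suc i" "Suc j" "k - 1"]
        in force)+
  have m: "j + k \<le> n" "i + k \<le> n" "i + j \<le> n" "i \<le> n" "j \<le> n" "k \<le> n" "1 \<le> n"
    using n by auto
  have "jetE1 a p G i j k - (symb2 p G i j k + symb3 p G i j k)
    = 2 * of_nat i * G (i - 1) (Suc j) (Suc k) + a 1 1 * p $ 1 * G (Suc i) j k
      + (a 1 2 - 2 * of_nat j - 2 * of_nat k) * p $ 2 * G i (Suc j) k
      + (a 1 3 - 2 * of_nat j - 2 * of_nat k) * p $ 3 * G i j (Suc k)
      + (a 1 0 + a 1 1 * of_nat i + a 1 2 * of_nat j + a 1 3 * of_nat k
         - (of_nat j + of_nat k) * (of_nat j + of_nat k - 1)) * G i j k"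
    unfolding jetE1_def symb_defs by algebra
  then show ?A
    unfolding lower_const_def
    by (simp only:) (rule norm_lower_terms[OF x(1) h h0 u' u[OF m(1)] u[OF m(1)] v[OF m(1)] m(4-7) g])
  have "jetE2 a p G i j k - (symb1 p G i j k + symb3 p G i j k)
    = 2 * of_nat j * G (Suc i) (j - 1) (Suc k)
      + (a 2 1 - 2 * of_nat i - 2 * of_nat k) * p $ 1 * G (Suc i) j k
      + a 2 2 * p $ 2 * G i (Suc j) k
      + (a 2 3 - 2 * of_nat i - 2 * of_nat k) * p $ 3 * G i j (Suc k)
      + (a 2 0 + a 2 1 * of_nat i + a 2 2 * of_nat j + a 2 3 * of_nat k
         - (of_nat i + of_nat k) * (of_nat i + of_nat k - 1)) * G i j k"
    unfolding jetE2_def symb_defs by algebra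
  then show ?B
    unfolding lower_const_def
    by (simp only:) (rule norm_lower_terms[OF x(2) h h0 u[OF m(2)] u' u[OF m(2)] v[OF m(2)] m(4-7) g])
  have "jetE3 a p G i j k - (symb1 p G i j k + symb2 p G i j k)
    = 2 * of_nat k * G (Suc i) (Suc j) (k - 1)
      + (a 3 1 - 2 * of_nat i - 2 * of_nat j) * p $ 1 * G (Suc i) j k
      + (a 3 2 - 2 * of_nat i - 2 * of_nat j) * p $ 2 * G i (Suc j) k
      + a 3 3 * p $ 3 * G i j (Suc k)
      + (a 3 0 + a 3 1 * of_nat i + a 3 2 * of_nat j + a 3 3 * of_nat k
         - (of_nat i + of_nat j) * (of_nat i + of_nat j - 1)) * G i j k"
    unfolding jetE3_def symb_defs by algebra
  then show ?C
    unfolding lower_const_def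
    by (simp only:) (rule norm_lower_terms[OF x(3) h h0 u[OF m(3)] u[OF m(3)] u' v[OF m(3)] m(4-7) g])
qed

text \<open>For a solution the symbols are minus the lower-order terms, so order \<open>n\<close> is
  bounded by \<open>n\<close> times order \<open>n - 1\<close> plus \<open>n\<^sup>2\<close> times
  order \<open>n - 2\<close>. The factorial absorbs exactly these weights.\<close>

lemma jet_solution_growth:
  assumes "generic p" and E: "jetE1 a p G = (\<lambda>i j k. 0)" "jetE2 a p G = (\<lambda>i j k. 0)" "jetE3 a p G = (\<lambda>i j k. 0)"
  shows "\<exists>A\<ge>0. \<exists>M\<ge>0. \<forall>i j k. norm (G i j k) \<le> A * M ^ (i + j + k) * fact (i + j + k)"
proof -
  obtain C where C: "C \<ge> 0"
    "\<And>G e i j k. symb_le p G e \<Longrightarrow> i + j + k = 4 \<Longrightarrow> norm (G i j k) \<le> C * e"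
    using symb_uniform_bound[OF assms(1)] by blast
  define K where "K = lower_const (a 1) p + lower_const (a 2) p + lower_const (a 3) p"
  have K: "0 \<le> K" by (simp add: K_def lower_const_nonneg)
  \<comment> \<open>One additional power of \<open>M\<close> per order has to pay for
    \<open>3 * C * K\<close>.\<close>
  define M where "M = max 1 (3 * C * K)"
  have M: "1 \<le> M" "3 * C * K \<le> M" by (auto simp: M_def)
  define S where "S = {(i, j, k). i + j + k < (4::nat)}"
  have fin: "finite S"
    by (rule finite_subset[of _ "{..4} \<times> {..4} \<times> {..4}"]) (auto simp: S_def)
  define A where "A = (\<Sum>(i, j, k)\<in>S. norm (G i j k))"
  have A: "0 \<le> A" unfolding A_def by (rule sum_nonneg) auto
  have base: "norm (G i j k) \<le> A" if "i + j + k < 4" for i j k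
    unfolding A_def using member_le_sum[OF _ _ fin, of "(i, j, k)" "\<lambda>(i, j, k). norm (G i j k)"] that
    by (force simp: S_def)
  have "norm (G i j k) \<le> A * M ^ n * fact n" if "i + j + k = n" for i j k n
    using that
  proof (induction n arbitrary: i j k rule: less_induct)
    case (less n)
    show ?case
    proof (cases "n < 4")
      case True
      then have "norm (G i j k) \<le> A * 1 * 1" using base less.prems by auto
      also have "\<dots> \<le> A * M ^ n * fact n"
        using A M by (intro mult_mono) auto
      finally show ?thesis .
    next
      case False
      then obtain m where m: "n = Suc (Suc m)" "m \<ge> 2"
        by (intro that[of "n - 2"]) auto
      define g1 g2 where "g1 = A * M ^ Suc m * fact (Suc m)" and "g2 = A * M ^ m * fact m"
      have g: "0 \<le> g1" "0 \<le> g2" using A M by (auto simp: g1_def g2_def)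
      define X where "X = real n * g1 + real n * real n * g2"
      have X0: "0 \<le> X" using g by (simp add: X_def)
      have G1: "norm (G i j k) \<le> g1" if "i + j + k + 1 = n" for i j k
        unfolding g1_def using less.IH[of "Suc m" i j k] that m by simp
      have G2: "norm (G i j k) \<le> g2" if "i + j + k + 2 = n" for i j k
        unfolding g2_def using less.IH[of m i j k] that m by simp
      have sy: "norm (symb1 p G x y z) \<le> K * X \<and> norm (symb2 p G x y z) \<le> K * X \<and> norm (symb3 p G x y z) \<le> K * X"
        if xyz: "x + y + z + 2 = n" for x y z
      proof -
        let ?s1 = "symb1 p G x y z" and ?s2 = "symb2 p G x y z" and ?s3 = "symb3 p G x y z"
        have "norm (jetE1 a p G x y z - (?s2 + ?s3)) \<le> lower_const (a 1) p * X"
          unfolding X_def by (rule jetE_near_symb(1)[OF xyz g]) (fact G1, fact G2)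
        moreover have "norm (jetE2 a p G x y z - (?s1 + ?s3)) \<le> lower_const (a 2) p * X"
          unfolding X_def by (rule jetE_near_symb(2)[OF xyz g]) (fact G1, fact G2)
        moreover have "norm (jetE3 a p G x y z - (?s1 + ?s2)) \<le> lower_const (a 3) p * X"
          unfolding X_def by (rule jetE_near_symb(3)[OF xyz g]) (fact G1, fact G2)
        ultimately have "norm (?s2 + ?s3) \<le> lower_const (a 1) p * X" "norm (?s1 + ?s3) \<le> lower_const (a 2) p * X"
          "norm (?s1 + ?s2) \<le> lower_const (a 3) p * X"
          unfolding E diff_0 norm_minus_cancel by blast+
        moreover have "K * X = lower_const (a 1) p * X + lower_const (a 2) p * X + lower_const (a 3) p * X"
          by (simp add: K_def distrib_right)
        moreover have "2 * norm ?s1 \<le> norm (?s1 + ?s3) + norm (?s1 + ?s2) + norm (?s2 + ?s3)"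
        proof -
          have "2 * ?s1 = ((?s1 + ?s3) + (?s1 + ?s2)) - (?s2 + ?s3)" by simp
          then have "norm (2 * ?s1) \<le> norm (?s1 + ?s3) + norm (?s1 + ?s2) + norm (?s2 + ?s3)"
            by (metis norm_triangle_ineq norm_triangle_le_diff add_right_mono)
          then show ?thesis by (simp add: norm_mult)
        qed
        moreover have "2 * norm ?s2 \<le> norm (?s1 + ?s3) + norm (?s1 + ?s2) + norm (?s2 + ?s3)"
        proof -
          have "2 * ?s2 = ((?s2 + ?s3) + (?s1 + ?s2)) - (?s1 + ?s3)" by simp
          then have "norm (2 * ?s2) \<le> norm (?s2 + ?s3) + norm (?s1 + ?s2) + norm (?s1 + ?s3)"
            by (metis norm_triangle_ineq norm_triangle_le_diff add_right_mono)
          then show ?thesis by (simp add: norm_mult)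
        qed
        moreover have "2 * norm ?s3 \<le> norm (?s1 + ?s3) + norm (?s1 + ?s2) + norm (?s2 + ?s3)"
        proof -
          have "2 * ?s3 = ((?s1 + ?s3) + (?s2 + ?s3)) - (?s1 + ?s2)" by simp
          then have "norm (2 * ?s3) \<le> norm (?s1 + ?s3) + norm (?s2 + ?s3) + norm (?s1 + ?s2)"
            by (metis norm_triangle_ineq norm_triangle_le_diff add_right_mono)
          then show ?thesis by (simp add: norm_mult)
        qed
        ultimately show ?thesis
          using norm_ge_zero[of ?s1] norm_ge_zero[of ?s2] norm_ge_zero[of ?s3] by linarith
      qed
      obtain i' j' k' u v w where w: "i = u + i'" "j = v + j'" "k = w + k'" "u + v + w = 4"
        using degree4_split[of i j k] less.prems False by (metis not_less)
      have "symb_le p (\<lambda>x y z. G (x + i') (y + j') (z + k')) (K * X)"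
        unfolding symb_le_def symb_shift using sy w less.prems by auto
      from C(2)[OF this w(4)] have "norm (G i j k) \<le> C * (K * X)" using w by simp
      \<comment> \<open>The first summand of \<open>X\<close> gives \<open>n!\<close> once. The
        second gives it at most twice, because \<open>n \<le> 2 * (n - 1)\<close>.\<close>
      also have "X \<le> 3 * (A * M ^ Suc m * fact n)"
      proof -
        have "real n * g1 = A * M ^ Suc m * fact n"
          using m by (simp add: g1_def)
        moreover have "real n * real n * g2 \<le> 2 * (A * M ^ Suc m * fact n)"
        proof -
          have f: "real n * real n * fact m \<le> 2 * fact n"
          proof -
            have "real n \<le> 2 * real (Suc m)" using m by simp
            then have "real n * (real n * fact m) \<le> 2 * real (Suc m) * (real n * fact m)"
              by (intro mult_right_mono) auto
            then show ?thesis using m by (simp add: algebra_simps)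
          qed
          have "A * M ^ m \<le> A * M ^ Suc m"
            using A M by (intro mult_left_mono power_increasing) auto
          then have "(A * M ^ m) * (real n * real n * fact m) \<le> (A * M ^ Suc m) * (2 * fact n)"
            using f by (rule mult_mono) (use A M in auto)
          then show ?thesis by (simp add: g2_def mult_ac)
        qed
        ultimately show ?thesis unfolding X_def by linarith
      qed
      then have "C * (K * X) \<le> C * (K * (3 * (A * M ^ Suc m * fact n)))"
        using C(1) K by (intro mult_left_mono) auto
      also have "\<dots> = (3 * C * K) * (A * M ^ Suc m * fact n)" by simp
      also have "\<dots> \<le> M * (A * M ^ Suc m * fact n)"
        using M A by (intro mult_right_mono) auto
      also have "\<dots> = A * M ^ n * fact n" using m by simp
      finally show ?thesis .
    qed
  qed
  then show ?thesis
    using A M by (intro exI[of _ A] conjI exI[of _ M]) auto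
qed

section \<open>Local solutions and the rank\<close>

lemma nat_cases3: obtains "n = 0" | "n = Suc 0" | m where "n = Suc (Suc m)"
  by (metis not0_implies_Suc)

context jet_at
begin

lemma
  assumes "holomorphic3_on u U"
  shows jet_of_E1: "jet_of p (E1 a u) i j k = jetE1 a p (jet_of p u) i j k"
    and holomorphic3_on_E1: "holomorphic3_on (E1 a u) U"
proof -
  have hp: "holomorphic3_on (partial m u) U" "holomorphic3_on (partial m (partial n u)) U" for m n
    by (intro holomorphic3_on_partialI assms open_U)+
  note hol = holomorphic3_on_add holomorphic3_on_mult holomorphic3_on_const holomorphic3_on_coord hp assms
  \<comment> \<open>Expanded into constants and coordinates multiplying partial derivatives, the
    form to which the rules for \<open>jet_of\<close> apply. The later case splits resolve the
    truncated subtractions from applying the Leibniz rule twice.\<close>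
  have eq: "E1 a u = (\<lambda>t. partial 2 (partial 2 u) t + ((- 1) * (t $ 2 * (t $ 2 * partial 2 (partial 2 u) t))
      + (2 * (t $ 1 * partial 2 (partial 3 u) t) + ((- 2) * (t $ 2 * (t $ 3 * partial 2 (partial 3 u) t))
      + (partial 3 (partial 3 u) t + ((- 1) * (t $ 3 * (t $ 3 * partial 3 (partial 3 u) t))
      + (a 1 1 * (t $ 1 * partial 1 u t) + (a 1 2 * (t $ 2 * partial 2 u t)
      + (a 1 3 * (t $ 3 * partial 3 u t) + a 1 0 * u t)))))))))"
    unfolding E1_def partial2_def by (intro ext) algebra
  show "holomorphic3_on (E1 a u) U"
    unfolding eq by (intro hol)
  show "jet_of p (E1 a u) i j k = jetE1 a p (jet_of p u) i j k"
    unfolding eq jetE1_def gdefs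
    by (simp only: jet_of_add jet_of_cmult jet_of_coord_mult hol jet_of_partial)
      (cases i; cases j rule: nat_cases3; cases k rule: nat_cases3; hypsubst_thin; simp; algebra)
qed

lemma
  assumes "holomorphic3_on u U"
  shows jet_of_E2: "jet_of p (E2 a u) i j k = jetE2 a p (jet_of p u) i j k"
    and holomorphic3_on_E2: "holomorphic3_on (E2 a u) U"
proof -
  have hp: "holomorphic3_on (partial m u) U" "holomorphic3_on (partial m (partial n u)) U" for m n
    by (intro holomorphic3_on_partialI assms open_U)+
  note hol = holomorphic3_on_add holomorphic3_on_mult holomorphic3_on_const holomorphic3_on_coord hp assms
  have eq: "E2 a u = (\<lambda>t. partial 3 (partial 3 u) t + ((- 1) * (t $ 3 * (t $ 3 * partial 3 (partial 3 u) t))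
      + (2 * (t $ 2 * partial 3 (partial 1 u) t) + ((- 2) * (t $ 3 * (t $ 1 * partial 3 (partial 1 u) t))
      + (partial 1 (partial 1 u) t + ((- 1) * (t $ 1 * (t $ 1 * partial 1 (partial 1 u) t))
      + (a 2 1 * (t $ 1 * partial 1 u t) + (a 2 2 * (t $ 2 * partial 2 u t)
      + (a 2 3 * (t $ 3 * partial 3 u t) + a 2 0 * u t)))))))))"
    unfolding E2_def partial2_def by (intro ext) algebra
  show "holomorphic3_on (E2 a u) U"
    unfolding eq by (intro hol)
  show "jet_of p (E2 a u) i j k = jetE2 a p (jet_of p u) i j k"
    unfolding eq jetE2_def gdefs
    by (simp only: jet_of_add jet_of_cmult jet_of_coord_mult hol jet_of_partial)
      (cases j; cases i rule: nat_cases3; cases k rule: nat_cases3; hypsubst_thin; simp; algebra)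
qed

lemma
  assumes "holomorphic3_on u U"
  shows jet_of_E3: "jet_of p (E3 a u) i j k = jetE3 a p (jet_of p u) i j k"
    and holomorphic3_on_E3: "holomorphic3_on (E3 a u) U"
proof -
  have hp: "holomorphic3_on (partial m u) U" "holomorphic3_on (partial m (partial n u)) U" for m n
    by (intro holomorphic3_on_partialI assms open_U)+
  note hol = holomorphic3_on_add holomorphic3_on_mult holomorphic3_on_const holomorphic3_on_coord hp assms
  have eq: "E3 a u = (\<lambda>t. partial 1 (partial 1 u) t + ((- 1) * (t $ 1 * (t $ 1 * partial 1 (partial 1 u) t))
      + (2 * (t $ 3 * partial 1 (partial 2 u) t) + ((- 2) * (t $ 1 * (t $ 2 * partial 1 (partial 2 u) t))
      + (partial 2 (partial 2 u) t + ((- 1) * (t $ 2 * (t $ 2 * partial 2 (partial 2 u) t))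
      + (a 3 1 * (t $ 1 * partial 1 u t) + (a 3 2 * (t $ 2 * partial 2 u t)
      + (a 3 3 * (t $ 3 * partial 3 u t) + a 3 0 * u t)))))))))"
    unfolding E3_def partial2_def by (intro ext) algebra
  show "holomorphic3_on (E3 a u) U"
    unfolding eq by (intro hol)
  show "jet_of p (E3 a u) i j k = jetE3 a p (jet_of p u) i j k"
    unfolding eq jetE3_def gdefs
    by (simp only: jet_of_add jet_of_cmult jet_of_coord_mult hol jet_of_partial)
      (cases k; cases i rule: nat_cases3; cases j rule: nat_cases3; hypsubst_thin; simp; algebra)
qed

end

text \<open>A local solution only has to satisfy the generators; on an open set, vanishing passes to
  partial derivatives.\<close>

lemma left_ideal_vanish:
  assumes "P \<in> left_ideal S" "open U" "\<And>Q t. Q \<in> S \<Longrightarrow> t \<in> U \<Longrightarrow> Q u t = 0" "t \<in> U"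
  shows "P u t = 0"
  using assms(1,4)
proof (induction P arbitrary: t rule: left_ideal.induct)
  case (mult_partial P i)
  have "partial i (P u) t = partial i (\<lambda>t. 0) t"
    by (rule partial_cong[OF assms(2) mult_partial.prems]) (rule mult_partial.IH)
  then show ?case by (simp add: partial_const)
qed (auto simp: assms(3))

text \<open>All terms of order other than two cancel, leaving a linear relation between second
  derivatives of a solution.\<close>

lemma jetE_commutator12:
  "jetE1 a p (jetE2 a p G) 0 0 0 - jetE2 a p (jetE1 a p G) 0 0 0
    = - 2 * a 1 1 * G 2 0 0 + 2 * p $ 2 * (a 1 2 - a 1 3 - a 1 1) * G 1 0 1 + 2 * a 2 2 * G 0 2 0
      + 2 * p $ 1 * (a 2 3 + a 2 2 - a 2 1) * G 0 1 1 + 2 * (a 2 3 - a 1 3) * G 0 0 2"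
  by (simp add: jetE1_def jetE2_def gdefs eval_nat_numeral) algebra

lemma jetE_commutator23:
  "jetE2 a p (jetE3 a p G) 0 0 0 - jetE3 a p (jetE2 a p G) 0 0 0
    = 2 * (a 3 1 - a 2 1) * G 2 0 0 + 2 * p $ 3 * (a 2 3 - a 2 2 - a 2 1) * G 1 1 0
      + 2 * p $ 2 * (a 3 3 - a 3 2 + a 3 1) * G 1 0 1 - 2 * a 2 2 * G 0 2 0 + 2 * a 3 3 * G 0 0 2"
  by (simp add: jetE2_def jetE3_def gdefs eval_nat_numeral) algebra

section \<open>Solution germs and jet solutions\<close>

lemma jet_of_zero: "jet_of p (\<lambda>t. 0) i j k = 0"
proof -
  have "(partial m ^^ n) (\<lambda>t. 0) = (\<lambda>t. 0)" for m n
    by (induction n) (simp_all add: partial_const_fun)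
  then show ?thesis by (simp add: jet_of_def mixed_partial_def)
qed

definition is_jet_solution :: "(nat \<Rightarrow> nat \<Rightarrow> complex) \<Rightarrow> complex ^ 3 \<Rightarrow> jet \<Rightarrow> bool" where
  "is_jet_solution a p G \<longleftrightarrow>
     jetE1 a p G = (\<lambda>i j k. 0) \<and> jetE2 a p G = (\<lambda>i j k. 0) \<and> jetE3 a p G = (\<lambda>i j k. 0)"

lemma is_jet_solution_sum:
  assumes "finite S" "\<And>s. s \<in> S \<Longrightarrow> is_jet_solution a p (H s)"
  shows "is_jet_solution a p (\<lambda>i j k. \<Sum>s\<in>S. c s * H s i j k)"
  using assms(2) by (simp add: is_jet_solution_def jet_linear_sum[OF _ assms(1)] jet_linear_jetE)

lemma is_jet_solution_diff:
  assumes "is_jet_solution a p G" "is_jet_solution a p H"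
  shows "is_jet_solution a p (\<lambda>i j k. G i j k - H i j k)"
  using assms by (simp add: is_jet_solution_def jet_linear_diff jet_linear_jetE)

abbreviation (input) system_ideal :: "(nat \<Rightarrow> nat \<Rightarrow> complex) \<Rightarrow> diffop set" where
  "system_ideal a \<equiv> left_ideal {E1 a, E2 a, E3 a}"

lemma local_solution_jet:
  assumes "u \<in> local_solutions (system_ideal a) p"
  shows "\<exists>r>0. holomorphic3_on u (ball p r)" and "is_jet_solution a p (jet_of p u)"
proof -
  obtain U where U: "open U" "p \<in> U" "holomorphic3_on u U"
    and P: "\<And>P t. P \<in> system_ideal a \<Longrightarrow> t \<in> U \<Longrightarrow> P u t = 0"
    using assms by (auto simp: local_solutions_def)
  obtain r where "r > 0" "ball p r \<subseteq> U" using U(1,2) openE by blast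
  then show "\<exists>r>0. holomorphic3_on u (ball p r)"
    using holomorphic3_on_subset[OF U(3)] by blast
  interpret jet_at U p by unfold_locales (use U in auto)
  have z: "E1 a u t = 0" "E2 a u t = 0" "E3 a u t = 0" if "t \<in> U" for t
    using P[OF left_ideal.gen that] by auto
  show "is_jet_solution a p (jet_of p u)"
    unfolding is_jet_solution_def fun_eq_iff
      jet_of_E1[OF U(3), symmetric] jet_of_E2[OF U(3), symmetric] jet_of_E3[OF U(3), symmetric]
    using jet_of_cong[of "E1 a u" "\<lambda>t. 0"] jet_of_cong[of "E2 a u" "\<lambda>t. 0"] jet_of_cong[of "E3 a u" "\<lambda>t. 0"] z
    by (simp add: jet_of_zero)
qed

text \<open>The growth bound makes the jet converge to some \<open>u\<close>. Each
  \<open>E_i u\<close> then has zero jet and vanishes by the identity theorem.\<close>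

lemma jet_solution_realize:
  assumes "generic p" "is_jet_solution a p G"
  shows "\<exists>u \<in> local_solutions (system_ideal a) p. jet_of p u = G"
proof -
  note E = assms(2)[unfolded is_jet_solution_def]
  obtain A M where "0 \<le> A" "0 \<le> M" "\<And>i j k. norm (G i j k) \<le> A * M ^ (i + j + k) * fact (i + j + k)"
    using jet_solution_growth[OF assms(1)] E by blast
  from jet_realize[OF this, of p] obtain u r where u: "0 < r" "holomorphic3_on u (ball p r)"
    and jet': "jet_of p u = G" by blast
  interpret jet_at "ball p r" p by unfold_locales (use u in auto)
  have "E1 a u t = 0" "E2 a u t = 0" "E3 a u t = 0" if "t \<in> ball p r" for t
    by (rule jet_zero_imp_zero[OF holomorphic3_on_E1[OF u(2)] _ that]
        jet_zero_imp_zero[OF holomorphic3_on_E2[OF u(2)] _ that]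
        jet_zero_imp_zero[OF holomorphic3_on_E3[OF u(2)] _ that];
        simp add: jet_of_E1[OF u(2)] jet_of_E2[OF u(2)] jet_of_E3[OF u(2)] jet' E)+
  then have "P u t = 0" if "P \<in> system_ideal a" "t \<in> ball p r" for P t
    by (intro left_ideal_vanish[OF that(1) open_ball _ that(2)]) auto
  then have "u \<in> local_solutions (system_ideal a) p"
    using u by (auto simp: local_solutions_def intro!: exI[of _ "ball p r"])
  with jet' show ?thesis by blast
qed

text \<open>For \<open>k < 8\<close> the binary digits of \<open>k\<close> run through the exponents
  \<open>\<epsilon>\<close> of the eight free derivatives.\<close>

definition corner :: "jet \<Rightarrow> nat \<Rightarrow> complex" where
  "corner G k = G (k mod 2) (k div 2 mod 2) (k div 4)"

lemma corner_index:
  assumes "i \<le> 1" "j \<le> 1" "k \<le> 1"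
  shows "i + 2 * j + 4 * k < 8" "corner G (i + 2 * j + 4 * k) = G i j k"
proof -
  have "i = 0 \<or> i = 1" "j = 0 \<or> j = 1" "k = 0 \<or> k = 1" using assms by auto
  then show "i + 2 * j + 4 * k < 8" "corner G (i + 2 * j + 4 * k) = G i j k"
    by (elim disjE; simp add: corner_def)+
qed

lemma jet_solution_unique_corner:
  assumes "generic p" "is_jet_solution a p G" "\<And>k. k < 8 \<Longrightarrow> corner G k = 0"
  shows "G i j k = 0"
proof (rule jet_solution_unique[OF assms(1)])
  show "jetE1 a p G = (\<lambda>i j k. 0)" "jetE2 a p G = (\<lambda>i j k. 0)" "jetE3 a p G = (\<lambda>i j k. 0)"
    using assms(2) by (auto simp: is_jet_solution_def)
  show "G i j k = 0" if "i \<le> 1" "j \<le> 1" "k \<le> 1" for i j k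
    using assms(3)[OF corner_index(1)[OF that]] corner_index(2)[OF that, of G] by simp
qed

lemma common_ball:
  fixes n :: nat
  assumes "\<And>k. k < n \<Longrightarrow> \<exists>r>0. holomorphic3_on (B k) (ball p r)"
  shows "\<exists>r>0. \<forall>k<n. holomorphic3_on (B k) (ball p r)"
  using assms
proof (induction n)
  case (Suc n)
  then obtain r s where r: "r > 0" "\<forall>k<n. holomorphic3_on (B k) (ball p r)" "s > 0" "holomorphic3_on (B n) (ball p s)"
    by (meson less_Suc_eq)
  then have "holomorphic3_on (B k) (ball p (min r s))" if "k < Suc n" for k
    using that holomorphic3_on_subset[OF _ subset_ball] by (metis less_Suc_eq min.cobounded1 min.cobounded2)
  then show ?case using r by (intro exI[of _ "min r s"]) auto
qed (auto intro: exI[of _ 1])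

lemma eventually_zero_iff_jet:
  assumes "0 < r" "holomorphic3_on u (ball p r)"
  shows "(\<forall>\<^sub>F t in nhds p. u t = 0) \<longleftrightarrow> (\<forall>i j k. jet_of p u i j k = 0)"
proof
  assume "\<forall>\<^sub>F t in nhds p. u t = 0"
  then obtain S where S: "open S" "p \<in> S" "\<And>t. t \<in> S \<Longrightarrow> u t = 0"
    by (auto simp: eventually_nhds)
  interpret jet_at S p by unfold_locales (use S in auto)
  show "\<forall>i j k. jet_of p u i j k = 0"
    using jet_of_cong[of u "\<lambda>t. 0"] S(3) by (simp add: jet_of_zero)
next
  assume "\<forall>i j k. jet_of p u i j k = 0"
  then have "u t = 0" if "t \<in> ball p r" for t
    using jet_zero_imp_zero[OF assms(2) _ that] by blast
  moreover have "\<forall>\<^sub>F t in nhds p. t \<in> ball p r"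
    using assms(1) by (intro eventually_nhds_in_open) auto
  ultimately show "\<forall>\<^sub>F t in nhds p. u t = 0"
    by (auto elim: eventually_mono)
qed

lemma jet_of_lincomb:
  fixes B :: "nat \<Rightarrow> complex ^ 3 \<Rightarrow> complex"
  assumes "0 < r" "\<And>k. k < n \<Longrightarrow> holomorphic3_on (B k) (ball p r)"
  shows "jet_of p (\<lambda>t. \<Sum>k<n. c k * B k t) = (\<lambda>i j l. \<Sum>k<n. c k * jet_of p (B k) i j l)"
    and "holomorphic3_on (\<lambda>t. \<Sum>k<n. c k * B k t) (ball p r)"
proof -
  interpret jet_at "ball p r" p by unfold_locales (use assms in auto)
  show "jet_of p (\<lambda>t. \<Sum>k<n. c k * B k t) = (\<lambda>i j l. \<Sum>k<n. c k * jet_of p (B k) i j l)"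
    "holomorphic3_on (\<lambda>t. \<Sum>k<n. c k * B k t) (ball p r)"
    using jet_of_sum[of "{..<n}" B c] assms(2) by (auto simp: fun_eq_iff)
qed

section \<open>Rank eight in terms of jets\<close>

text \<open>The corner values are injective on solutions, so on an eight-dimensional solution space
  they take all values.\<close>

lemma rank8_imp_jets:
  assumes "generic p" "solution_germs_dim (system_ideal a) p 8"
  shows "\<exists>G. is_jet_solution a p G \<and> (\<forall>k<8. corner G k = y k)"
proof -
  obtain B :: "nat \<Rightarrow> complex ^ 3 \<Rightarrow> complex" where B': "\<forall>k<8. B k \<in> local_solutions (system_ideal a) p"
    and ind: "\<forall>c. (\<forall>\<^sub>F t in nhds p. (\<Sum>k<8. c k * B k t) = 0) \<longrightarrow> (\<forall>k<8. c k = 0)"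
    using assms(2) unfolding solution_germs_dim_def by blast
  then have B: "B k \<in> local_solutions (system_ideal a) p" if "k < 8" for k
    using that by blast
  have "\<exists>r>0. \<forall>k<8. holomorphic3_on (B k) (ball p r)"
    by (rule common_ball) (rule local_solution_jet(1)[OF B])
  then obtain r where r: "r > 0" "\<And>k. k < 8 \<Longrightarrow> holomorphic3_on (B k) (ball p r)"
    by blast
  have lin: "jet_of p (\<lambda>t. \<Sum>k<8. c k * B k t) = (\<lambda>i j l. \<Sum>k<8. c k * jet_of p (B k) i j l)"
    "holomorphic3_on (\<lambda>t. \<Sum>k<8. c k * B k t) (ball p r)" for c
    by (rule jet_of_lincomb[OF r(1)], rule r(2), assumption)+
  define A where "A = (\<lambda>k' k. corner (jet_of p (B k)) k')"
  define H where "H = (\<lambda>x i j l. \<Sum>k<8. x k * jet_of p (B k) i j l)"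
  have sol: "is_jet_solution a p (H x)" for x
    unfolding H_def by (rule is_jet_solution_sum) (auto intro: local_solution_jet(2) B)
  have corner_H: "corner (H x) k' = (\<Sum>k<8. A k' k * x k)" for x k'
    by (simp add: corner_def H_def A_def mult.commute)
  have "\<exists>x. \<forall>k'\<in>{..<8}. (\<Sum>k\<in>{..<8}. A k' k * x k) = y k'"
  proof (rule square_system_solvable)
    fix x k assume x: "\<And>k'. k' \<in> {..<8} \<Longrightarrow> (\<Sum>k<8. A k' k * x k) = 0" and "k \<in> {..<8::nat}"
    have "H x i j l = 0" for i j l
      by (rule jet_solution_unique_corner[OF assms(1) sol]) (use x in \<open>simp add: corner_H\<close>)
    then have "\<forall>\<^sub>F t in nhds p. (\<Sum>k<8. x k * B k t) = 0"
      unfolding eventually_zero_iff_jet[OF r(1) lin(2)] lin(1) by (simp add: H_def)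
    then show "x k = 0" using ind \<open>k \<in> {..<8}\<close> by auto
  qed simp
  then obtain x where "\<forall>k'<8. corner (H x) k' = y k'" by (auto simp: corner_H)
  with sol show ?thesis by blast
qed

text \<open>The basis is dual to the eight corner values; these values are the coefficients of any
  solution.\<close>

lemma commuting_imp_rank8:
  assumes "commuting_jets a p"
  shows "solution_germs_dim (system_ideal a) p 8"
proof -
  interpret commuting_jets a p by fact
  have "\<exists>u. u \<in> local_solutions (system_ideal a) p \<and> (\<forall>k'<8. corner (jet_of p u) k' = (if k' = k then 1 else 0))"
    for k
  proof -
    obtain G where G: "is_jet_solution a p G"
      "\<And>i j l. i \<le> 1 \<Longrightarrow> j \<le> 1 \<Longrightarrow> l \<le> 1 \<Longrightarrow> G i j l = (if i + 2 * j + 4 * l = k then 1 else 0)"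
      unfolding is_jet_solution_def
      by (rule formal_solution_exists[of "\<lambda>i j l. if i + 2 * j + 4 * l = k then 1 else 0"]) blast
    have "corner G k' = (if k' = k then 1 else 0)" if "k' < 8" for k'
    proof -
      have "k' mod 2 + 2 * (k' div 2 mod 2) + 4 * (k' div 4) = k'" by presburger
      moreover have "k' mod 2 \<le> 1" "k' div 2 mod 2 \<le> 1" "k' div 4 \<le> 1" using that by auto
      ultimately show ?thesis unfolding corner_def by (subst G(2)) auto
    qed
    with jet_solution_realize[OF generic G(1)] show ?thesis by metis
  qed
  then obtain B where B: "\<And>k. B k \<in> local_solutions (system_ideal a) p"
    "\<And>k k'. k' < 8 \<Longrightarrow> corner (jet_of p (B k)) k' = (if k' = k then 1 else 0)"
    by metis
  have corner_sum: "corner (\<lambda>i j l. \<Sum>k<8. c k * jet_of p (B k) i j l) k' = c k'" if "k' < 8" for c k'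
  proof -
    have "corner (\<lambda>i j l. \<Sum>k<8. c k * jet_of p (B k) i j l) k' = (\<Sum>k<8. c k * corner (jet_of p (B k)) k')"
      by (simp add: corner_def)
    also have "\<dots> = (\<Sum>k<8. if k' = k then c k else 0)"
      by (intro sum.cong) (auto simp: B(2)[OF that])
    finally show ?thesis using that by simp
  qed
  show ?thesis
    unfolding solution_germs_dim_def
  proof (intro exI[of _ B] conjI allI impI ballI)
    show "B k \<in> local_solutions (system_ideal a) p" for k by (rule B)
  next
    fix c :: "nat \<Rightarrow> complex" and k :: nat
    assume z: "\<forall>\<^sub>F t in nhds p. (\<Sum>k<8. c k * B k t) = 0" and k: "k < 8"
    have "\<exists>r>0. \<forall>k<8. holomorphic3_on (B k) (ball p r)"
      by (rule common_ball) (rule local_solution_jet(1)[OF B(1)])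
    then obtain r where r: "r > 0" "\<And>k. k < 8 \<Longrightarrow> holomorphic3_on (B k) (ball p r)"
      by blast
    have lin: "jet_of p (\<lambda>t. \<Sum>k<8. c k * B k t) = (\<lambda>i j l. \<Sum>k<8. c k * jet_of p (B k) i j l)"
      "holomorphic3_on (\<lambda>t. \<Sum>k<8. c k * B k t) (ball p r)" for c
      by (rule jet_of_lincomb[OF r(1)], rule r(2), assumption)+
    have "(\<Sum>k<8. c k * jet_of p (B k) i j l) = 0" for i j l
      using z unfolding eventually_zero_iff_jet[OF r(1) lin(2)] lin(1) by blast
    then show "c k = 0"
      using corner_sum[OF k, of c] by (simp add: corner_def)
  next
    fix u assume u: "u \<in> local_solutions (system_ideal a) p"
    define c where "c = corner (jet_of p u)"
    \<comment> \<open>Appending \<open>u\<close> as a ninth function provides a common ball and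
      makes the difference to be shown zero a single linear combination.\<close>
    define B' where "B' = (\<lambda>k. if k < 8 then B k else u)"
    have "\<exists>r>0. holomorphic3_on (B' k) (ball p r)" for k
      using local_solution_jet(1)[OF B(1)] local_solution_jet(1)[OF u] by (simp add: B'_def)
    then have "\<exists>r>0. \<forall>k<9. holomorphic3_on (B' k) (ball p r)"
      by (rule common_ball)
    then obtain r where r: "r > 0" "\<And>k. k < 9 \<Longrightarrow> holomorphic3_on (B' k) (ball p r)"
      by blast
    have lin: "jet_of p (\<lambda>t. \<Sum>k<9. c k * B' k t) = (\<lambda>i j l. \<Sum>k<9. c k * jet_of p (B' k) i j l)"
      "holomorphic3_on (\<lambda>t. \<Sum>k<9. c k * B' k t) (ball p r)" for c
      by (rule jet_of_lincomb[OF r(1)], rule r(2), assumption)+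
    define e where "e = (\<lambda>k. if k < 8 then - c k else (1::complex))"
    have split: "(\<Sum>k<9. e k * F (B' k)) = F u - (\<Sum>k<8. c k * F (B k))" for F :: "(complex ^ 3 \<Rightarrow> complex) \<Rightarrow> complex"
    proof -
      have "(\<Sum>k<9. e k * F (B' k)) = (\<Sum>k<Suc 8. e k * F (B' k))" by simp
      also have "\<dots> = (\<Sum>k<8. e k * F (B' k)) + F u"
        unfolding sum.lessThan_Suc by (simp add: e_def B'_def)
      also have "(\<Sum>k<8. e k * F (B' k)) = - (\<Sum>k<8. c k * F (B k))"
        unfolding sum_negf[symmetric] by (intro sum.cong) (auto simp: e_def B'_def)
      finally show ?thesis by simp
    qed
    let ?v = "\<lambda>t. \<Sum>k<9. e k * B' k t"
    have v: "?v t = u t - (\<Sum>k<8. c k * B k t)" for t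
      using split[of "\<lambda>f. f t"] .
    have jv: "jet_of p ?v = (\<lambda>i j l. jet_of p u i j l - (\<Sum>k<8. c k * jet_of p (B k) i j l))"
      unfolding lin(1)
    proof (intro ext)
      fix i j l
      show "(\<Sum>k<9. e k * jet_of p (B' k) i j l) = jet_of p u i j l - (\<Sum>k<8. c k * jet_of p (B k) i j l)"
        using split[of "\<lambda>f. jet_of p f i j l"] .
    qed
    have "is_jet_solution a p (jet_of p ?v)"
      unfolding jv by (intro is_jet_solution_diff is_jet_solution_sum local_solution_jet(2) u B) simp
    moreover have "corner (jet_of p ?v) k = 0" if "k < 8" for k
      using corner_sum[OF that, of c] unfolding jv by (simp add: c_def corner_def)
    ultimately have "jet_of p ?v i j l = 0" for i j l
      by (rule jet_solution_unique_corner[OF generic])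
    then have "\<forall>\<^sub>F t in nhds p. ?v t = 0"
      unfolding eventually_zero_iff_jet[OF r(1) lin(2)] by blast
    then show "\<exists>c. \<forall>\<^sub>F t in nhds p. u t = (\<Sum>k<8. c k * B k t)"
      unfolding v by (intro exI[of _ c]) simp
  qed
qed

section \<open>Polynomials and generic points\<close>

definition X1 :: "complex poly poly poly" where "X1 = [:[:[:0, 1:]:]:]"
definition X2 :: "complex poly poly poly" where "X2 = [:[:0, 1:]:]"
definition X3 :: "complex poly poly poly" where "X3 = [:0, 1:]"

lemma eval3_simps:
  "eval3 (f + g) t = eval3 f t + eval3 g t" "eval3 (f - g) t = eval3 f t - eval3 g t"
  "eval3 (f * g) t = eval3 f t * eval3 g t" "eval3 1 t = 1" "eval3 0 t = 0" "eval3 2 t = 2"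
  "eval3 X1 t = t $ 1" "eval3 X2 t = t $ 2" "eval3 X3 t = t $ 3"
  by (simp_all add: eval3_def X1_def X2_def X3_def)

text \<open>\<open>f\<close> will embed the scalars as constants at each level of the iterated
  polynomial ring.\<close>

lemma exists_nonroot:
  fixes q :: "'a::idom poly"
  assumes "q \<noteq> 0" "inj f" "infinite S"
  shows "\<exists>c\<in>S. poly q (f c) \<noteq> 0"
proof (rule ccontr)
  assume "\<not> ?thesis"
  then have "f ` S \<subseteq> {x. poly q x = 0}" by auto
  then have "finite (f ` S)"
    using poly_roots_finite[OF assms(1)] finite_subset by blast
  then show False
    using assms(2,3) finite_imageD inj_on_subset by blast
qed

text \<open>The coordinates are chosen from the outermost variable inwards, keeping the partially
  evaluated polynomial nonzero. A third of \<open>r\<close> for each suffices, as the norm is at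
  most the sum of the coordinate norms.\<close>

lemma eval3_nonzero_near:
  assumes "h \<noteq> 0" "0 < r"
  shows "\<exists>t\<in>ball p r. eval3 h t \<noteq> 0"
proof -
  have inf: "infinite (ball (x :: complex) (r / 3))" for x
    using assms(2) by (intro uncountable_infinite uncountable_ball) simp
  have inj: "inj (\<lambda>c :: complex. [:[:c:]:])" "inj (\<lambda>c :: complex. [:c:])" "inj (\<lambda>c :: complex. c)"
    by (auto simp: inj_def)
  obtain c3 where c3: "c3 \<in> ball (p $ 3) (r / 3)" "poly h [:[:c3:]:] \<noteq> 0"
    using exists_nonroot[OF assms(1) inj(1) inf] by blast
  obtain c2 where c2: "c2 \<in> ball (p $ 2) (r / 3)" "poly (poly h [:[:c3:]:]) [:c2:] \<noteq> 0"
    using exists_nonroot[OF c3(2) inj(2) inf] by blast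
  obtain c1 where c1: "c1 \<in> ball (p $ 1) (r / 3)" "poly (poly (poly h [:[:c3:]:]) [:c2:]) c1 \<noteq> 0"
    using exists_nonroot[OF c2(2) inj(3) inf] by blast
  define t :: "complex ^ 3" where "t = vector [c1, c2, c3]"
  have t: "t $ 1 = c1" "t $ 2 = c2" "t $ 3 = c3"
    by (simp_all add: t_def)
  have "norm (p - t) \<le> (\<Sum>i\<in>UNIV. norm ((p - t) $ i))"
    unfolding norm_vec_def by (rule L2_set_le_sum) simp
  also have "\<dots> < r / 3 + r / 3 + r / 3"
    using c1(1) c2(1) c3(1) unfolding sum_3 by (simp add: t dist_norm)
  finally have "t \<in> ball p r" by (simp add: dist_norm)
  moreover have "eval3 h t \<noteq> 0" using c1(2) by (simp add: eval3_def t)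
  ultimately show ?thesis by blast
qed

text \<open>Density of the points with \<open>eval3 h t \<noteq> 0\<close> permits evaluating
  relations at points outside the generic set.\<close>

lemma continuous_zero_of_generic_zero:
  fixes f :: "complex ^ 3 \<Rightarrow> complex"
  assumes "h \<noteq> 0" "continuous_on UNIV f" "\<And>t. eval3 h t \<noteq> 0 \<Longrightarrow> f t = 0"
  shows "f p = 0"
proof (rule ccontr)
  assume "f p \<noteq> 0"
  have "open (f -` (- {0}))"
    by (rule open_vimage[OF _ assms(2)]) auto
  then obtain r where "r > 0" "ball p r \<subseteq> f -` (- {0})"
    using \<open>f p \<noteq> 0\<close> openE[of "f -` (- {0})" p] by auto
  with eval3_nonzero_near[OF assms(1), of r p] assms(3) show False by auto
qed

definition generic_poly :: "complex poly poly poly" where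
  "generic_poly = (let q1 = 1 - X1 * X1; q2 = 1 - X2 * X2; q3 = 1 - X3 * X3;
      k1 = X1 - X2 * X3; k2 = X2 - X3 * X1; k3 = X3 - X1 * X2
    in q1 * q2 * q3 * (q1 * q2 * q3 - q1 * (k1 * k1) - q2 * (k2 * k2) - q3 * (k3 * k3)
      - 2 * k1 * k2 * k3))"

lemma eval3_generic_poly: "eval3 generic_poly p \<noteq> 0 \<longleftrightarrow> generic p"
  by (simp add: generic_poly_def Let_def eval3_simps generic_def gdelta_def gdefs power2_eq_square)

lemma generic_poly_nonzero: "generic_poly \<noteq> 0"
proof -
  have "generic 0" by (simp add: generic_def gdelta_def gdefs)
  then have "eval3 generic_poly 0 \<noteq> 0" by (simp add: eval3_generic_poly)
  then show ?thesis by (auto simp: eval3_simps)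
qed

lemma commuting_system_rank8:
  assumes "a 1 1 = 0" "a 2 2 = 0" "a 3 3 = 0"
    and "a 1 2 = s" "a 1 3 = s" "a 2 1 = s" "a 2 3 = s" "a 3 1 = s" "a 3 2 = s"
  shows "has_rank (system_ideal a) 8"
  unfolding has_rank_def
proof (intro exI[of _ generic_poly] conjI allI impI)
  show "generic_poly \<noteq> 0" by (rule generic_poly_nonzero)
  fix p assume "eval3 generic_poly p \<noteq> 0"
  then have "commuting_jets a p"
    using assms jetE12_commute[of a s p] jetE13_commute[of a s p] jetE23_commute[of a s p]
    by unfold_locales (auto simp: eval3_generic_poly)
  then show "solution_germs_dim (system_ideal a) p 8" by (rule commuting_imp_rank8)
qed

section \<open>Necessity of the conditions\<close>

text \<open>With all derivatives below order two equal to zero, the three equations express the pure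
  second derivatives through the mixed ones, and the commutators become relations between second
  derivatives alone.\<close>

lemma jet_solution_relations:
  assumes "generic p" "is_jet_solution a p G"
    and "G 0 0 0 = 0" "G 1 0 0 = 0" "G 0 1 0 = 0" "G 0 0 1 = 0"
  shows "gq1 p * G 2 0 0 = - gk3 p * G 1 1 0 - gk2 p * G 1 0 1 + gk1 p * G 0 1 1"
    "gq2 p * G 0 2 0 = - gk3 p * G 1 1 0 - gk1 p * G 0 1 1 + gk2 p * G 1 0 1"
    "gq3 p * G 0 0 2 = - gk2 p * G 1 0 1 - gk1 p * G 0 1 1 + gk3 p * G 1 1 0"
    "- a 1 1 * G 2 0 0 + p $ 2 * (a 1 2 - a 1 3 - a 1 1) * G 1 0 1 + a 2 2 * G 0 2 0
      + p $ 1 * (a 2 3 + a 2 2 - a 2 1) * G 0 1 1 + (a 2 3 - a 1 3) * G 0 0 2 = 0"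
    "(a 3 1 - a 2 1) * G 2 0 0 + p $ 3 * (a 2 3 - a 2 2 - a 2 1) * G 1 1 0
      + p $ 2 * (a 3 3 - a 3 2 + a 3 1) * G 1 0 1 - a 2 2 * G 0 2 0 + a 3 3 * G 0 0 2 = 0"
proof -
  note E = assms(2)[unfolded is_jet_solution_def]
  have z: "jetE1 a p (\<lambda>i j k. 0) 0 0 0 = 0" "jetE2 a p (\<lambda>i j k. 0) 0 0 0 = 0" "jetE3 a p (\<lambda>i j k. 0) 0 0 0 = 0"
    by (simp_all add: jetE1_def jetE2_def jetE3_def)
  have C: "jetE1 a p (jetE2 a p G) 0 0 0 - jetE2 a p (jetE1 a p G) 0 0 0 = 0"
    "jetE2 a p (jetE3 a p G) 0 0 0 - jetE3 a p (jetE2 a p G) 0 0 0 = 0"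
    using E z by simp_all
  show "- a 1 1 * G 2 0 0 + p $ 2 * (a 1 2 - a 1 3 - a 1 1) * G 1 0 1 + a 2 2 * G 0 2 0
      + p $ 1 * (a 2 3 + a 2 2 - a 2 1) * G 0 1 1 + (a 2 3 - a 1 3) * G 0 0 2 = 0"
    using jetE_commutator12[of a p G, unfolded C(1)] by algebra
  show "(a 3 1 - a 2 1) * G 2 0 0 + p $ 3 * (a 2 3 - a 2 2 - a 2 1) * G 1 1 0
      + p $ 2 * (a 3 3 - a 3 2 + a 3 1) * G 1 0 1 - a 2 2 * G 0 2 0 + a 3 3 * G 0 0 2 = 0"
    using jetE_commutator23[of a p G, unfolded C(2)] by algebra
  have v: "jetE1 a p G 0 0 0 = 0" "jetE2 a p G 0 0 0 = 0" "jetE3 a p G 0 0 0 = 0"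
    using E by simp_all
  have e: "gq2 p * G 0 2 0 + 2 * gk1 p * G 0 1 1 + gq3 p * G 0 0 2 = 0"
    "gq3 p * G 0 0 2 + 2 * gk2 p * G 1 0 1 + gq1 p * G 2 0 0 = 0"
    "gq1 p * G 2 0 0 + 2 * gk3 p * G 1 1 0 + gq2 p * G 0 2 0 = 0"
    using v assms(3-6) by (simp_all add: jetE1_def jetE2_def jetE3_def eval_nat_numeral)
  show "gq1 p * G 2 0 0 = - gk3 p * G 1 1 0 - gk2 p * G 1 0 1 + gk1 p * G 0 1 1"
    "gq2 p * G 0 2 0 = - gk3 p * G 1 1 0 - gk1 p * G 0 1 1 + gk2 p * G 1 0 1"
    "gq3 p * G 0 0 2 = - gk2 p * G 1 0 1 - gk1 p * G 0 1 1 + gk3 p * G 1 1 0"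
    using e by algebra+
qed

text \<open>Rank eight allows a solution with a single mixed second derivative equal to
  \<open>1\<close> and the other corner values \<open>0\<close>. Inserting it into a commutator
  relation and clearing the denominators \<open>gq\<close> isolates coefficients.\<close>

lemma rank8_relations:
  assumes "generic p" "solution_germs_dim (system_ideal a) p 8"
  shows "gk3 p * (a 1 1 * gq2 p * gq3 p - a 2 2 * gq1 p * gq3 p + (a 2 3 - a 1 3) * gq1 p * gq2 p) = 0"
    and "gk1 p * ((a 3 1 - a 2 1) * gq2 p * gq3 p + a 2 2 * gq1 p * gq3 p - a 3 3 * gq1 p * gq2 p) = 0"
    and "a 1 1 = 0 \<Longrightarrow> a 2 2 = 0 \<Longrightarrow> a 2 3 = a 1 3 \<Longrightarrow> p $ 2 * (a 1 2 - a 1 3) = 0"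
    and "a 1 1 = 0 \<Longrightarrow> a 2 2 = 0 \<Longrightarrow> a 2 3 = a 1 3 \<Longrightarrow> p $ 1 * (a 2 3 - a 2 1) = 0"
    and "a 3 1 = a 2 1 \<Longrightarrow> a 2 2 = 0 \<Longrightarrow> a 3 3 = 0 \<Longrightarrow> p $ 2 * (a 3 1 - a 3 2) = 0"
proof -
  have ex: "\<exists>G. is_jet_solution a p G \<and> G 0 0 0 = 0 \<and> G 1 0 0 = 0 \<and> G 0 1 0 = 0 \<and> G 0 0 1 = 0
      \<and> G 1 1 0 = y3 \<and> G 1 0 1 = y5 \<and> G 0 1 1 = y6" for y3 y5 y6
  proof -
    \<comment> \<open>\<open>3\<close>, \<open>5\<close>, \<open>6\<close> are the binary codes of
      \<open>(1,1,0)\<close>, \<open>(1,0,1)\<close>, \<open>(0,1,1)\<close>.\<close>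
    define y where "y = (\<lambda>n :: nat. if n = 3 then y3 else if n = 5 then y5 else if n = 6 then y6 else (0 :: complex))"
    obtain G where sol: "is_jet_solution a p G" and G: "\<And>k. k < 8 \<Longrightarrow> corner G k = y k"
      using rank8_imp_jets[OF assms, of y] by blast
    have "G 0 0 0 = 0 \<and> G 1 0 0 = 0 \<and> G 0 1 0 = 0 \<and> G 0 0 1 = 0
      \<and> G 1 1 0 = y3 \<and> G 1 0 1 = y5 \<and> G 0 1 1 = y6"
      using G[of 0] G[of 1] G[of 2] G[of 3] G[of 4] G[of 5] G[of 6] by (simp add: corner_def y_def)
    with sol show ?thesis by blast
  qed
  have q: "gq1 p \<noteq> 0" "gq2 p \<noteq> 0" "gq3 p \<noteq> 0" using assms(1) by (auto simp: generic_def)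
  obtain G where G: "is_jet_solution a p G" "G 0 0 0 = 0" "G 1 0 0 = 0" "G 0 1 0 = 0" "G 0 0 1 = 0"
    "G 1 1 0 = 1" "G 1 0 1 = 0" "G 0 1 1 = 0" using ex[of 1 0 0] by blast
  note r = jet_solution_relations[OF assms(1) G(1-5), unfolded G(6-8)]
  show "gk3 p * (a 1 1 * gq2 p * gq3 p - a 2 2 * gq1 p * gq3 p + (a 2 3 - a 1 3) * gq1 p * gq2 p) = 0"
    using r(1-4) by algebra
  obtain G where G: "is_jet_solution a p G" "G 0 0 0 = 0" "G 1 0 0 = 0" "G 0 1 0 = 0" "G 0 0 1 = 0"
    "G 1 1 0 = 0" "G 1 0 1 = 0" "G 0 1 1 = 1" using ex[of 0 0 1] by blast
  note r = jet_solution_relations[OF assms(1) G(1-5), unfolded G(6-8)]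
  show "gk1 p * ((a 3 1 - a 2 1) * gq2 p * gq3 p + a 2 2 * gq1 p * gq3 p - a 3 3 * gq1 p * gq2 p) = 0"
    using r(1-3,5) by algebra
  show "a 1 1 = 0 \<Longrightarrow> a 2 2 = 0 \<Longrightarrow> a 2 3 = a 1 3 \<Longrightarrow> p $ 1 * (a 2 3 - a 2 1) = 0"
    using r(4) by simp
  obtain G where G: "is_jet_solution a p G" "G 0 0 0 = 0" "G 1 0 0 = 0" "G 0 1 0 = 0" "G 0 0 1 = 0"
    "G 1 1 0 = 0" "G 1 0 1 = 1" "G 0 1 1 = 0" using ex[of 0 1 0] by blast
  note r = jet_solution_relations[OF assms(1) G(1-5), unfolded G(6-8)]
  show "a 1 1 = 0 \<Longrightarrow> a 2 2 = 0 \<Longrightarrow> a 2 3 = a 1 3 \<Longrightarrow> p $ 2 * (a 1 2 - a 1 3) = 0"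
    using r(4) by simp
  show "a 3 1 = a 2 1 \<Longrightarrow> a 2 2 = 0 \<Longrightarrow> a 3 3 = 0 \<Longrightarrow> p $ 2 * (a 3 1 - a 3 2) = 0"
    using r(5) by simp
qed

lemma rank8_imp_conditions:
  assumes "has_rank (system_ideal a) 8"
  shows "a 1 1 = 0" "a 2 2 = 0" "a 3 3 = 0"
    "a 1 2 = a 1 3" "a 1 3 = a 2 1" "a 2 1 = a 2 3" "a 2 3 = a 3 1" "a 3 1 = a 3 2"
proof -
  obtain h where h: "h \<noteq> 0" "\<And>p. eval3 h p \<noteq> 0 \<Longrightarrow> solution_germs_dim (system_ideal a) p 8"
    using assms unfolding has_rank_def by blast
  \<comment> \<open>A sample point certifying that the additional factors, by which the relations
    will be divided, form a nonzero polynomial.\<close>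
  have ev: "eval3 ((X1 - X2 * X3) * (X3 - X1 * X2) * X1 * X2) (vector [2, 3, 5]) \<noteq> 0"
    by (simp add: eval3_simps)
  define H where "H = h * (generic_poly * ((X1 - X2 * X3) * (X3 - X1 * X2) * X1 * X2))"
  have H: "H \<noteq> 0"
    using h(1) generic_poly_nonzero ev unfolding H_def by (auto simp: eval3_simps(5))
  have D: "generic p" "solution_germs_dim (system_ideal a) p 8" "gk1 p \<noteq> 0" "gk3 p \<noteq> 0" "p $ 1 \<noteq> 0" "p $ 2 \<noteq> 0"
    if "eval3 H p \<noteq> 0" for p
    using that h(2)[of p] eval3_generic_poly[of p] by (auto simp: H_def eval3_simps gdefs)
  have c: "continuous_on UNIV gq1" "continuous_on UNIV gq2" "continuous_on UNIV gq3"
    unfolding gq1_def gq2_def gq3_def by (intro continuous_intros)+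
  have R1: "a 1 1 * gq2 p * gq3 p - a 2 2 * gq1 p * gq3 p + (a 2 3 - a 1 3) * gq1 p * gq2 p = 0" for p
    by (rule continuous_zero_of_generic_zero[OF H])
      (use rank8_relations(1)[OF D(1,2)] D(4) in \<open>auto intro!: continuous_intros c\<close>)
  have R2: "(a 3 1 - a 2 1) * gq2 p * gq3 p + a 2 2 * gq1 p * gq3 p - a 3 3 * gq1 p * gq2 p = 0" for p
    by (rule continuous_zero_of_generic_zero[OF H])
      (use rank8_relations(2)[OF D(1,2)] D(3) in \<open>auto intro!: continuous_intros c\<close>)
  have ax: "axis i (1 :: complex) $ j = (if j = i then 1 else 0)" for i j :: 3
    by (simp add: axis_def)
  \<comment> \<open>At \<open>axis i 1\<close> the \<open>i\<close>-th \<open>gq\<close> is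
    \<open>0\<close> and the other two are \<open>1\<close>, so one coefficient survives in each
    relation. These points are not generic, which is why \<open>R1\<close> and \<open>R2\<close>
    were extended to all \<open>p\<close>.\<close>
  have 1: "a 1 1 = 0" "a 3 1 = a 2 1"
    using R1[of "axis 1 1"] R2[of "axis 1 1"] by (simp_all add: gdefs ax)
  have 2: "a 2 2 = 0"
    using R1[of "axis 2 1"] by (simp add: gdefs ax)
  have 3: "a 2 3 = a 1 3" "a 3 3 = 0"
    using R1[of "axis 3 1"] R2[of "axis 3 1"] by (simp_all add: gdefs ax)
  obtain p where p: "eval3 H p \<noteq> 0"
    using eval3_nonzero_near[OF H, of 1 0] by auto
  note rel = rank8_relations(3-5)[OF D(1,2)[OF p]]
  have 4: "a 1 2 = a 1 3" "a 2 3 = a 2 1" "a 3 1 = a 3 2"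
    using rel(1)[OF 1(1) 2 3(1)] rel(2)[OF 1(1) 2 3(1)] rel(3)[OF 1(2) 2 3(2)] D(5,6)[OF p] by auto
  show "a 1 1 = 0" "a 2 2 = 0" "a 3 3 = 0"
    "a 1 2 = a 1 3" "a 1 3 = a 2 1" "a 2 1 = a 2 3" "a 2 3 = a 3 1" "a 3 1 = a 3 2"
    using 1 2 3 4 by simp_all
qed

theorem theorem1p1:
  fixes a :: "nat \<Rightarrow> nat \<Rightarrow> complex"
  shows "has_rank (left_ideal {E1 a, E2 a, E3 a}) 8 \<longleftrightarrow>
     (a 1 1 = 0 \<and> a 2 2 = 0 \<and> a 3 3 = 0) \<and>
     (a 1 2 = a 1 3 \<and> a 1 3 = a 2 1 \<and> a 2 1 = a 2 3 \<and> a 2 3 = a 3 1 \<and> a 3 1 = a 3 2)"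
  using rank8_imp_conditions[of a] commuting_system_rank8[of a "a 3 2"] by metis

end
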